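(* A graphon property $\mathcal R\subseteq\mathcal W_0$ is testable if and only if for every $\varepsilon>0$ there is an $\varepsilon'>0$ such that $B_\square(\mathcal R,\varepsilon')\subseteq B_1(\mathcal R,\varepsilon)$.
   Context: Graphs are finite and simple; a graph property is a class of graphs invariant under isomorphism. $\mathcal W_0$ is the set of symmetric measurable functions $W:[0,1]^2\to[0,1]$. For a graph $F$ on $[k]$, $t(F,W)=\int_{[0,1]^k}\prod_{ij\in E(F)}W(x_i,x_j)\,dx$. Two functions $W_1,W_2\in\mathcal W_0$ are isomorphic if $t(F,W_1)=t(F,W_2)$ for every graph $F$. A function property is a subset of $\mathcal W_0$; a graphon property is a function property invariant under isomorphism. Norms: $\|W\|_1=\int_{[0,1]^2}|W|$ and $\|W\|_\square=\sup_{S,T\subseteq[0,1]}|\int_{S\times T}W|$ (sup over measurable $S,T$). $d_1(U,W)=\|U-W\|_1$, $d_\square(U,W)=\|U-W\|_\square$; the distance of a function from a set is the infimum of the distances to its elements. $B_1(S,c)=\{W\in\mathcal W_0: d_1(W,S)<c\}$, $B_\square(S,c)=\{W\in\mathcal W_0: d_\square(W,S)<c\}$ for $S\subseteq\mathcal W_0$, $c>0$. $W$-random graph: $\mathbb G(k,W)$ is obtained by choosing $X_1,\dots,X_k\in[0,1]$ independently and uniformly and then, for each $i<j$ independently, connecting $i$ and $j$ with probability $W(X_i,X_j)$. A function property $\mathcal R$ is testable if there is a graph property $\mathcal R'$ such that (a) $\Pr(\mathbb G(k,W)\in\mathcal R')\ge 2/3$ for every $W\in\mathcal R$ and every $k\ge1$,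 and (b) for every $\varepsilon>0$ there is a $k_\varepsilon\ge1$ such that $\Pr(\mathbb G(k,W)\in\mathcal R')\le1/3$ for every $k\ge k_\varepsilon$ and every $W\in\mathcal W_0$ with $d_1(W,\mathcal R)\ge\varepsilon$. *)

theory Defs
  imports "HOL-Probability.Probability"
begin

type_synonym graph = "nat set \<times> nat set set"

definition simple_graph :: "graph \<Rightarrow> bool" where
  "simple_graph G \<longleftrightarrow> finite (fst G) \<and> snd G \<subseteq> {e. e \<subseteq> fst G \<and> card e = 2}"

definition graph_isomorphic :: "graph \<Rightarrow> graph \<Rightarrow> bool" where
  "graph_isomorphic G H \<longleftrightarrow>
     (\<exists>f. bij_betw f (fst G) (fst H) \<and> snd H = (\<lambda>e. f ` e) ` snd G)"

definition graph_property :: "graph set \<Rightarrow> bool" where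
  "graph_property P \<longleftrightarrow>
     (\<forall>G\<in>P. simple_graph G) \<and>
     (\<forall>G H. G \<in> P \<longrightarrow> simple_graph H \<longrightarrow> graph_isomorphic G H \<longrightarrow> H \<in> P)"

text \<open>Measurability on \<open>[0,1]\<close> and \<open>[0,1]\<^sup>2\<close> is Borel measurability.\<close>

definition unit_interval :: "real measure" where
  "unit_interval = restrict_space lborel {0..1}"

definition unit_square :: "(real \<times> real) measure" where
  "unit_square = unit_interval \<Otimes>\<^sub>M unit_interval"

text \<open>Elements of \<open>W0\<close> are extensional, so that two of them are equal as soon as they agree
  on \<open>[0,1]\<^sup>2\<close>.\<close>

definition W0 :: "(real \<times> real \<Rightarrow> real) set" where
  "W0 = {W \<in> ({0..1} \<times> {0..1}) \<rightarrow>\<^sub>E {0..1}.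
     W \<in> borel_measurable unit_square \<and>
     (\<forall>x\<in>{0..1}. \<forall>y\<in>{0..1}. W (x, y) = W (y, x))}"

definition vertex_pairs :: "nat \<Rightarrow> (nat \<times> nat) set" where
  "vertex_pairs k = {(i, j). 1 \<le> i \<and> i < j \<and> j \<le> k}"

definition hom_density :: "nat \<Rightarrow> nat set set \<Rightarrow> (real \<times> real \<Rightarrow> real) \<Rightarrow> real" where
  "hom_density k E W =
     (\<integral>x. (\<Prod>(i, j)\<in>{(i, j) \<in> vertex_pairs k. {i, j} \<in> E}. W (x i, x j))
        \<partial>(\<Pi>\<^sub>M i\<in>{1..k}. unit_interval))"

definition isomorphic :: "(real \<times> real \<Rightarrow> real) \<Rightarrow> (real \<times> real \<Rightarrow> real) \<Rightarrow> bool" where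
  "isomorphic U W \<longleftrightarrow>
     (\<forall>k E. simple_graph ({1..k}, E) \<longrightarrow> hom_density k E U = hom_density k E W)"

definition graphon_property :: "(real \<times> real \<Rightarrow> real) set \<Rightarrow> bool" where
  "graphon_property R \<longleftrightarrow>
     R \<subseteq> W0 \<and> (\<forall>U\<in>R. \<forall>W\<in>W0. isomorphic U W \<longrightarrow> W \<in> R)"

definition L1_norm :: "(real \<times> real \<Rightarrow> real) \<Rightarrow> real" where
  "L1_norm W = (\<integral>z. \<bar>W z\<bar> \<partial>unit_square)"

definition cut_norm :: "(real \<times> real \<Rightarrow> real) \<Rightarrow> real" where
  "cut_norm W = (SUP (S, T)\<in>sets unit_interval \<times> sets unit_interval.
     \<bar>LINT z:S \<times> T|unit_square. W z\<bar>)"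

definition d_1 :: "(real \<times> real \<Rightarrow> real) \<Rightarrow> (real \<times> real \<Rightarrow> real) \<Rightarrow> real" where
  "d_1 U W = L1_norm (\<lambda>z. U z - W z)"

definition d_cut :: "(real \<times> real \<Rightarrow> real) \<Rightarrow> (real \<times> real \<Rightarrow> real) \<Rightarrow> real" where
  "d_cut U W = cut_norm (\<lambda>z. U z - W z)"

text \<open>Distances from a set are extended reals: the distance from the empty set is \<open>\<infinity>\<close>.\<close>

definition setdist_1 :: "(real \<times> real \<Rightarrow> real) \<Rightarrow> (real \<times> real \<Rightarrow> real) set \<Rightarrow> ereal" where
  "setdist_1 W S = (INF U\<in>S. ereal (d_1 W U))"

definition setdist_cut :: "(real \<times> real \<Rightarrow> real) \<Rightarrow> (real \<times> real \<Rightarrow> real) set \<Rightarrow> ereal" where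
  "setdist_cut W S = (INF U\<in>S. ereal (d_cut W U))"

definition B_1 :: "(real \<times> real \<Rightarrow> real) set \<Rightarrow> real \<Rightarrow> (real \<times> real \<Rightarrow> real) set" where
  "B_1 S c = {W \<in> W0. setdist_1 W S < ereal c}"

definition B_cut :: "(real \<times> real \<Rightarrow> real) set \<Rightarrow> real \<Rightarrow> (real \<times> real \<Rightarrow> real) set" where
  "B_cut S c = {W \<in> W0. setdist_cut W S < ereal c}"

text \<open>The random graph on \<open>{1..k}\<close> with independent edges, given the sample points \<open>x 1, \<dots>, x k\<close>.\<close>

definition sampled_graph :: "nat \<Rightarrow> (real \<times> real \<Rightarrow> real) \<Rightarrow> (nat \<Rightarrow> real) \<Rightarrow> graph pmf" where
  "sampled_graph k W x =
     map_pmf (\<lambda>b. ({1..k}, {{i, j} |i j. (i, j) \<in> vertex_pairs k \<and> b (i, j)}))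
       (Pi_pmf (vertex_pairs k) False (\<lambda>(i, j). bernoulli_pmf (W (x i, x j))))"

definition random_graph :: "nat \<Rightarrow> (real \<times> real \<Rightarrow> real) \<Rightarrow> graph measure" where
  "random_graph k W =
     (\<Pi>\<^sub>M i\<in>{1..k}. unit_interval) \<bind> (\<lambda>x. measure_pmf (sampled_graph k W x))"

definition testable :: "(real \<times> real \<Rightarrow> real) set \<Rightarrow> bool" where
  "testable R \<longleftrightarrow>
     (\<exists>P. graph_property P \<and>
        (\<forall>W\<in>R. \<forall>k\<ge>1. measure (random_graph k W) P \<ge> 2 / 3) \<and>
        (\<forall>\<epsilon>>0::real. \<exists>k\<^sub>0\<ge>1. \<forall>k\<ge>k\<^sub>0. \<forall>W\<in>W0. setdist_1 W R \<ge> ereal \<epsilon> \<longrightarrow>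
            measure (random_graph k W) P \<le> 1 / 3))"

end

theory Submission
  imports Defs
begin

text \<open>
  If a tester decides with samples of size \<open>k\<close>, then the acceptance probability is an integral of a
  polynomial in the values of the function and hence Lipschitz in the cut norm (counting lemma), so a function that
  is far from \<open>R\<close> in \<open>L\<^sub>1\<close> cannot be close to \<open>R\<close> in the cut norm.

  Conversely, accept a graph \<open>G\<close> on \<open>k\<close> vertices if some element of \<open>R\<close> is within \<open>\<delta>\<^sub>k\<close> in the cut norm
  of a step function of \<open>G\<close>, where \<open>\<delta>\<^sub>k\<close> tends to \<open>0\<close> slowly. A function \<open>W\<close> is, with high probability,
  close to a step function of \<open>G(k, W)\<close>. To see this, approximate \<open>W\<close> in the cut norm by a step
  function \<open>V\<close> with a bounded number of classes. The density of four-cycles controls the cut norm in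
  both directions, and its first moment carries the closeness of \<open>W\<close> and \<open>V\<close> over to the sample; the
  step function \<open>V\<close> itself is recovered by a measure-preserving rearrangement, since the class sizes
  in the sample concentrate. If \<open>U\<close> in \<open>R\<close> and \<open>W\<close> are both close to step functions of the same \<open>G\<close>, then
  a measure-preserving pullback of \<open>U\<close>, which is again in \<open>R\<close>, is close to \<open>W\<close>.
\<close>

section \<open>Four-cycle densities\<close>

text \<open>The cut norm is a supremum over pairs of sets, so its mean on a random sample cannot be
  computed term by term. For symmetric \<open>Z\<close>, \<open>four_cycle_density\<close> is the
  homomorphism density of the 4-cycle, the squared Hilbert-Schmidt norm of the composition of
  \<open>Z\<close> with itself. It is a polynomial in the values of \<open>Z\<close>, so its mean on
  a sample of k points is its value on the function up to O(1/k), and Markov's inequality does the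
  work of concentration or of a union bound over cuts. It is also invariant under pullback along
  measure-preserving maps that have no inverse. The price is a fourth root, harmless because only
  qualitative closeness is needed. A sampled graph is 0-1 valued, hence in general far from
  \<open>W\<close> in L1; but given the sample points the edges are independent with means in
  \<open>W\<close>, so in a cycle on distinct vertices the edge noise averages out. Both error
  probabilities of the tester come from one event, that the sample is close to
  \<open>W\<close>.\<close>

definition four_cycle_density :: "'a measure \<Rightarrow> ('a \<times> 'a \<Rightarrow> real) \<Rightarrow> real" where
  "four_cycle_density M Z = (\<integral>x. (\<integral>z. (\<integral>y. Z (x, y) * Z (y, z) \<partial>M)\<^sup>2 \<partial>M) \<partial>M)"

context prob_space
begin

lemma integrable_bounded:
  fixes f :: "'a \<Rightarrow> real"
  assumes "f \<in> borel_measurable M" "\<And>x. x \<in> space M \<Longrightarrow> \<bar>f x\<bar> \<le> B"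
  shows "integrable M f"
  using assms by (intro integrable_const_bound[of _ B]) (auto intro!: AE_I2)

text \<open>A non-integrable function has integral 0, which \<open>0 \<le> B\<close> covers; so the
  bound applies without a measurability side condition.\<close>

lemma abs_integral_le:
  fixes f :: "'a \<Rightarrow> real"
  assumes "\<And>x. x \<in> space M \<Longrightarrow> \<bar>f x\<bar> \<le> B" and "0 \<le> B"
  shows "\<bar>\<integral>x. f x \<partial>M\<bar> \<le> B"
proof (cases "integrable M f")
  case True
  have "\<bar>\<integral>x. f x \<partial>M\<bar> \<le> (\<integral>x. \<bar>f x\<bar> \<partial>M)" by (rule integral_abs_bound)
  also have "\<dots> \<le> (\<integral>x. B \<partial>M)"
    using assms True by (intro integral_mono_AE) (auto intro!: AE_I2)
  finally show ?thesis by (simp add: prob_space)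
next
  case False
  then show ?thesis using assms by (simp add: not_integrable_integral_eq)
qed

text \<open>Nonnegativity of the variance. It serves as the Cauchy-Schwarz inequality against the
  constant 1.\<close>

lemma square_integral_le:
  fixes f :: "'a \<Rightarrow> real"
  assumes [measurable]: "f \<in> borel_measurable M" and B: "\<And>x. x \<in> space M \<Longrightarrow> \<bar>f x\<bar> \<le> B"
  shows "(\<integral>x. f x \<partial>M)\<^sup>2 \<le> (\<integral>x. (f x)\<^sup>2 \<partial>M)"
proof -
  have 1: "integrable M f" by (rule integrable_bounded[OF _ B]) auto
  have 2: "integrable M (\<lambda>x. (f x)\<^sup>2)"
    by (rule integrable_bounded[where B="B\<^sup>2"]) (auto intro!: B power2_le_iff_abs_le[THEN iffD2] simp: order_trans[OF abs_ge_zero B])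
  show ?thesis using variance_eq[OF 1 2] variance_positive[of f] by simp
qed

lemma fubini_bounded:
  fixes f :: "'a \<Rightarrow> 'a \<Rightarrow> real"
  assumes [measurable]: "case_prod f \<in> borel_measurable (M \<Otimes>\<^sub>M M)"
    and B: "\<And>x y. x \<in> space M \<Longrightarrow> y \<in> space M \<Longrightarrow> \<bar>f x y\<bar> \<le> B"
  shows "(\<integral>x. (\<integral>y. f x y \<partial>M) \<partial>M) = (\<integral>y. (\<integral>x. f x y \<partial>M) \<partial>M)"
proof -
  interpret P: pair_prob_space M M ..
  have "integrable (M \<Otimes>\<^sub>M M) (case_prod f)"
    by (rule P.integrable_bounded[where B=B]) (auto simp: space_pair_measure B)
  then show ?thesis by (rule P.Fubini_integral[symmetric])
qed

lemma set_integral_Times: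
  fixes Z :: "'a \<times> 'a \<Rightarrow> real"
  assumes [measurable]: "Z \<in> borel_measurable (M \<Otimes>\<^sub>M M)" "S \<in> sets M" "T \<in> sets M"
    and B: "\<And>x y. x \<in> space M \<Longrightarrow> y \<in> space M \<Longrightarrow> \<bar>Z (x, y)\<bar> \<le> B"
  shows "(LINT z:S \<times> T|M \<Otimes>\<^sub>M M. Z z)
    = (\<integral>x. (\<integral>y. indicator S x * indicator T y * Z (x, y) \<partial>M) \<partial>M)"
proof -
  interpret P: pair_prob_space M M ..
  have "integrable (M \<Otimes>\<^sub>M M) (\<lambda>z. indicator (S \<times> T) z *\<^sub>R Z z)"
    using order_trans[OF abs_ge_zero B]
    by (intro P.integrable_bounded[where B=B])
       (auto simp: space_pair_measure B indicator_def)
  from P.integral_fst'[OF this, symmetric] show ?thesis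
    unfolding set_lebesgue_integral_def by (simp add: indicator_times)
qed

text \<open>Two applications of Cauchy-Schwarz, one per side of the rectangle. The first drops the
  indicator of \<open>S\<close> and doubles the variable in \<open>T\<close>, so that a codegree
  \<open>D y y'\<close> appears; the second drops the indicators of \<open>T\<close> and squares the
  codegree.\<close>

lemma rectangle_integral_power4_le:
  fixes Z :: "'a \<times> 'a \<Rightarrow> real"
  assumes [measurable]: "Z \<in> borel_measurable (M \<Otimes>\<^sub>M M)" "S \<in> sets M" "T \<in> sets M"
    and B: "\<And>x y. x \<in> space M \<Longrightarrow> y \<in> space M \<Longrightarrow> \<bar>Z (x, y)\<bar> \<le> 1"
    and sym: "\<And>x y. x \<in> space M \<Longrightarrow> y \<in> space M \<Longrightarrow> Z (x, y) = Z (y, x)"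
  shows "(LINT z:S \<times> T|M \<Otimes>\<^sub>M M. Z z) ^ 4 \<le> four_cycle_density M Z"
proof -
  define g where "g x = (\<integral>y. indicator T y * Z (x, y) \<partial>M)" for x
  define D where "D x z = (\<integral>y. Z (x, y) * Z (y, z) \<partial>M)" for x z
  define h where "h y y' = indicator T y * (indicator T y' * D y y')" for y y'
  have gm[measurable]: "g \<in> borel_measurable M" unfolding g_def by measurable
  have Dm[measurable]: "(\<lambda>(x, y). D x y) \<in> borel_measurable (M \<Otimes>\<^sub>M M)"
    unfolding D_def by measurable
  have hm[measurable]: "(\<lambda>(x, y). h x y) \<in> borel_measurable (M \<Otimes>\<^sub>M M)"
    unfolding h_def by measurable
  have gB: "\<bar>g x\<bar> \<le> 1" if "x \<in> space M" for x
    unfolding g_def using that B by (intro abs_integral_le) (auto simp: indicator_def)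
  have DB: "\<bar>D x z\<bar> \<le> 1" if "x \<in> space M" "z \<in> space M" for x z
    unfolding D_def using that B by (intro abs_integral_le) (auto simp: abs_mult intro!: mult_le_one)
  have hB: "\<bar>h x z\<bar> \<le> 1" if "x \<in> space M" "z \<in> space M" for x z
    unfolding h_def using DB[OF that] by (auto simp: indicator_def)
  have sq_le: "(\<integral>y'. (h y y')\<^sup>2 \<partial>M) \<le> 1" "(\<integral>y'. (D y y')\<^sup>2 \<partial>M) \<le> 1" if "y \<in> space M" for y
    using that by (auto intro!: abs_le_D1[OF abs_integral_le] hB DB simp: abs_square_le_1)
  have "(LINT z:S \<times> T|M \<Otimes>\<^sub>M M. Z z) = (\<integral>x. indicator S x * g x \<partial>M)"
    unfolding g_def
    by (subst set_integral_Times[where B=1]) (auto simp: B mult.assoc)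
  then have "(LINT z:S \<times> T|M \<Otimes>\<^sub>M M. Z z)\<^sup>2 = (\<integral>x. indicator S x * g x \<partial>M)\<^sup>2" by simp
  also have "\<dots> \<le> (\<integral>x. (indicator S x * g x)\<^sup>2 \<partial>M)"
    by (rule square_integral_le[where B=1]) (auto simp: indicator_def gB)
  also have "\<dots> \<le> (\<integral>x. (g x)\<^sup>2 \<partial>M)"
  proof (rule integral_mono)
    show "integrable M (\<lambda>x. (indicator S x * g x)\<^sup>2)" "integrable M (\<lambda>x. (g x)\<^sup>2)"
      by (rule integrable_bounded[where B=1]; auto simp: indicator_def gB abs_square_le_1)+
  qed (auto simp: indicator_def)
  \<comment> \<open>The square is written with two copies y, y' of the inner variable; two exchanges
    of integrals then make x innermost.\<close>
  also have "\<dots> = (\<integral>x. (\<integral>y. (\<integral>y'. indicator T y * Z (x, y) * (indicator T y' * Z (x, y')) \<partial>M) \<partial>M) \<partial>M)"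
    unfolding g_def power2_eq_square by (simp add: mult.commute)
  also have "\<dots> = (\<integral>y. (\<integral>x. (\<integral>y'. indicator T y * Z (x, y) * (indicator T y' * Z (x, y')) \<partial>M) \<partial>M) \<partial>M)"
    by (rule fubini_bounded[where B=1])
       (auto simp: abs_mult B indicator_def intro!: abs_integral_le mult_le_one)
  also have "\<dots> = (\<integral>y. (\<integral>y'. (\<integral>x. indicator T y * Z (x, y) * (indicator T y' * Z (x, y')) \<partial>M) \<partial>M) \<partial>M)"
  proof (rule Bochner_Integration.integral_cong[OF refl], rule fubini_bounded[where B=1])
    fix y assume [measurable]: "y \<in> space M"
    show "(\<lambda>(x, y'). indicator T y * Z (x, y) * (indicator T y' * Z (x, y'))) \<in> borel_measurable (M \<Otimes>\<^sub>M M)"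
      by measurable
  qed (auto simp: abs_mult B indicator_def intro!: mult_le_one)
  \<comment> \<open>Symmetry turns \<open>Z (x, y)\<close> into \<open>Z (y, x)\<close>, so the
    integral over x is \<open>D y y'\<close>.\<close>
  also have "\<dots> = (\<integral>y. (\<integral>y'. h y y' \<partial>M) \<partial>M)"
    unfolding h_def D_def
    by (intro Bochner_Integration.integral_cong refl)
       (auto simp: sym indicator_def intro!: Bochner_Integration.integral_cong)
  finally have 1: "(LINT z:S \<times> T|M \<Otimes>\<^sub>M M. Z z)\<^sup>2 \<le> (\<integral>y. (\<integral>y'. h y y' \<partial>M) \<partial>M)" .
  \<comment> \<open>The smaller side of the previous bound is a square, hence nonnegative, so
    squaring preserves the inequality.\<close>
  have "((LINT z:S \<times> T|M \<Otimes>\<^sub>M M. Z z)\<^sup>2)\<^sup>2 \<le> (\<integral>y. (\<integral>y'. h y y' \<partial>M) \<partial>M)\<^sup>2"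
    by (rule power_mono[OF 1]) auto
  also have "\<dots> \<le> (\<integral>y. (\<integral>y'. h y y' \<partial>M)\<^sup>2 \<partial>M)"
    by (rule square_integral_le[where B=1]) (auto intro!: abs_integral_le hB)
  also have "\<dots> \<le> (\<integral>y. (\<integral>y'. (h y y')\<^sup>2 \<partial>M) \<partial>M)"
    by (intro integral_mono integrable_bounded[where B=1] square_integral_le)
       (auto intro!: abs_integral_le hB simp: abs_square_le_1 sq_le)
  also have "\<dots> \<le> (\<integral>y. (\<integral>y'. (D y y')\<^sup>2 \<partial>M) \<partial>M)"
  proof (intro integral_mono integrable_bounded[where B=1])
    show "(h y y')\<^sup>2 \<le> (D y y')\<^sup>2" for y y' by (auto simp: h_def indicator_def)
  qed (auto intro!: abs_integral_le hB DB simp: abs_square_le_1 sq_le)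
  finally show ?thesis
    unfolding four_cycle_density_def D_def by (simp add: power_mult[symmetric])
qed

lemma four_cycle_density_nonneg: "0 \<le> four_cycle_density M Z"
  unfolding four_cycle_density_def by (intro Bochner_Integration.integral_nonneg) auto

text \<open>A bilinear form in weights bounded by 1 is largest at weights of modulus 1:
  \<open>f\<close> is replaced by the sign of \<open>h\<close>, then \<open>g\<close> by the sign of
  \<open>k\<close>. Two sign functions cut the square into four rectangles, which gives the factor
  4.\<close>

lemma bilinear_integral_le:
  fixes Z :: "'a \<times> 'a \<Rightarrow> real"
  assumes [measurable]: "Z \<in> borel_measurable (M \<Otimes>\<^sub>M M)"
    and B: "\<And>x y. x \<in> space M \<Longrightarrow> y \<in> space M \<Longrightarrow> \<bar>Z (x, y)\<bar> \<le> 1"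
    and c: "\<And>S T. S \<in> sets M \<Longrightarrow> T \<in> sets M \<Longrightarrow> \<bar>LINT z:S \<times> T|M \<Otimes>\<^sub>M M. Z z\<bar> \<le> c"
    and [measurable]: "f \<in> borel_measurable M" "g \<in> borel_measurable M"
    and f: "\<And>x. x \<in> space M \<Longrightarrow> \<bar>f x\<bar> \<le> 1" and g: "\<And>x. x \<in> space M \<Longrightarrow> \<bar>g x\<bar> \<le> 1"
  shows "\<bar>\<integral>x. (\<integral>y. f x * g y * Z (x, y) \<partial>M) \<partial>M\<bar> \<le> 4 * c"
proof -
  define h where "h x = (\<integral>y. g y * Z (x, y) \<partial>M)" for x
  have hm[measurable]: "h \<in> borel_measurable M" unfolding h_def by measurable
  have hB: "\<bar>h x\<bar> \<le> 1" if "x \<in> space M" for x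
    unfolding h_def using that B g by (intro abs_integral_le) (auto simp: abs_mult intro!: mult_le_one)
  define s where "s x = (if h x \<ge> 0 then 1 else -1 :: real)" for x
  have sm[measurable]: "s \<in> borel_measurable M" unfolding s_def by measurable
  have sB: "\<bar>s x\<bar> = 1" for x by (simp add: s_def)
  define k where "k y = (\<integral>x. s x * Z (x, y) \<partial>M)" for y
  have km[measurable]: "k \<in> borel_measurable M" unfolding k_def by measurable
  have kB: "\<bar>k x\<bar> \<le> 1" if "x \<in> space M" for x
    unfolding k_def using that B by (intro abs_integral_le) (auto simp: abs_mult sB intro!: mult_le_one)
  define t where "t y = (if k y \<ge> 0 then 1 else -1 :: real)" for y
  have tm[measurable]: "t \<in> borel_measurable M" unfolding t_def by measurable
  have tB: "\<bar>t x\<bar> = 1" for x by (simp add: t_def)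
  have "\<bar>\<integral>x. (\<integral>y. f x * g y * Z (x, y) \<partial>M) \<partial>M\<bar> = \<bar>\<integral>x. f x * h x \<partial>M\<bar>"
    unfolding h_def by (simp add: mult.assoc)
  also have "\<dots> \<le> (\<integral>x. \<bar>f x * h x\<bar> \<partial>M)" by (rule integral_abs_bound)
  also have "\<dots> \<le> (\<integral>x. s x * h x \<partial>M)"
  proof (intro integral_mono integrable_bounded[where B=1])
    fix x assume x: "x \<in> space M"
    show "\<bar>f x * h x\<bar> \<le> s x * h x"
      using mult_right_mono[OF f[OF x] abs_ge_zero[of "h x"]]
      by (auto simp: s_def abs_mult)
  qed (auto simp: abs_mult f hB sB intro!: mult_le_one)
  also have "\<dots> = (\<integral>x. (\<integral>y. s x * g y * Z (x, y) \<partial>M) \<partial>M)"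
    unfolding h_def by (simp add: mult.assoc)
  also have "\<dots> = (\<integral>y. (\<integral>x. s x * g y * Z (x, y) \<partial>M) \<partial>M)"
    by (rule fubini_bounded[where B=1]) (auto simp: abs_mult sB g B intro!: mult_le_one)
  also have "\<dots> = (\<integral>y. g y * k y \<partial>M)"
    unfolding k_def by (simp only: integral_mult_right_zero[symmetric] mult_ac)
  also have "\<dots> \<le> (\<integral>y. t y * k y \<partial>M)"
  proof (intro integral_mono integrable_bounded[where B=1])
    fix x assume x: "x \<in> space M"
    have "g x * k x \<le> \<bar>g x * k x\<bar>" by simp
    also have "\<dots> \<le> t x * k x"
      using mult_right_mono[OF g[OF x] abs_ge_zero[of "k x"]]
      by (auto simp: t_def abs_mult)
    finally show "g x * k x \<le> t x * k x" .
  qed (auto simp: abs_mult g kB tB intro!: mult_le_one)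
  also have "\<dots> = (\<integral>y. (\<integral>x. s x * t y * Z (x, y) \<partial>M) \<partial>M)"
    unfolding k_def by (simp only: integral_mult_right_zero[symmetric] mult_ac)
  also have "\<dots> = (\<integral>x. (\<integral>y. s x * t y * Z (x, y) \<partial>M) \<partial>M)"
    by (rule fubini_bounded[where B=1, symmetric]) (auto simp: abs_mult sB tB B intro!: mult_le_one)
  also have "\<dots> \<le> 4 * c"
  proof -
    define S where "S = {x \<in> space M. h x \<ge> 0}"
    define S' where "S' = {x \<in> space M. \<not> h x \<ge> 0}"
    define T where "T = {x \<in> space M. k x \<ge> 0}"
    define T' where "T' = {x \<in> space M. \<not> k x \<ge> 0}"
    have [measurable]: "S \<in> sets M" "S' \<in> sets M" "T \<in> sets M" "T' \<in> sets M"
      unfolding S_def S'_def T_def T'_def by measurable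
    let ?r = "\<lambda>A B x y. indicator A x * indicator B y * Z (x, y)"
    have iy: "integrable M (?r A B x)" if [measurable]: "A \<in> sets M" "B \<in> sets M" and x[measurable]: "x \<in> space M" for A B x
      by (rule integrable_bounded[where B=1]) (auto simp: indicator_def B x)
    have ix: "integrable M (\<lambda>x. \<integral>y. ?r A B x y \<partial>M)" if [measurable]: "A \<in> sets M" "B \<in> sets M" for A B
      by (rule integrable_bounded[where B=1]) (auto simp: indicator_def B intro!: abs_integral_le)
    have "(\<integral>x. (\<integral>y. s x * t y * Z (x, y) \<partial>M) \<partial>M) =
      (\<integral>x. (\<integral>y. ?r S T x y - ?r S T' x y - ?r S' T x y + ?r S' T' x y \<partial>M) \<partial>M)"
      by (intro Bochner_Integration.integral_cong refl)
         (auto simp: s_def t_def S_def S'_def T_def T'_def indicator_def)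
    also have "\<dots> = (\<integral>x. (\<integral>y. ?r S T x y \<partial>M) - (\<integral>y. ?r S T' x y \<partial>M) - (\<integral>y. ?r S' T x y \<partial>M) + (\<integral>y. ?r S' T' x y \<partial>M) \<partial>M)"
      by (intro Bochner_Integration.integral_cong refl)
         (simp add: iy Bochner_Integration.integral_add Bochner_Integration.integral_diff Bochner_Integration.integrable_add Bochner_Integration.integrable_diff)
    also have "\<dots> = (\<integral>x. (\<integral>y. ?r S T x y \<partial>M) \<partial>M) - (\<integral>x. (\<integral>y. ?r S T' x y \<partial>M) \<partial>M)
        - (\<integral>x. (\<integral>y. ?r S' T x y \<partial>M) \<partial>M) + (\<integral>x. (\<integral>y. ?r S' T' x y \<partial>M) \<partial>M)"
      by (simp add: ix Bochner_Integration.integral_add Bochner_Integration.integral_diff Bochner_Integration.integrable_add Bochner_Integration.integrable_diff)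
    also have "\<dots> \<le> 4 * c"
      using c[of S T] c[of S T'] c[of S' T] c[of S' T']
      by (simp add: set_integral_Times[where B=1] B)
    finally show ?thesis .
  qed
  finally show ?thesis .
qed

text \<open>Opening one of the two factors \<open>D x z\<close> exposes the edge xy of the cycle.
  For fixed z the other three edges split into \<open>D x z\<close>, a function of x, and
  \<open>Z (y, z)\<close>, a function of y, so the bilinear bound applies to the exposed
  edge.\<close>

lemma four_cycle_density_le:
  fixes Z :: "'a \<times> 'a \<Rightarrow> real"
  assumes [measurable]: "Z \<in> borel_measurable (M \<Otimes>\<^sub>M M)"
    and B: "\<And>x y. x \<in> space M \<Longrightarrow> y \<in> space M \<Longrightarrow> \<bar>Z (x, y)\<bar> \<le> 1"
    and c: "\<And>S T. S \<in> sets M \<Longrightarrow> T \<in> sets M \<Longrightarrow> \<bar>LINT z:S \<times> T|M \<Otimes>\<^sub>M M. Z z\<bar> \<le> c"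
  shows "four_cycle_density M Z \<le> 4 * c"
proof -
  define D where "D x z = (\<integral>y. Z (x, y) * Z (y, z) \<partial>M)" for x z
  have Dm[measurable]: "(\<lambda>(x, y). D x y) \<in> borel_measurable (M \<Otimes>\<^sub>M M)"
    unfolding D_def by measurable
  have DB: "\<bar>D x z\<bar> \<le> 1" if "x \<in> space M" "z \<in> space M" for x z
    unfolding D_def using that B by (intro abs_integral_le) (auto simp: abs_mult intro!: mult_le_one)
  have "four_cycle_density M Z = (\<integral>x. (\<integral>z. (D x z)\<^sup>2 \<partial>M) \<partial>M)"
    unfolding four_cycle_density_def D_def ..
  also have "\<dots> = (\<integral>z. (\<integral>x. (D x z)\<^sup>2 \<partial>M) \<partial>M)"
    by (rule fubini_bounded[where B=1]) (auto simp: DB abs_square_le_1)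
  also have "\<dots> = (\<integral>z. (\<integral>x. (\<integral>y. D x z * Z (y, z) * Z (x, y) \<partial>M) \<partial>M) \<partial>M)"
  proof (intro Bochner_Integration.integral_cong refl)
    fix x z
    have "(D x z)\<^sup>2 = D x z * (\<integral>y. Z (x, y) * Z (y, z) \<partial>M)"
      by (simp add: power2_eq_square D_def)
    also have "\<dots> = (\<integral>y. D x z * Z (y, z) * Z (x, y) \<partial>M)"
      by (simp add: mult.assoc mult.commute[of "Z (_, z)"])
    finally show "(D x z)\<^sup>2 = (\<integral>y. D x z * Z (y, z) * Z (x, y) \<partial>M)" .
  qed
  also have "\<dots> \<le> (\<integral>z. 4 * c \<partial>M)"
  proof (rule integral_mono)
    show "integrable M (\<lambda>z. \<integral>x. (\<integral>y. D x z * Z (y, z) * Z (x, y) \<partial>M) \<partial>M)"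
      by (rule integrable_bounded[where B=1])
         (auto intro!: abs_integral_le mult_le_one simp: abs_mult DB B simp del: integral_mult_right_zero integral_mult_left_zero)
    fix z assume z[measurable]: "z \<in> space M"
    have "\<bar>\<integral>x. (\<integral>y. D x z * Z (y, z) * Z (x, y) \<partial>M) \<partial>M\<bar> \<le> 4 * c"
      by (rule bilinear_integral_le[OF _ B c]) (auto simp: DB B z)
    then show "(\<integral>x. (\<integral>y. D x z * Z (y, z) * Z (x, y) \<partial>M) \<partial>M) \<le> 4 * c" by linarith
  qed simp
  finally show ?thesis by (simp add: prob_space)
qed

end

section \<open>The cut norm on the unit square\<close>

lemma space_unit_interval[simp]: "space unit_interval = {0..1}"
  by (simp add: unit_interval_def space_restrict_space)

lemma sets_unit_interval: "sets unit_interval = sets (restrict_space borel {0..1})"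
  by (simp add: unit_interval_def sets_restrict_space)

lemma prob_space_unit_interval: "prob_space unit_interval"
  by (rule prob_spaceI) (simp add: unit_interval_def emeasure_restrict_space space_restrict_space)

interpretation unit_interval: prob_space unit_interval
  by (rule prob_space_unit_interval)

lemma measure_unit_interval[simp]: "measure unit_interval {0..1} = 1"
  using unit_interval.prob_space by simp

lemma unit_interval_sets_borel: "A \<in> sets unit_interval \<Longrightarrow> A \<in> sets borel"
  by (auto simp: unit_interval_def sets_restrict_space)

lemma borel_Int_unit_interval[measurable]: "A \<in> sets borel \<Longrightarrow> A \<inter> {0..1} \<in> sets unit_interval"
  by (auto simp: unit_interval_def sets_restrict_space)

lemma measurable_unit_intervalI:
  "f \<in> borel_measurable M \<Longrightarrow> (\<And>x. x \<in> space M \<Longrightarrow> f x \<in> {0..1}) \<Longrightarrow> f \<in> measurable M unit_interval"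
  by (subst measurable_cong_sets[OF refl sets_unit_interval]) (auto intro: measurable_restrict_space2)

lemma measurable_unit_intervalD[measurable_dest]:
  "f \<in> measurable M unit_interval \<Longrightarrow> f \<in> borel_measurable M"
  by (subst (asm) measurable_cong_sets[OF refl sets_unit_interval])
     (auto simp: measurable_restrict_space2_iff)

lemma ident_unit_interval[measurable]: "(\<lambda>x. x) \<in> borel_measurable unit_interval"
  by (rule measurable_unit_intervalD) simp

text \<open>Made for differences of two graphons, whence the range [-1, 1].\<close>

definition kernel :: "(real \<times> real \<Rightarrow> real) \<Rightarrow> bool" where
  "kernel Z \<longleftrightarrow> Z \<in> borel_measurable (unit_interval \<Otimes>\<^sub>M unit_interval) \<and>
     (\<forall>x\<in>{0..1}. \<forall>y\<in>{0..1}. \<bar>Z (x, y)\<bar> \<le> 1 \<and> Z (x, y) = Z (y, x))"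

lemma kernel_measurable[measurable_dest]:
  "kernel Z \<Longrightarrow> Z \<in> borel_measurable (unit_interval \<Otimes>\<^sub>M unit_interval)"
  by (simp add: kernel_def)

lemma kernel_bound: "kernel Z \<Longrightarrow> x \<in> {0..1} \<Longrightarrow> y \<in> {0..1} \<Longrightarrow> \<bar>Z (x, y)\<bar> \<le> 1"
  by (simp add: kernel_def)

lemma kernel_sym: "kernel Z \<Longrightarrow> x \<in> {0..1} \<Longrightarrow> y \<in> {0..1} \<Longrightarrow> Z (x, y) = Z (y, x)"
  by (simp add: kernel_def)

text \<open>As \<open>W0\<close>, but without extensionality, which pullbacks and step functions lack.\<close>

definition graphon :: "(real \<times> real \<Rightarrow> real) \<Rightarrow> bool" where
  "graphon W \<longleftrightarrow> W \<in> borel_measurable (unit_interval \<Otimes>\<^sub>M unit_interval) \<and>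
     (\<forall>x\<in>{0..1}. \<forall>y\<in>{0..1}. W (x, y) \<in> {0..1} \<and> W (x, y) = W (y, x))"

lemma graphon_measurable[measurable_dest]:
  "graphon Z \<Longrightarrow> Z \<in> borel_measurable (unit_interval \<Otimes>\<^sub>M unit_interval)"
  by (simp add: graphon_def)

lemma W0_graphon: "W \<in> W0 \<Longrightarrow> graphon W"
  by (auto simp: W0_def graphon_def unit_square_def PiE_iff)

lemma graphon_diff_kernel:
  assumes "graphon U" "graphon W" shows "kernel (\<lambda>z. U z - W z)"
proof -
  have [measurable]: "U \<in> borel_measurable (unit_interval \<Otimes>\<^sub>M unit_interval)" "W \<in> borel_measurable (unit_interval \<Otimes>\<^sub>M unit_interval)"
    using assms by (auto simp: graphon_def)
  have "\<bar>U (x, y) - W (x, y)\<bar> \<le> 1" if "x \<in> {0..1}" "y \<in> {0..1}" for x y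
    using assms that unfolding graphon_def by (fastforce simp: abs_le_iff)
  then show ?thesis using assms by (auto simp: kernel_def graphon_def)
qed

lemma graphon_pullback:
  assumes W: "graphon W" and m: "\<psi> \<in> measurable unit_interval unit_interval"
  shows "graphon (\<lambda>(x, y). W (\<psi> x, \<psi> y))"
proof -
  note [measurable] = graphon_measurable[OF W] m
  have "\<psi> x \<in> {0..1}" if "x \<in> {0..1}" for x
    using measurable_space[OF m] that by simp
  then show ?thesis using W by (auto simp: graphon_def)
qed

text \<open>On the reals a supremum carries information only for bounded families; this makes
  \<open>cut_norm\<close> usable from below.\<close>

lemma bdd_above_cut_norm:
  assumes "kernel Z"
  shows "bdd_above ((\<lambda>(S, T). \<bar>LINT z:S \<times> T|unit_square. Z z\<bar>) ` (sets unit_interval \<times> sets unit_interval))"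
proof -
  note [measurable] = kernel_measurable[OF assms]
  have "\<bar>LINT z:S \<times> T|unit_square. Z z\<bar> \<le> 1" if [measurable]: "S \<in> sets unit_interval" "T \<in> sets unit_interval" for S T
    unfolding unit_square_def
    by (subst unit_interval.set_integral_Times[where B=1])
       (auto simp: kernel_bound[OF assms] indicator_def intro!: unit_interval.abs_integral_le)
  then show ?thesis by (auto intro!: bdd_aboveI[where M=1])
qed

lemma cut_norm_upper:
  assumes "\<And>S T. S \<in> sets unit_interval \<Longrightarrow> T \<in> sets unit_interval \<Longrightarrow> \<bar>LINT z:S \<times> T|unit_square. Z z\<bar> \<le> c"
  shows "cut_norm Z \<le> c"
  unfolding cut_norm_def by (rule cSUP_least) (use assms in auto)

lemma cut_norm_lower:
  assumes "kernel Z" "S \<in> sets unit_interval" "T \<in> sets unit_interval"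
  shows "\<bar>LINT z:S \<times> T|unit_square. Z z\<bar> \<le> cut_norm Z"
  unfolding cut_norm_def
  using cSUP_upper[OF _ bdd_above_cut_norm[OF assms(1)], of "(S, T)"] assms by auto

lemma cut_norm_nonneg: "kernel Z \<Longrightarrow> 0 \<le> cut_norm Z"
  using cut_norm_lower[of Z "{}" "{}"] by auto

lemma cut_norm_triangle:
  assumes "kernel Z" "kernel Z1" "kernel Z2"
    and eq: "\<And>x y. x \<in> {0..1} \<Longrightarrow> y \<in> {0..1} \<Longrightarrow> Z (x, y) = Z1 (x, y) + Z2 (x, y)"
  shows "cut_norm Z \<le> cut_norm Z1 + cut_norm Z2"
proof (rule cut_norm_upper)
  fix S T assume S: "S \<in> sets unit_interval" "T \<in> sets unit_interval"
  interpret P: pair_prob_space unit_interval unit_interval ..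
  note [measurable] = S kernel_measurable[OF assms(1)] kernel_measurable[OF assms(2)] kernel_measurable[OF assms(3)]
  have int: "set_integrable unit_square (S \<times> T) Y" if Y: "kernel Y" for Y
  proof -
    note [measurable] = kernel_measurable[OF Y]
    show ?thesis unfolding set_integrable_def unit_square_def
      by (rule P.integrable_bounded[where B=1])
         (auto simp: space_pair_measure indicator_def kernel_bound[OF Y])
  qed
  have "(LINT z:S \<times> T|unit_square. Z z) = (LINT z:S \<times> T|unit_square. Z1 z + Z2 z)"
    unfolding set_lebesgue_integral_def unit_square_def
    by (intro Bochner_Integration.integral_cong refl) (auto simp: space_pair_measure eq)
  also have "\<dots> = (LINT z:S \<times> T|unit_square. Z1 z) + (LINT z:S \<times> T|unit_square. Z2 z)"
    by (rule set_integral_add) (use int assms in auto)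
  finally show "\<bar>LINT z:S \<times> T|unit_square. Z z\<bar> \<le> cut_norm Z1 + cut_norm Z2"
    using cut_norm_lower[OF assms(2) S] cut_norm_lower[OF assms(3) S] by linarith
qed

text \<open>A bound of the form \<open>r ^ 4\<close> avoids fourth roots: each caller supplies
  \<open>r\<close>.\<close>

lemma cut_norm_le_four_cycle:
  assumes Z: "kernel Z" and r: "four_cycle_density unit_interval Z \<le> r ^ 4" "0 \<le> r"
  shows "cut_norm Z \<le> r"
proof (rule cut_norm_upper)
  fix S T assume [measurable]: "S \<in> sets unit_interval" "T \<in> sets unit_interval"
  note [measurable] = kernel_measurable[OF Z]
  have "(LINT z:S \<times> T|unit_square. Z z) ^ 4 \<le> r ^ 4"
    unfolding unit_square_def
    by (rule order_trans[OF unit_interval.rectangle_integral_power4_le r(1)])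
       (auto simp: kernel_bound[OF Z] kernel_sym[OF Z, symmetric] intro: kernel_sym[OF Z])
  then have "\<bar>LINT z:S \<times> T|unit_square. Z z\<bar> ^ 4 \<le> r ^ 4" by simp
  then show "\<bar>LINT z:S \<times> T|unit_square. Z z\<bar> \<le> r"
    using r(2) power_mono_iff[of "\<bar>LINT z:S \<times> T|unit_square. Z z\<bar>" r 4] by auto
qed

lemma four_cycle_le_cut_norm:
  assumes Z: "kernel Z" shows "four_cycle_density unit_interval Z \<le> 4 * cut_norm Z"
  by (rule unit_interval.four_cycle_density_le)
     (use kernel_measurable[OF Z] kernel_bound[OF Z] cut_norm_lower[OF Z] in \<open>auto simp: unit_square_def\<close>)

text \<open>The absolute value of \<open>Z (x, y)\<close> is at most the number of coordinates in
  \<open>A\<close>, whose mean is twice the measure of \<open>A\<close>. The lemma compares step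
  functions whose classes agree off \<open>A\<close>.\<close>

lemma cut_norm_le_exceptional:
  assumes Z: "kernel Z" and A: "A \<in> sets unit_interval"
    and z: "\<And>x y. x \<in> {0..1} - A \<Longrightarrow> y \<in> {0..1} - A \<Longrightarrow> Z (x, y) = 0"
  shows "cut_norm Z \<le> 2 * measure unit_interval A"
proof (rule cut_norm_upper)
  fix S T assume [measurable]: "S \<in> sets unit_interval" "T \<in> sets unit_interval"
  note [measurable] = kernel_measurable[OF Z] A
  have AB: "(indicator A x :: real) + indicator A y \<le> 2" for x y by (auto simp: indicator_def)
  let ?f = "\<lambda>x y. indicator S x * indicator T y * Z (x, y)"
  have "\<bar>LINT z:S \<times> T|unit_square. Z z\<bar> = \<bar>\<integral>x. (\<integral>y. ?f x y \<partial>unit_interval) \<partial>unit_interval\<bar>"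
    unfolding unit_square_def by (subst unit_interval.set_integral_Times[where B=1]) (auto simp: kernel_bound[OF Z])
  also have "\<dots> \<le> (\<integral>x. \<bar>\<integral>y. ?f x y \<partial>unit_interval\<bar> \<partial>unit_interval)"
    by (rule integral_abs_bound)
  also have "\<dots> \<le> (\<integral>x. (\<integral>y. \<bar>?f x y\<bar> \<partial>unit_interval) \<partial>unit_interval)"
  proof (rule integral_mono)
    show "integrable unit_interval (\<lambda>x. \<bar>\<integral>y. ?f x y \<partial>unit_interval\<bar>)"
      by (rule unit_interval.integrable_bounded[where B=1])
         (auto simp: kernel_bound[OF Z] indicator_def intro!: unit_interval.abs_integral_le)
    show "integrable unit_interval (\<lambda>x. \<integral>y. \<bar>?f x y\<bar> \<partial>unit_interval)"
      by (rule unit_interval.integrable_bounded[where B=1])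
         (auto simp: kernel_bound[OF Z] indicator_def intro!: abs_le_D1[OF unit_interval.abs_integral_le])
  qed (rule integral_abs_bound)
  also have "\<dots> \<le> (\<integral>x. (\<integral>y. indicator A x + indicator A y \<partial>unit_interval) \<partial>unit_interval)"
  proof (intro integral_mono)
    show "integrable unit_interval (\<lambda>x. \<integral>y. \<bar>?f x y\<bar> \<partial>unit_interval)"
      by (rule unit_interval.integrable_bounded[where B=1])
         (auto simp: kernel_bound[OF Z] indicator_def intro!: abs_le_D1[OF unit_interval.abs_integral_le])
    show "integrable unit_interval (\<lambda>y. \<bar>?f x y\<bar>)" if [measurable]: "x \<in> space unit_interval" for x
      by (rule unit_interval.integrable_bounded[where B=1])
         (use that in \<open>auto simp: kernel_bound[OF Z] indicator_def\<close>)
    show "\<bar>?f x y\<bar> \<le> indicator A x + indicator A y" if "x \<in> space unit_interval" "y \<in> space unit_interval" for x y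
      using kernel_bound[OF Z, of x y] z[of x y] that by (auto simp: indicator_def)
    show "integrable unit_interval (\<lambda>x. \<integral>y. indicator A x + indicator A y \<partial>unit_interval :: real)"
      by (rule unit_interval.integrable_bounded[where B=2])
         (auto intro!: abs_le_D1[OF unit_interval.abs_integral_le] AB)
  qed (auto intro!: unit_interval.integrable_bounded[where B=2] AB)
  also have "\<dots> = 2 * measure unit_interval A"
    by (simp add: unit_interval.prob_space unit_interval.integrable_bounded[where B=1] sets.Int_space_eq2[OF A, simplified])
  finally show "\<bar>LINT z:S \<times> T|unit_square. Z z\<bar> \<le> 2 * measure unit_interval A" .
qed

section \<open>Pullback along measure-preserving maps\<close>

definition measure_preserving_map :: "(real \<Rightarrow> real) \<Rightarrow> bool" where
  "measure_preserving_map \<psi> \<longleftrightarrow> \<psi> \<in> measurable unit_interval unit_interval \<and>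
     distr unit_interval unit_interval \<psi> = unit_interval"

text \<open>The change of variables is made in each of the three nested integrals, outermost
  first.\<close>

lemma four_cycle_density_distr:
  assumes [measurable]: "\<psi> \<in> measurable M N" "Z \<in> borel_measurable (N \<Otimes>\<^sub>M N)" and "prob_space M"
  shows "four_cycle_density M (\<lambda>(x, y). Z (\<psi> x, \<psi> y)) = four_cycle_density (distr M N \<psi>) Z"
proof -
  interpret prob_space M by fact
  interpret D: prob_space "distr M N \<psi>" by (rule prob_space_distr) fact
  have [measurable]: "Z \<in> borel_measurable (distr M N \<psi> \<Otimes>\<^sub>M distr M N \<psi>)" by measurable
  have "(\<lambda>(x, z). \<integral>y. Z (x, y) * Z (y, z) \<partial>distr M N \<psi>) \<in> borel_measurable (distr M N \<psi> \<Otimes>\<^sub>M distr M N \<psi>)"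
    by measurable
  \<comment> \<open>The pushforward has the sets of \<open>N\<close>, so measurability over it is
    measurability over \<open>N\<close>, the form in which \<open>integral_distr\<close> asks for
    it.\<close>
  then have [measurable]: "(\<lambda>(x, z). \<integral>y. Z (x, y) * Z (y, z) \<partial>distr M N \<psi>) \<in> borel_measurable (N \<Otimes>\<^sub>M N)"
    by (simp cong: measurable_cong_sets)
  have "(\<lambda>x. \<integral>z. (\<integral>y. Z (x, y) * Z (y, z) \<partial>distr M N \<psi>)\<^sup>2 \<partial>distr M N \<psi>) \<in> borel_measurable (distr M N \<psi>)"
    by measurable
  then have [measurable]: "(\<lambda>x. \<integral>z. (\<integral>y. Z (x, y) * Z (y, z) \<partial>distr M N \<psi>)\<^sup>2 \<partial>distr M N \<psi>) \<in> borel_measurable N"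
    by simp
  have 1: "(\<integral>y. Z (x, y) * Z (y, z) \<partial>distr M N \<psi>) = (\<integral>y. Z (x, \<psi> y) * Z (\<psi> y, z) \<partial>M)"
    if [measurable]: "x \<in> space N" "z \<in> space N" for x z
    by (rule integral_distr) auto
  have 2: "(\<integral>z. (\<integral>y. Z (x, y) * Z (y, z) \<partial>distr M N \<psi>)\<^sup>2 \<partial>distr M N \<psi>)
    = (\<integral>z. (\<integral>y. Z (x, y) * Z (y, \<psi> z) \<partial>distr M N \<psi>)\<^sup>2 \<partial>M)" if [measurable]: "x \<in> space N" for x
    by (rule integral_distr) auto
  have 3: "four_cycle_density (distr M N \<psi>) Z
    = (\<integral>x. (\<integral>z. (\<integral>y. Z (\<psi> x, y) * Z (y, z) \<partial>distr M N \<psi>)\<^sup>2 \<partial>distr M N \<psi>) \<partial>M)"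
    unfolding four_cycle_density_def by (rule integral_distr) auto
  have sp: "\<psi> x \<in> space N" if "x \<in> space M" for x using that by (rule measurable_space[rotated]) fact
  show ?thesis
    unfolding 3 unfolding four_cycle_density_def
    by (intro Bochner_Integration.integral_cong refl) (simp add: 2 1 sp cong: Bochner_Integration.integral_cong)
qed

lemma kernel_pullback:
  assumes Z: "kernel Z" and m: "\<psi> \<in> measurable unit_interval unit_interval"
  shows "kernel (\<lambda>(x, y). Z (\<psi> x, \<psi> y))"
proof -
  note [measurable] = kernel_measurable[OF Z] m
  have "\<psi> x \<in> {0..1}" if "x \<in> {0..1}" for x
    using measurable_space[OF m] that by simp
  then show ?thesis using Z by (auto simp: kernel_def)
qed

text \<open>A measurable rectangle need not be the preimage of a rectangle when
  \<open>\<psi>\<close> has no inverse, so the cut norm is not transported set by set. The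
  four-cycle density is invariant; passing to it and back costs the fourth root.\<close>

lemma cut_norm_pullback_le:
  assumes Z: "kernel Z" and \<psi>: "measure_preserving_map \<psi>" and r: "4 * cut_norm Z \<le> r ^ 4" "0 \<le> r"
  shows "cut_norm (\<lambda>(x, y). Z (\<psi> x, \<psi> y)) \<le> r"
proof -
  have m: "\<psi> \<in> measurable unit_interval unit_interval"
    and d: "distr unit_interval unit_interval \<psi> = unit_interval"
    using \<psi> by (auto simp: measure_preserving_map_def)
  have "four_cycle_density unit_interval (\<lambda>(x, y). Z (\<psi> x, \<psi> y)) = four_cycle_density unit_interval Z"
    using four_cycle_density_distr[OF m kernel_measurable[OF Z] prob_space_unit_interval] by (simp add: d)
  then show ?thesis
    using four_cycle_le_cut_norm[OF Z] r by (intro cut_norm_le_four_cycle kernel_pullback[OF Z m]) auto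
qed

text \<open>\<open>restrict\<close> restores the extensionality that membership in \<open>W0\<close>
  demands.\<close>

lemma pullback_W0:
  assumes "U \<in> W0" "\<psi> \<in> measurable unit_interval unit_interval"
  shows "restrict (\<lambda>(x, y). U (\<psi> x, \<psi> y)) ({0..1} \<times> {0..1}) \<in> W0"
proof -
  have g: "graphon (\<lambda>(x, y). U (\<psi> x, \<psi> y))"
    using graphon_pullback[OF W0_graphon assms(2)] assms(1) .
  have "restrict (\<lambda>(x, y). U (\<psi> x, \<psi> y)) ({0..1} \<times> {0..1}) \<in> borel_measurable unit_square"
    using graphon_measurable[OF g] unfolding unit_square_def
    by (rule measurable_cong[THEN iffD1, rotated]) (auto simp: space_pair_measure)
  then show ?thesis using g by (auto simp: W0_def graphon_def)
qed

text \<open>Applied to each coordinate, \<open>\<psi>\<close> sends independent uniform points to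
  independent uniform points, so every homomorphism density is unchanged.\<close>

lemma isomorphic_pullback:
  assumes U: "U \<in> W0" and \<psi>: "measure_preserving_map \<psi>"
  shows "isomorphic U (restrict (\<lambda>(x, y). U (\<psi> x, \<psi> y)) ({0..1} \<times> {0..1}))"
  unfolding isomorphic_def
proof (intro allI impI)
  fix k :: nat and E :: "nat set set"
  have m[measurable]: "\<psi> \<in> measurable unit_interval unit_interval"
    and d: "distr unit_interval unit_interval \<psi> = unit_interval"
    using \<psi> by (auto simp: measure_preserving_map_def)
  note Um[measurable] = graphon_measurable[OF W0_graphon[OF U]]
  let ?P = "\<Pi>\<^sub>M i\<in>{1..k}. unit_interval"
  let ?F = "{(i, j) \<in> vertex_pairs k. {i, j} \<in> E}"
  have fin: "?F \<subseteq> {1..k} \<times> {1..k}" by (auto simp: vertex_pairs_def)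
  have D: "distr ?P ?P (compose {1..k} \<psi>) = ?P"
    by (subst distr_PiM_finite_prob_space') (auto simp: prob_space_unit_interval d)
  have cm[measurable]: "compose {1..k} \<psi> \<in> measurable ?P ?P"
    unfolding compose_def by measurable
  have fm: "(\<lambda>x. \<Prod>(i, j)\<in>?F. U (x i, x j)) \<in> borel_measurable ?P"
  proof (rule borel_measurable_prod)
    fix p assume "p \<in> ?F"
    then have "fst p \<in> {1..k}" "snd p \<in> {1..k}" using fin by auto
    then show "(\<lambda>x. case p of (i, j) \<Rightarrow> U (x i, x j)) \<in> borel_measurable ?P"
      by (simp add: case_prod_beta)
  qed
  have "hom_density k E U = (\<integral>x. (\<Prod>(i, j)\<in>?F. U (x i, x j)) \<partial>distr ?P ?P (compose {1..k} \<psi>))"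
    unfolding hom_density_def D ..
  also have "\<dots> = (\<integral>x. (\<Prod>(i, j)\<in>?F. U (compose {1..k} \<psi> x i, compose {1..k} \<psi> x j)) \<partial>?P)"
    by (rule integral_distr[OF cm fm])
  also have "\<dots> = hom_density k E (restrict (\<lambda>(x, y). U (\<psi> x, \<psi> y)) ({0..1} \<times> {0..1}))"
    unfolding hom_density_def
  proof (intro Bochner_Integration.integral_cong prod.cong refl)
    fix x p assume x: "x \<in> space ?P" and p: "p \<in> ?F"
    then have "fst p \<in> {1..k}" "snd p \<in> {1..k}" using fin by auto
    moreover have "x i \<in> {0..1}" if "i \<in> {1..k}" for i using x that by (auto simp: space_PiM PiE_iff)
    ultimately show "(case p of (i, j) \<Rightarrow> U (compose {1..k} \<psi> x i, compose {1..k} \<psi> x j)) =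
       (case p of (i, j) \<Rightarrow> restrict (\<lambda>(x, y). U (\<psi> x, \<psi> y)) ({0..1} \<times> {0..1}) (x i, x j))"
      by (auto simp: case_prod_beta compose_def)
  qed
  finally show "hom_density k E U = hom_density k E (restrict (\<lambda>(x, y). U (\<psi> x, \<psi> y)) ({0..1} \<times> {0..1}))" .
qed

section \<open>Measure-preserving rearrangements\<close>

lemma measure_unit_interval_Ioc_le:
  assumes "x \<le> y" shows "measure unit_interval ({x<..y} \<inter> {0..1}) \<le> y - x"
proof -
  have "measure unit_interval ({x<..y} \<inter> {0..1}) = measure lborel ({x<..y} \<inter> {0..1})"
    unfolding unit_interval_def by (rule measure_restrict_space) auto
  also have "\<dots> \<le> measure lborel {x<..y}"
    by (rule measure_mono_fmeasurable) (auto simp: fmeasurable_def assms)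
  also have "\<dots> = y - x" using assms by simp
  finally show ?thesis .
qed

text \<open>The unnormalised distribution function of Lebesgue measure on \<open>A\<close>.\<close>

definition partial_measure :: "real set \<Rightarrow> real \<Rightarrow> real" where
  "partial_measure A x = measure unit_interval (A \<inter> {..x})"

context
  fixes A :: "real set"
  assumes A: "A \<in> sets unit_interval"
begin

lemma partial_measure_sets[measurable]: "A \<inter> {..x} \<in> sets unit_interval"
proof -
  have "A \<inter> {..x} \<inter> {0..1} = A \<inter> {..x}" using sets.sets_into_space[OF A] by auto
  then show ?thesis using borel_Int_unit_interval[of "A \<inter> {..x}"] unit_interval_sets_borel[OF A] by simp
qed

lemma partial_measure_mono: "x \<le> y \<Longrightarrow> partial_measure A x \<le> partial_measure A y"
  unfolding partial_measure_def by (rule unit_interval.finite_measure_mono) auto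

lemma partial_measure_nonneg: "0 \<le> partial_measure A x"
  by (simp add: partial_measure_def)

lemma partial_measure_le: "partial_measure A x \<le> measure unit_interval A"
  unfolding partial_measure_def by (rule unit_interval.finite_measure_mono) (auto simp: A)

text \<open>Absence of atoms enters here: no interval has more mass than its length. Continuity of
  the distribution function, and with it the existence of every intermediate value, follows.\<close>

lemma partial_measure_Lipschitz:
  assumes "x \<le> y" shows "partial_measure A y \<le> partial_measure A x + (y - x)"
proof -
  have "partial_measure A y \<le> measure unit_interval (A \<inter> {..x} \<union> {x<..y} \<inter> {0..1})"
    unfolding partial_measure_def
    using sets.sets_into_space[OF A] by (intro unit_interval.finite_measure_mono) auto
  also have "\<dots> \<le> measure unit_interval (A \<inter> {..x}) + measure unit_interval ({x<..y} \<inter> {0..1})"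
    by (rule measure_Un_le) auto
  finally show ?thesis using measure_unit_interval_Ioc_le[OF assms] by (simp add: partial_measure_def)
qed

lemma partial_measure_continuous: "continuous_on S (partial_measure A)"
proof -
  have "1-lipschitz_on UNIV (partial_measure A)"
  proof (rule lipschitz_onI)
    fix x y :: real
    show "dist (partial_measure A x) (partial_measure A y) \<le> 1 * dist x y"
      using partial_measure_Lipschitz[of x y] partial_measure_Lipschitz[of y x]
        partial_measure_mono[of x y] partial_measure_mono[of y x]
      by (cases "x \<le> y") (auto simp: dist_real_def)
  qed simp
  then show ?thesis using lipschitz_on_continuous_on continuous_on_subset by blast
qed

lemma partial_measure_0:
  assumes "x \<le> 0" shows "partial_measure A x = 0"
proof -
  \<comment> \<open>\<open>A\<close> may contain the point 0, so the mass up to \<open>x\<close> is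
    bounded by the mass slightly further left, which vanishes, plus the Lipschitz error
    \<open>e\<close>.\<close>
  have "partial_measure A (x - e) = 0" if "e > 0" for e
  proof -
    have "A \<inter> {..x - e} = {}" using sets.sets_into_space[OF A] that assms by (auto simp: subset_iff)
    then show ?thesis by (simp add: partial_measure_def)
  qed
  then have "partial_measure A x \<le> 0 + e" if "e > 0" for e
    using partial_measure_Lipschitz[of "x - e" x] that by simp
  then have "partial_measure A x \<le> 0" by (rule field_le_epsilon)
  then show ?thesis using partial_measure_nonneg[of x] by simp
qed

lemma partial_measure_1: "1 \<le> x \<Longrightarrow> partial_measure A x = measure unit_interval A"
  unfolding partial_measure_def using sets.sets_into_space[OF A]
  by (intro arg_cong[where f="measure unit_interval"]) fastforce

lemma partial_measure_attains:
  assumes "0 \<le> t" "t \<le> measure unit_interval A"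
  obtains s where "0 \<le> s" "s \<le> 1" "partial_measure A s = t"
  using IVT'[of "partial_measure A" 0 t 1] assms partial_measure_0 partial_measure_1
    partial_measure_continuous by auto

text \<open>The probability integral transform: a distribution function without jumps is itself
  uniformly distributed. Its sublevel set in \<open>A\<close> is an initial segment, which ends at
  the largest point where the level \<open>t\<close> is not exceeded.\<close>

lemma measure_partial_measure_le:
  assumes t: "0 \<le> t" "t \<le> measure unit_interval A"
  shows "measure unit_interval {x\<in>A. partial_measure A x \<le> t} = t"
proof -
  obtain s0 where s0: "0 \<le> s0" "s0 \<le> 1" "partial_measure A s0 = t"
    using partial_measure_attains[OF t] .
  let ?K = "{x. partial_measure A x \<le> t} \<inter> {0..1}"
  have "compact ?K"
    by (intro closed_Int_compact closed_Collect_le continuous_on_const partial_measure_continuous) simp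
  moreover have "s0 \<in> ?K" using s0 by auto
  ultimately obtain s where s: "s \<in> ?K" "\<And>x. x \<in> ?K \<Longrightarrow> x \<le> s"
    using compact_attains_sup[of ?K] by blast
  have "partial_measure A s = t"
    using partial_measure_mono[OF s(2)[OF \<open>s0 \<in> ?K\<close>]] s(1) s0 by auto
  moreover have "{x\<in>A. partial_measure A x \<le> t} = A \<inter> {..s}"
    using s sets.sets_into_space[OF A] partial_measure_mono[of _ s] by fastforce
  ultimately show ?thesis by (simp add: partial_measure_def)
qed

end

text \<open>On each class of \<open>a\<close>, the map is the quantile function of the corresponding class of \<open>b\<close>
  composed with the distribution function of the class of \<open>a\<close>.\<close>

lemma rearrangement_exact:
  fixes a b :: "real \<Rightarrow> 'c" and C :: "'c set"
  assumes a[measurable]: "a \<in> measurable unit_interval (count_space UNIV)"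
    and b[measurable]: "b \<in> measurable unit_interval (count_space UNIV)"
    and C: "finite C" "\<And>x. x \<in> {0..1} \<Longrightarrow> a x \<in> C" "\<And>x. x \<in> {0..1} \<Longrightarrow> b x \<in> C"
    and eq: "\<And>c. c \<in> C \<Longrightarrow> measure unit_interval {x\<in>{0..1}. a x = c} = measure unit_interval {x\<in>{0..1}. b x = c}"
  obtains \<psi> where "measure_preserving_map \<psi>" "AE x in unit_interval. b (\<psi> x) = a x"
proof -
  define A where "A c = {x\<in>{0..1}. a x = c}" for c
  define B where "B c = {x\<in>{0..1}. b x = c}" for c
  have A[measurable]: "A c \<in> sets unit_interval" and B[measurable]: "B c \<in> sets unit_interval" for c
  proof -
    have "{x\<in>space unit_interval. a x = c} \<in> sets unit_interval" "{x\<in>space unit_interval. b x = c} \<in> sets unit_interval"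
      by measurable
    then show "A c \<in> sets unit_interval" "B c \<in> sets unit_interval" by (auto simp: A_def B_def)
  qed
  have eq': "measure unit_interval (A c) = measure unit_interval (B c)" if "c \<in> C" for c
    using eq[OF that] by (simp add: A_def B_def)
  \<comment> \<open>\<open>K x\<close> holds the y by which the class of \<open>b\<close> has
    accumulated at least the mass that the class of \<open>a\<close> has up to x; its least element
    is the generalised inverse.\<close>
  define K where "K x = {y. partial_measure (A (a x)) x \<le> partial_measure (B (a x)) y} \<inter> {0..1}" for x
  define \<psi> where "\<psi> x = Inf (K x)" for x
  \<comment> \<open>\<open>K x\<close> is closed, so the infimum is attained, and
    \<open>\<psi> x \<le> y\<close> becomes equivalent to \<open>y \<in> K x\<close>. Equal class
    sizes ensure that \<open>K x\<close> contains 1.\<close>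
  have K: "1 \<in> K x" "\<psi> x \<in> K x" "y \<in> {0..1} \<Longrightarrow> \<psi> x \<le> y \<longleftrightarrow> y \<in> K x" if x: "x \<in> {0..1}" for x y
  proof -
    show 1: "1 \<in> K x"
      using partial_measure_le[OF A, of "a x" x] partial_measure_1[OF B, of 1 "a x"] eq'[OF C(2)[OF x]]
      by (auto simp: K_def)
    have cl: "closed (K x)" unfolding K_def
      by (intro closed_Int closed_Collect_le continuous_on_const partial_measure_continuous) auto
    have bdd: "bdd_below (K x)" by (auto simp: K_def)
    show 2: "\<psi> x \<in> K x" unfolding \<psi>_def
      by (rule closed_contains_Inf) (use 1 cl bdd in auto)
    show "\<psi> x \<le> y \<longleftrightarrow> y \<in> K x" if "y \<in> {0..1}"
    proof
      assume "\<psi> x \<le> y"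
      then have "partial_measure (B (a x)) (\<psi> x) \<le> partial_measure (B (a x)) y"
        by (rule partial_measure_mono[OF B])
      then show "y \<in> K x" using 2 that by (auto simp: K_def)
    next
      assume "y \<in> K x" then show "\<psi> x \<le> y" unfolding \<psi>_def by (rule cInf_lower[OF _ bdd])
    qed
  qed
  have \<psi>01: "\<psi> x \<in> {0..1}" if "x \<in> {0..1}" for x using K(2)[OF that] by (auto simp: K_def)
  have le: "{x\<in>A c. \<psi> x \<le> y} = {x\<in>A c. partial_measure (A c) x \<le> partial_measure (B c) y}"
    if "y \<in> {0..1}" for c y
    using K(3)[OF _ that] that by (auto simp: A_def K_def)
  have pm[measurable]: "partial_measure D \<in> borel_measurable unit_interval" if "D \<in> sets unit_interval" for D
    using borel_measurable_continuous_onI[OF partial_measure_continuous[OF that]]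
    by (rule measurable_compose[OF ident_unit_interval])
  have UA: "{0..1} = (\<Union>c\<in>C. A c)" using C by (auto simp: A_def)
  have A01: "0 \<le> \<psi> x \<and> \<psi> x \<le> 1" if "x \<in> A c" for x c
    using \<psi>01[of x] that by (simp add: A_def)
  have low: "{x\<in>A c. \<psi> x \<le> y} = {}" if "y < 0" for c y
  proof (rule equals0I)
    fix x assume "x \<in> {x\<in>A c. \<psi> x \<le> y}"
    then show False using A01[of x c] that by simp
  qed
  have high: "{x\<in>A c. \<psi> x \<le> y} = A c" if "y > 1" for c y
  proof safe
    fix x assume "x \<in> A c"
    then show "\<psi> x \<le> y" using A01[of x c] that by simp
  qed
  have sl[measurable]: "{x\<in>A c. \<psi> x \<le> y} \<in> sets unit_interval" for c y
  proof -
    consider "y < 0" | "y > 1" | "y \<in> {0..1}" by fastforce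
    then show ?thesis
    proof cases
      case 1
      then have "{x\<in>A c. \<psi> x \<le> y} = {}" by (rule low)
      then show ?thesis by (simp only: sets.empty_sets)
    next
      case 2
      then have "{x\<in>A c. \<psi> x \<le> y} = A c" by (rule high)
      then show ?thesis by (simp only: A)
    next
      case 3
      have "{x\<in>space unit_interval. x \<in> A c \<and> partial_measure (A c) x \<le> partial_measure (B c) y} \<in> sets unit_interval"
        by measurable
      also have "{x\<in>space unit_interval. x \<in> A c \<and> partial_measure (A c) x \<le> partial_measure (B c) y} = {x\<in>A c. partial_measure (A c) x \<le> partial_measure (B c) y}"
        by (auto simp: A_def)
      finally show ?thesis by (simp add: le[OF 3])
    qed
  qed
  \<comment> \<open>The integral transform on \<open>A c\<close> at the level
    \<open>partial_measure (B c) y\<close>.\<close>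
  have ml: "measure unit_interval {x\<in>A c. \<psi> x \<le> y} = partial_measure (B c) y" if c: "c \<in> C" for c y
  proof -
    consider "y < 0" | "y > 1" | "y \<in> {0..1}" by fastforce
    then show ?thesis
    proof cases
      case 1
      then show ?thesis by (simp only: low measure_empty partial_measure_0[OF B] less_imp_le)
    next
      case 2
      then show ?thesis by (simp only: high partial_measure_1[OF B] eq'[OF c] less_imp_le)
    next
      case 3
      show ?thesis unfolding le[OF 3]
        using partial_measure_nonneg[OF B] partial_measure_le[OF B, of c y]
        by (intro measure_partial_measure_le[OF A]) (simp_all add: eq'[OF c])
    qed
  qed
  have \<psi>b[measurable]: "\<psi> \<in> borel_measurable unit_interval"
  proof (rule borel_measurable_iff_le[THEN iffD2], rule allI)
    fix y
    have "{x\<in>space unit_interval. \<psi> x \<le> y} = (\<Union>c\<in>C. {x\<in>A c. \<psi> x \<le> y})"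
      using UA by auto
    also have "\<dots> \<in> sets unit_interval" using C(1) by (intro sets.finite_UN) auto
    finally show "{x\<in>space unit_interval. \<psi> x \<le> y} \<in> sets unit_interval" .
  qed
  have \<psi>m[measurable]: "\<psi> \<in> measurable unit_interval unit_interval"
    by (rule measurable_unit_intervalI) (use \<psi>01 in auto)
  \<comment> \<open>The image under \<open>\<psi>\<close> of the mass on \<open>A c\<close> and the
    mass on \<open>B c\<close> are finite measures on the line with the same distribution function,
    hence equal.\<close>
  have key: "measure unit_interval {x\<in>A c. \<psi> x \<in> X} = measure unit_interval (B c \<inter> X)"
    if c: "c \<in> C" and X[measurable]: "X \<in> sets borel" for c X
  proof -
    define M1 where "M1 = distr (restrict_space unit_interval (A c)) borel \<psi>"
    define M2 where "M2 = distr (restrict_space unit_interval (B c)) borel (\<lambda>x. x)"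
    have m1[measurable]: "\<psi> \<in> borel_measurable (restrict_space unit_interval (A c))"
      by (rule measurable_restrict_space1) measurable
    have m2[measurable]: "(\<lambda>x. x) \<in> borel_measurable (restrict_space unit_interval (B c))"
      by (rule measurable_restrict_space1) measurable
    have e1: "measure M1 Y = measure unit_interval {x\<in>A c. \<psi> x \<in> Y}" if [measurable]: "Y \<in> sets borel" for Y
    proof -
      have "\<psi> -` Y \<inter> space (restrict_space unit_interval (A c)) = {x\<in>A c. \<psi> x \<in> Y}"
        by (auto simp: space_restrict_space A_def)
      then show ?thesis unfolding M1_def
        by (subst measure_distr[OF m1 that]) (auto intro!: measure_restrict_space)
    qed
    have e2: "measure M2 Y = measure unit_interval (B c \<inter> Y)" if [measurable]: "Y \<in> sets borel" for Y
    proof -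
      have "(\<lambda>x. x) -` Y \<inter> space (restrict_space unit_interval (B c)) = B c \<inter> Y"
        by (auto simp: space_restrict_space B_def)
      then show ?thesis unfolding M2_def
        by (subst measure_distr[OF m2 that]) (auto intro!: measure_restrict_space)
    qed
    have "M1 = M2"
    proof (rule cdf_unique')
      have "finite_measure (restrict_space unit_interval (A c))" "finite_measure (restrict_space unit_interval (B c))"
        by (auto intro!: finite_measure_restrict_space unit_interval.finite_measure_axioms)
      then show "finite_borel_measure M1" "finite_borel_measure M2"
        unfolding finite_borel_measure_def finite_borel_measure_axioms_def M1_def M2_def
        by (auto intro!: finite_measure.finite_measure_distr)
      show "cdf M1 = cdf M2"
      proof
        fix y
        have "cdf M1 y = measure unit_interval {x\<in>A c. \<psi> x \<le> y}"
          by (simp add: cdf_def e1)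
        also have "\<dots> = cdf M2 y"
          by (simp add: cdf_def e2 ml[OF c] partial_measure_def)
        finally show "cdf M1 y = cdf M2 y" .
      qed
    qed
    then show ?thesis using e1[OF X] e2[OF X] by simp
  qed
  have sX[measurable]: "{x\<in>A c. \<psi> x \<in> X} \<in> sets unit_interval" if [measurable]: "X \<in> sets borel" for c X
  proof -
    have "{x\<in>space unit_interval. x \<in> A c \<and> \<psi> x \<in> X} \<in> sets unit_interval" by measurable
    also have "{x\<in>space unit_interval. x \<in> A c \<and> \<psi> x \<in> X} = {x\<in>A c. \<psi> x \<in> X}" by (auto simp: A_def)
    finally show ?thesis .
  qed
  have "distr unit_interval unit_interval \<psi> = unit_interval"
  proof (rule measure_eqI)
    fix X assume "X \<in> sets (distr unit_interval unit_interval \<psi>)"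
    then have X[measurable]: "X \<in> sets unit_interval" by simp
    note Xb[measurable] = unit_interval_sets_borel[OF X]
    have "measure unit_interval (\<psi> -` X \<inter> space unit_interval) = measure unit_interval (\<Union>c\<in>C. {x\<in>A c. \<psi> x \<in> X})"
      using UA by (intro arg_cong[where f="measure unit_interval"]) auto
    also have "\<dots> = (\<Sum>c\<in>C. measure unit_interval {x\<in>A c. \<psi> x \<in> X})"
    proof (rule unit_interval.finite_measure_finite_Union[OF C(1)])
      show "(\<lambda>c. {x\<in>A c. \<psi> x \<in> X}) ` C \<subseteq> sets unit_interval" using sX[OF Xb] by blast
    qed (auto simp: disjoint_family_on_def A_def)
    also have "\<dots> = (\<Sum>c\<in>C. measure unit_interval (B c \<inter> X))"
      by (intro sum.cong refl key) auto
    also have "\<dots> = measure unit_interval (\<Union>c\<in>C. B c \<inter> X)"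
    proof (rule unit_interval.finite_measure_finite_Union[OF C(1), symmetric])
      show "(\<lambda>c. B c \<inter> X) ` C \<subseteq> sets unit_interval" using B X by blast
    qed (auto simp: disjoint_family_on_def B_def)
    also have "(\<Union>c\<in>C. B c \<inter> X) = X"
      using C sets.sets_into_space[OF X] by (auto simp: B_def)
    finally show "emeasure (distr unit_interval unit_interval \<psi>) X = emeasure unit_interval X"
      by (simp add: emeasure_distr unit_interval.emeasure_eq_measure)
  qed simp
  then have 1: "measure_preserving_map \<psi>" by (simp add: measure_preserving_map_def \<psi>m)
  \<comment> \<open>With \<open>B c\<close> for \<open>X\<close> in \<open>key\<close>, the part of
    \<open>A c\<close> sent into \<open>B c\<close> has the full measure of \<open>A c\<close>, so
    the rest is null.\<close>
  have "AE x in unit_interval. x \<in> A c \<longrightarrow> \<psi> x \<in> B c" if c: "c \<in> C" for c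
  proof -
    have Bb[measurable]: "B c \<in> sets borel" by (rule unit_interval_sets_borel) simp
    have "measure unit_interval (A c - {x\<in>A c. \<psi> x \<in> B c}) = measure unit_interval (A c) - measure unit_interval {x\<in>A c. \<psi> x \<in> B c}"
      by (rule unit_interval.finite_measure_Diff) auto
    also have "\<dots> = 0" using key[OF c Bb] eq'[OF c] by simp
    finally have "A c - {x\<in>A c. \<psi> x \<in> B c} \<in> null_sets unit_interval"
      by (auto simp: null_sets_def unit_interval.emeasure_eq_measure)
    then show ?thesis by (rule AE_I') (auto simp: A_def)
  qed
  then have "AE x in unit_interval. \<forall>c\<in>C. x \<in> A c \<longrightarrow> \<psi> x \<in> B c"
    using C(1) by (simp add: AE_finite_all)
  then have "AE x in unit_interval. b (\<psi> x) = a x"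
    by (rule AE_mp) (auto intro!: AE_I2 simp: A_def B_def C)
  with 1 show ?thesis by (rule that)
qed

text \<open>Each class is trimmed on both sides to the smaller of its two sizes, and the surplus
  goes to an extra label \<open>None\<close>. All labels, \<open>None\<close> included, then have
  equal mass under \<open>a'\<close> and \<open>b'\<close>, so the exact rearrangement applies; up
  to a null set the classes can disagree only where \<open>a'\<close> is
  \<open>None\<close>.\<close>

lemma rearrangement:
  fixes a b :: "real \<Rightarrow> 'c" and C :: "'c set"
  assumes a[measurable]: "a \<in> measurable unit_interval (count_space UNIV)"
    and b[measurable]: "b \<in> measurable unit_interval (count_space UNIV)"
    and C: "finite C" "\<And>x. x \<in> {0..1} \<Longrightarrow> a x \<in> C" "\<And>x. x \<in> {0..1} \<Longrightarrow> b x \<in> C"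
  obtains \<psi> where "measure_preserving_map \<psi>"
    "measure unit_interval {x\<in>{0..1}. b (\<psi> x) \<noteq> a x} \<le>
     (\<Sum>c\<in>C. \<bar>measure unit_interval {x\<in>{0..1}. a x = c} - measure unit_interval {x\<in>{0..1}. b x = c}\<bar>)"
proof -
  define A where "A c = {x\<in>{0..1}. a x = c}" for c
  define B where "B c = {x\<in>{0..1}. b x = c}" for c
  have A[measurable]: "A c \<in> sets unit_interval" and B[measurable]: "B c \<in> sets unit_interval" for c
  proof -
    have "{x\<in>space unit_interval. a x = c} \<in> sets unit_interval" "{x\<in>space unit_interval. b x = c} \<in> sets unit_interval"
      by measurable
    then show "A c \<in> sets unit_interval" "B c \<in> sets unit_interval" by (auto simp: A_def B_def)
  qed
  define mn where "mn c = min (measure unit_interval (A c)) (measure unit_interval (B c))" for c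
  have "0 \<le> mn c" "mn c \<le> measure unit_interval (A c)" "mn c \<le> measure unit_interval (B c)" for c
    by (auto simp: mn_def)
  then have "\<exists>s. partial_measure (A c) s = mn c" "\<exists>s. partial_measure (B c) s = mn c" for c
    by (meson partial_measure_attains A B)+
  then obtain s t where s: "\<And>c. partial_measure (A c) (s c) = mn c" and t: "\<And>c. partial_measure (B c) (t c) = mn c"
    by metis
  \<comment> \<open>An initial segment of each class is kept; a cut at the required mass exists
    because distribution functions are continuous.\<close>
  define a' where "a' x = (if x \<le> s (a x) then Some (a x) else None)" for x
  define b' where "b' x = (if x \<le> t (b x) then Some (b x) else None)" for x
  have [measurable]: "(\<lambda>x. Some (a x)) \<in> measurable unit_interval (count_space UNIV)"
    "(\<lambda>x. Some (b x)) \<in> measurable unit_interval (count_space UNIV)"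
    "(\<lambda>x. s (a x)) \<in> borel_measurable unit_interval" "(\<lambda>x. t (b x)) \<in> borel_measurable unit_interval"
    by (rule measurable_compose[OF a] measurable_compose[OF b]; simp)+
  have [measurable]: "a' \<in> measurable unit_interval (count_space UNIV)" "b' \<in> measurable unit_interval (count_space UNIV)"
    unfolding a'_def b'_def by measurable
  let ?C = "insert None (Some ` C)"
  have am: "{x\<in>{0..1}. a' x = Some c} = A c \<inter> {..s c}" and bm: "{x\<in>{0..1}. b' x = Some c} = B c \<inter> {..t c}" for c
    by (auto simp: a'_def b'_def A_def B_def split: if_splits)
  have none: "measure unit_interval {x\<in>{0..1}. f x = None} = 1 - (\<Sum>c\<in>C. measure unit_interval {x\<in>{0..1}. f x = Some c})"
    if [measurable]: "f \<in> measurable unit_interval (count_space UNIV)" and fC: "\<And>x. x \<in> {0..1} \<Longrightarrow> f x \<in> ?C" for f :: "real \<Rightarrow> 'c option"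
  proof -
    have ms: "{x\<in>{0..1}. f x = c} \<in> sets unit_interval" for c
    proof -
      have "{x\<in>space unit_interval. f x = c} \<in> sets unit_interval" by measurable
      then show ?thesis by simp
    qed
    have "(\<Union>c\<in>?C. {x\<in>{0..1}. f x = c}) = {0..1}" using fC by blast
    then have "1 = measure unit_interval (\<Union>c\<in>?C. {x\<in>{0..1}. f x = c})" by (simp only: measure_unit_interval)
    also have "\<dots> = (\<Sum>c\<in>?C. measure unit_interval {x\<in>{0..1}. f x = c})"
      by (rule unit_interval.finite_measure_finite_Union) (use C ms in \<open>auto simp: disjoint_family_on_def\<close>)
    also have "\<dots> = measure unit_interval {x\<in>{0..1}. f x = None} + (\<Sum>c\<in>C. measure unit_interval {x\<in>{0..1}. f x = Some c})"
      using C(1) by (subst sum.insert) (auto simp: sum.reindex)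
    finally show ?thesis by simp
  qed
  have a'C: "a' x \<in> ?C" and b'C: "b' x \<in> ?C" if "x \<in> {0..1}" for x
    using C that by (auto simp: a'_def b'_def)
  have noneA: "measure unit_interval {x\<in>{0..1}. a' x = None} = 1 - (\<Sum>c\<in>C. mn c)"
    using none[of a'] a'C by (simp only: am s[unfolded partial_measure_def]) simp
  have noneB: "measure unit_interval {x\<in>{0..1}. b' x = None} = 1 - (\<Sum>c\<in>C. mn c)"
    using none[of b'] b'C by (simp only: bm t[unfolded partial_measure_def]) simp
  obtain \<psi> where \<psi>: "measure_preserving_map \<psi>" "AE x in unit_interval. b' (\<psi> x) = a' x"
  proof (rule rearrangement_exact[of a' b' ?C])
    show "measure unit_interval {x\<in>{0..1}. a' x = c} = measure unit_interval {x\<in>{0..1}. b' x = c}" if "c \<in> ?C" for c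
      by (cases c) (simp_all only: noneA noneB am bm s[unfolded partial_measure_def] t[unfolded partial_measure_def])
  qed (use C a'C b'C in auto)
  have [measurable]: "\<psi> \<in> measurable unit_interval unit_interval"
    using \<psi>(1) by (simp add: measure_preserving_map_def)
  have m1: "{x\<in>space unit_interval. a' x = None} \<in> sets unit_interval"
  proof -
    have "a' -` {None} \<inter> space unit_interval \<in> sets unit_interval"
      by (rule measurable_sets[where A="count_space UNIV"]) auto
    then show ?thesis by (simp add: vimage_def Collect_conj_eq[symmetric] Int_def conj_commute)
  qed
  have "measure unit_interval {x\<in>{0..1}. b (\<psi> x) \<noteq> a x} \<le> measure unit_interval {x\<in>{0..1}. a' x = None}"
  proof (rule unit_interval.finite_measure_mono_AE)
    show "AE x in unit_interval. x \<in> {x\<in>{0..1}. b (\<psi> x) \<noteq> a x} \<longrightarrow> x \<in> {x\<in>{0..1}. a' x = None}"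
      using \<psi>(2) by (rule AE_mp) (auto intro!: AE_I2 simp: a'_def b'_def split: if_splits)
  qed (use m1 in simp)
  also have "\<dots> = measure unit_interval (\<Union>c\<in>C. A c) - (\<Sum>c\<in>C. mn c)"
  proof -
    have "(\<Union>c\<in>C. A c) = {0..1}" using C by (auto simp: A_def)
    then show ?thesis by (simp only: noneA measure_unit_interval)
  qed
  also have "\<dots> = (\<Sum>c\<in>C. measure unit_interval (A c)) - (\<Sum>c\<in>C. mn c)"
  proof -
    have "measure unit_interval (\<Union>c\<in>C. A c) = (\<Sum>c\<in>C. measure unit_interval (A c))"
    proof (rule unit_interval.finite_measure_finite_Union[OF C(1)])
      show "A ` C \<subseteq> sets unit_interval" using A by blast
    qed (auto simp: disjoint_family_on_def A_def)
    then show ?thesis by simp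
  qed
  also have "\<dots> = (\<Sum>c\<in>C. measure unit_interval (A c) - mn c)" by (simp add: sum_subtractf)
  also have "\<dots> \<le> (\<Sum>c\<in>C. \<bar>measure unit_interval (A c) - measure unit_interval (B c)\<bar>)"
    by (intro sum_mono) (auto simp: mn_def)
  finally show ?thesis using that[OF \<psi>(1)] by (simp add: A_def B_def)
qed

section \<open>Weak regularity\<close>

text \<open>A partition is encoded by its class index \<open>c\<close>, so that refinement is
  arithmetic on indices; classes may be empty. The values \<open>v\<close> are constrained at all
  index pairs, which spares range conditions.\<close>

definition step_function :: "nat \<Rightarrow> (real \<Rightarrow> nat) \<Rightarrow> (nat \<Rightarrow> nat \<Rightarrow> real) \<Rightarrow> bool" where
  "step_function m c v \<longleftrightarrow> c \<in> measurable unit_interval (count_space UNIV) \<and> (\<forall>x\<in>{0..1}. c x < m) \<and>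
     (\<forall>i j. v i j \<in> {0..1} \<and> v i j = v j i)"

lemma graphon_of_step_function:
  assumes "step_function m c v" shows "graphon (\<lambda>(x, y). v (c x) (c y))"
proof -
  have c[measurable]: "c \<in> measurable unit_interval (count_space UNIV)" using assms by (simp add: step_function_def)
  let ?Q = "unit_interval \<Otimes>\<^sub>M unit_interval"
  have [measurable]: "(\<lambda>p. v i (c (snd p))) \<in> borel_measurable ?Q" for i
    by (rule measurable_compose[where N="count_space UNIV"]) auto
  have "(\<lambda>p. v (c (fst p)) (c (snd p))) \<in> borel_measurable ?Q"
    by (rule measurable_compose_countable[where f="\<lambda>i p. v i (c (snd p))"]) auto
  then show ?thesis using assms by (auto simp: graphon_def step_function_def case_prod_beta')
qed

lemma rectangle_integral_swap:
  assumes Z: "kernel Z" and [measurable]: "S \<in> sets unit_interval" "T \<in> sets unit_interval"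
  shows "(LINT z:T \<times> S|unit_square. Z z) = (LINT z:S \<times> T|unit_square. Z z)"
proof -
  note [measurable] = kernel_measurable[OF Z]
  have "(LINT z:T \<times> S|unit_square. Z z) = (\<integral>x. (\<integral>y. indicator T x * indicator S y * Z (x, y) \<partial>unit_interval) \<partial>unit_interval)"
    unfolding unit_square_def by (rule unit_interval.set_integral_Times[where B=1]) (auto simp: kernel_bound[OF Z])
  also have "\<dots> = (\<integral>y. (\<integral>x. indicator T x * indicator S y * Z (x, y) \<partial>unit_interval) \<partial>unit_interval)"
    by (rule unit_interval.fubini_bounded[where B=1]) (auto simp: kernel_bound[OF Z] indicator_def)
  also have "\<dots> = (\<integral>y. (\<integral>x. indicator S y * indicator T x * Z (y, x) \<partial>unit_interval) \<partial>unit_interval)"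
    by (intro Bochner_Integration.integral_cong refl) (auto intro: kernel_sym[OF Z] simp: indicator_def)
  also have "\<dots> = (LINT z:S \<times> T|unit_square. Z z)"
    unfolding unit_square_def by (rule unit_interval.set_integral_Times[where B=1, symmetric]) (auto simp: kernel_bound[OF Z])
  finally show ?thesis .
qed

text \<open>Clamping is the nearest-point projection onto an interval that contains
  \<open>w\<close>.\<close>

lemma square_diff_clamp_le:
  fixes w a :: real
  assumes "0 \<le> w" "w \<le> 1" shows "(w - max 0 (min 1 a))\<^sup>2 \<le> (w - a)\<^sup>2"
  using assms by (intro abs_le_square_iff[THEN iffD1]) (auto simp: max_def min_def)

text \<open>The decrement survives clamping the new step function to \<open>[0, 1]\<close>, because \<open>W\<close> has values there.\<close>

lemma energy_decrement:
  fixes W :: "real \<times> real \<Rightarrow> real"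
  assumes W: "graphon W" and step: "step_function m c v" and \<epsilon>: "0 < \<epsilon>"
    and big: "\<not> cut_norm (\<lambda>(x, y). W (x, y) - v (c x) (c y)) \<le> \<epsilon>"
  obtains c' v' where "step_function (4 * m) c' v'"
    "(\<integral>(x, y). (W (x, y) - v' (c' x) (c' y))\<^sup>2 \<partial>unit_square)
      \<le> (\<integral>(x, y). (W (x, y) - v (c x) (c y))\<^sup>2 \<partial>unit_square) - \<epsilon>\<^sup>2"
proof -
  interpret P: pair_prob_space unit_interval unit_interval ..
  define Z where "Z = (\<lambda>(x, y). W (x, y) - v (c x) (c y))"
  have "kernel (\<lambda>p. W p - (\<lambda>(x, y). v (c x) (c y)) p)"
    by (rule graphon_diff_kernel[OF W graphon_of_step_function[OF step]])
  also have "(\<lambda>p. W p - (\<lambda>(x, y). v (c x) (c y)) p) = Z"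
    by (auto simp: Z_def)
  finally have Z: "kernel Z" .
  note [measurable] = kernel_measurable[OF Z] graphon_measurable[OF W]
  obtain S T where S[measurable]: "S \<in> sets unit_interval" and T[measurable]: "T \<in> sets unit_interval"
    and ST: "\<bar>LINT z:S \<times> T|unit_square. Z z\<bar> > \<epsilon>"
    using big cut_norm_upper[of Z \<epsilon>] unfolding Z_def[symmetric] by (auto simp: not_le[symmetric])
  define J where "J = (LINT z:S \<times> T|unit_square. Z z)"
  \<comment> \<open>The correction has size \<open>\<epsilon>\<close> and the sign of
    \<open>J\<close>, so that its correlation with \<open>Z\<close> is at least
    \<open>\<epsilon> * \<epsilon>\<close>.\<close>
  define t where "t = (if J \<ge> 0 then \<epsilon> else - \<epsilon>)"
  have "t * J = \<epsilon> * \<bar>J\<bar>" by (simp add: t_def)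
  then have tJ: "t * J \<ge> \<epsilon> * \<epsilon>"
    using mult_left_mono[of \<epsilon> "\<bar>J\<bar>" \<epsilon>] ST \<epsilon> by (simp add: J_def)
  \<comment> \<open>The last base-4 digit of the new index records membership in \<open>S\<close>
    and in \<open>T\<close>; \<open>s1\<close> and \<open>t1\<close> read it back, and
    \<open>div 4\<close> recovers the old class.\<close>
  define c' where "c' x = 4 * c x + (if x \<in> S then 2 else 0) + (if x \<in> T then 1 else 0)" for x
  define s1 where "s1 i = (if i mod 4 \<ge> 2 then 1 else 0 :: real)" for i :: nat
  define t1 where "t1 i = (if odd i then 1 else 0 :: real)" for i :: nat
  define v' where "v' i j = max 0 (min 1 (v (i div 4) (j div 4) + t * ((s1 i * t1 j + t1 i * s1 j) / 2)))" for i j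
  \<comment> \<open>The correction must be symmetric, so the rectangle is averaged with its
    transpose; the integral against the symmetric \<open>Z\<close> is still
    \<open>J\<close>.\<close>
  define h where "h p = (indicator (S \<times> T) p + indicator (T \<times> S) p) / (2::real)" for p :: "real \<times> real"
  have c'm: "c' \<in> measurable unit_interval (count_space UNIV)"
  proof -
    have c: "c \<in> measurable unit_interval (count_space UNIV)" using step by (simp add: step_function_def)
    then have [measurable]: "(\<lambda>x. 4 * c x) \<in> measurable unit_interval (count_space UNIV)"
      by (rule measurable_compose) simp
    show ?thesis unfolding c'_def by measurable
  qed
  have "c' x < 4 * m" if "x \<in> {0..1}" for x
  proof -
    have "c x + 1 \<le> m" using step that by (auto simp: step_function_def Suc_le_eq)
    then show ?thesis by (auto simp: c'_def)
  qed
  moreover have "v' i j \<in> {0..1} \<and> v' i j = v' j i" for i j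
  proof -
    have "v (i div 4) (j div 4) = v (j div 4) (i div 4)" using step by (auto simp: step_function_def)
    then show ?thesis by (auto simp: v'_def mult.commute add.commute)
  qed
  ultimately have step': "step_function (4 * m) c' v'"
    using c'm by (simp add: step_function_def)
  have c'div: "c' x div 4 = c x" and s1c: "s1 (c' x) = indicator S x" and t1c: "t1 (c' x) = indicator T x" for x
    by (auto simp: c'_def s1_def t1_def indicator_def)
  have h01: "0 \<le> h p" "h p \<le> 1" for p by (auto simp: h_def indicator_def)
  have hm[measurable]: "h \<in> borel_measurable (unit_interval \<Otimes>\<^sub>M unit_interval)"
    unfolding h_def by measurable
  have v'eq: "v' (c' x) (c' y) = max 0 (min 1 (v (c x) (c y) + t * h (x, y)))" for x y
    by (simp add: v'_def c'div s1c t1c h_def indicator_times)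
  have m': "(\<lambda>(x, y). v' (c' x) (c' y)) \<in> borel_measurable (unit_interval \<Otimes>\<^sub>M unit_interval)"
    using graphon_measurable[OF graphon_of_step_function[OF step']] .
  have m'2[measurable]: "(\<lambda>p. W p - (\<lambda>(x, y). v' (c' x) (c' y)) p) \<in> borel_measurable (unit_interval \<Otimes>\<^sub>M unit_interval)"
    using m' by measurable
  have iZ: "integrable unit_square (\<lambda>p. (Z p)\<^sup>2)" and iZh: "integrable unit_square (\<lambda>p. h p * Z p)"
      and ih: "integrable unit_square (\<lambda>p. (h p)\<^sup>2)"
    unfolding unit_square_def using h01
    by (rule_tac P.integrable_bounded[where B=1];
        auto simp: space_pair_measure kernel_bound[OF Z] abs_square_le_1 abs_mult intro!: mult_le_one)+
  have iZ': "integrable unit_square (\<lambda>p. (Z p)\<^sup>2 - 2 * t * (h p * Z p) + t\<^sup>2 * (h p)\<^sup>2)"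
    using iZ iZh ih by (intro Bochner_Integration.integrable_add Bochner_Integration.integrable_diff integrable_mult_right) auto
  have "(\<integral>(x, y). (W (x, y) - v' (c' x) (c' y))\<^sup>2 \<partial>unit_square) = (\<integral>p. (W p - (\<lambda>(x, y). v' (c' x) (c' y)) p)\<^sup>2 \<partial>unit_square)"
    by (simp add: case_prod_beta')
  \<comment> \<open>Pointwise, clamping does not increase the error, and the unclamped error is
    \<open>Z p - t * h p\<close>, whose square is expanded.\<close>
  also have "\<dots> \<le> (\<integral>p. (Z p)\<^sup>2 - 2 * t * (h p * Z p) + t\<^sup>2 * (h p)\<^sup>2 \<partial>unit_square)"
  proof (rule integral_mono[OF _ iZ'])
    show "integrable unit_square (\<lambda>p. (W p - (\<lambda>(x, y). v' (c' x) (c' y)) p)\<^sup>2)"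
      unfolding unit_square_def
    proof (rule P.integrable_bounded[where B=1])
      fix p :: "real \<times> real" assume p: "p \<in> space (unit_interval \<Otimes>\<^sub>M unit_interval)"
      then have "\<bar>W p - (\<lambda>(x, y). v' (c' x) (c' y)) p\<bar> \<le> 1"
        using kernel_bound[OF graphon_diff_kernel[OF W graphon_of_step_function[OF step']], of "fst p" "snd p"]
        by (auto simp: space_pair_measure)
      then show "\<bar>(W p - (\<lambda>(x, y). v' (c' x) (c' y)) p)\<^sup>2\<bar> \<le> 1" by (simp add: abs_square_le_1)
    qed measurable
    fix p :: "real \<times> real" assume p: "p \<in> space unit_square"
    obtain x y where xy: "p = (x, y)" by (cases p)
    have W01: "0 \<le> W (x, y)" "W (x, y) \<le> 1" using W p xy by (auto simp: graphon_def unit_square_def space_pair_measure)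
    have "(W p - (\<lambda>(x, y). v' (c' x) (c' y)) p)\<^sup>2 \<le> (W (x, y) - (v (c x) (c y) + t * h (x, y)))\<^sup>2"
      unfolding xy by (simp add: v'eq square_diff_clamp_le[OF W01])
    also have "\<dots> = (Z p)\<^sup>2 - 2 * t * (h p * Z p) + t\<^sup>2 * (h p)\<^sup>2"
      by (simp add: xy Z_def power2_eq_square algebra_simps)
    finally show "(W p - (\<lambda>(x, y). v' (c' x) (c' y)) p)\<^sup>2 \<le> (Z p)\<^sup>2 - 2 * t * (h p * Z p) + t\<^sup>2 * (h p)\<^sup>2" .
  qed
  also have "\<dots> = (\<integral>p. (Z p)\<^sup>2 \<partial>unit_square) - 2 * t * (\<integral>p. h p * Z p \<partial>unit_square) + t\<^sup>2 * (\<integral>p. (h p)\<^sup>2 \<partial>unit_square)"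
    using iZ iZh ih by simp
  also have "(\<integral>p. h p * Z p \<partial>unit_square) = J"
  proof -
    have int: "integrable unit_square (\<lambda>p. indicator (A \<times> B) p * Z p)"
      if [measurable]: "A \<in> sets unit_interval" "B \<in> sets unit_interval" for A B
      unfolding unit_square_def
      by (rule P.integrable_bounded[where B=1]) (auto simp: space_pair_measure kernel_bound[OF Z] indicator_def)
    have "(\<integral>p. h p * Z p \<partial>unit_square) = (\<integral>p. (indicator (S \<times> T) p * Z p + indicator (T \<times> S) p * Z p) / 2 \<partial>unit_square)"
      by (simp add: h_def field_simps)
    also have "\<dots> = ((LINT z:S \<times> T|unit_square. Z z) + (LINT z:T \<times> S|unit_square. Z z)) / 2"
      unfolding set_lebesgue_integral_def using int[OF S T] int[OF T S] by simp
    also have "\<dots> = J" using rectangle_integral_swap[OF Z S T] by (simp add: J_def)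
    finally show ?thesis .
  qed
  \<comment> \<open>The cross term gains at least \<open>2 * \<epsilon>\<^sup>2\<close>, and the
    square of the correction loses at most \<open>\<epsilon>\<^sup>2\<close>.\<close>
  also have "(\<integral>p. (Z p)\<^sup>2 \<partial>unit_square) - 2 * t * J + t\<^sup>2 * (\<integral>p. (h p)\<^sup>2 \<partial>unit_square)
     \<le> (\<integral>p. (Z p)\<^sup>2 \<partial>unit_square) - 2 * \<epsilon>\<^sup>2 + \<epsilon>\<^sup>2 * 1"
  proof -
    have "(\<integral>p. (h p)\<^sup>2 \<partial>unit_square) \<le> 1"
      unfolding unit_square_def using h01 by (intro abs_le_D1[OF P.abs_integral_le]) (auto simp: abs_square_le_1)
    then have "\<epsilon>\<^sup>2 * (\<integral>p. (h p)\<^sup>2 \<partial>unit_square) \<le> \<epsilon>\<^sup>2 * 1" by (intro mult_left_mono) auto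
    moreover have "t\<^sup>2 = \<epsilon>\<^sup>2" by (simp add: t_def)
    ultimately show ?thesis using tJ by (simp add: power2_eq_square)
  qed
  finally have "(\<integral>(x, y). (W (x, y) - v' (c' x) (c' y))\<^sup>2 \<partial>unit_square) \<le> (\<integral>p. (Z p)\<^sup>2 \<partial>unit_square) - \<epsilon>\<^sup>2"
    by simp
  also have "(\<integral>p. (Z p)\<^sup>2 \<partial>unit_square) = (\<integral>(x, y). (W (x, y) - v (c x) (c y))\<^sup>2 \<partial>unit_square)"
    by (simp add: Z_def case_prod_beta')
  finally show ?thesis using that[OF step'] by simp
qed

text \<open>The Frieze-Kannan energy argument: the squared L2 error is at most 1 at the start, is
  never negative, and drops by \<open>\<epsilon>\<^sup>2\<close> as long as the cut norm exceeds
  \<open>\<epsilon>\<close>. So the number of classes is bounded in terms of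
  \<open>\<epsilon>\<close> alone, uniformly in \<open>W\<close>.\<close>

lemma weak_regularity:
  assumes \<epsilon>: "0 < (\<epsilon>::real)"
  obtains M where "\<And>W. graphon W \<Longrightarrow>
    \<exists>c v. step_function M c v \<and> cut_norm (\<lambda>(x, y). W (x, y) - v (c x) (c y)) \<le> \<epsilon>"
proof -
  interpret P: pair_prob_space unit_interval unit_interval ..
  \<comment> \<open>After \<open>N\<close> unsuccessful rounds the error would be negative; each
    round multiplies the number of classes by 4.\<close>
  obtain N :: nat where N: "1 < N * \<epsilon>\<^sup>2"
    using reals_Archimedean3[of "\<epsilon>\<^sup>2"] \<epsilon> by (auto simp: mult.commute)
  have "\<exists>c v. step_function (4 ^ N) c v \<and> cut_norm (\<lambda>(x, y). W (x, y) - v (c x) (c y)) \<le> \<epsilon>"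
    if W: "graphon W" for W
  proof (rule ccontr)
    assume neg: "\<not> ?thesis"
    have "\<exists>c v. step_function (4 ^ n) c v \<and>
        (\<integral>(x, y). (W (x, y) - v (c x) (c y))\<^sup>2 \<partial>unit_square) \<le> 1 - n * \<epsilon>\<^sup>2" if "n \<le> N" for n
      using that
    proof (induction n)
      case 0
      have st: "step_function 1 (\<lambda>_. 0) (\<lambda>_ _. 0)" by (simp add: step_function_def)
      have E: "(\<integral>(x, y). (W (x, y) - 0)\<^sup>2 \<partial>unit_square) \<le> 1"
        unfolding unit_square_def using W
        by (intro abs_le_D1[OF P.abs_integral_le]) (auto simp: space_pair_measure graphon_def abs_square_le_1)
      show ?case
        by (intro exI[of _ "\<lambda>_. 0"] exI[of _ "\<lambda>_ _. 0"]) (use st E in \<open>simp add: case_prod_beta'\<close>)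
    next
      case (Suc n)
      then obtain c v where st: "step_function (4 ^ n) c v"
        and E: "(\<integral>(x, y). (W (x, y) - v (c x) (c y))\<^sup>2 \<partial>unit_square) \<le> 1 - n * \<epsilon>\<^sup>2" by auto
      \<comment> \<open>Empty classes pad the partition to \<open>4 ^ N\<close> classes, so the
        negated claim covers every stage.\<close>
      have "(4::nat) ^ n \<le> 4 ^ N" using Suc.prems by (intro power_increasing) auto
      then have "step_function (4 ^ N) c v" using st unfolding step_function_def by (meson order_less_le_trans)
      then have "\<not> cut_norm (\<lambda>(x, y). W (x, y) - v (c x) (c y)) \<le> \<epsilon>" using neg by blast
      from energy_decrement[OF W st \<epsilon> this] obtain c' v' where
        "step_function (4 * 4 ^ n) c' v'" "(\<integral>(x, y). (W (x, y) - v' (c' x) (c' y))\<^sup>2 \<partial>unit_square)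
         \<le> (\<integral>(x, y). (W (x, y) - v (c x) (c y))\<^sup>2 \<partial>unit_square) - \<epsilon>\<^sup>2" .
      with E have "step_function (4 ^ Suc n) c' v'"
         "(\<integral>(x, y). (W (x, y) - v' (c' x) (c' y))\<^sup>2 \<partial>unit_square) \<le> 1 - Suc n * \<epsilon>\<^sup>2"
        by (auto simp: algebra_simps)
      then show ?case by blast
    qed
    from this[OF order_refl] obtain c :: "real \<Rightarrow> nat" and v where "(\<integral>(x, y). (W (x, y) - v (c x) (c y))\<^sup>2 \<partial>unit_square) \<le> 1 - N * \<epsilon>\<^sup>2"
      by blast
    moreover have "0 \<le> (\<integral>(x, y). (W (x, y) - v (c x) (c y))\<^sup>2 \<partial>unit_square)"
      by (rule Bochner_Integration.integral_nonneg) (simp add: case_prod_beta')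
    ultimately show False using N by linarith
  qed
  then show ?thesis using that by blast
qed

section \<open>The random graph\<close>

lemma finite_vertex_pairs[simp]: "finite (vertex_pairs k)"
  by (rule finite_subset[of _ "{1..k} \<times> {1..k}"]) (auto simp: vertex_pairs_def)

text \<open>Meant for subsets of \<open>vertex_pairs k\<close>: increasing pairs correspond to the
  independent coins.\<close>

definition edge_graph :: "nat \<Rightarrow> (nat \<times> nat) set \<Rightarrow> graph" where
  "edge_graph k B = ({1..k}, {{i, j} |i j. (i, j) \<in> B})"

text \<open>For \<open>B\<close> a subset of \<open>vertex_pairs k\<close>, the conditional
  probability, given the sample points, that the edge set is \<open>B\<close>. Finite sums with
  these weights take the place of the probability mass function.\<close>

definition edge_weight :: "nat \<Rightarrow> (real \<times> real \<Rightarrow> real) \<Rightarrow> (nat \<Rightarrow> real) \<Rightarrow> (nat \<times> nat) set \<Rightarrow> real" where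
  "edge_weight k W x B =
     (\<Prod>e\<in>vertex_pairs k. if e \<in> B then W (x (fst e), x (snd e)) else 1 - W (x (fst e), x (snd e)))"

abbreviation sample_space :: "nat \<Rightarrow> (nat \<Rightarrow> real) measure" where
  "sample_space k \<equiv> \<Pi>\<^sub>M i\<in>{1..k}. unit_interval"

lemma sample_space_in: "x \<in> space (sample_space k) \<Longrightarrow> i \<in> {1..k} \<Longrightarrow> x i \<in> {0..1}"
  by (auto simp: space_PiM PiE_iff)

lemma graphon_sample:
  assumes "graphon W" "x \<in> space (sample_space k)" "e \<in> vertex_pairs k"
  shows "W (x (fst e), x (snd e)) \<in> {0..1}"
  using assms sample_space_in[OF assms(2)] by (auto simp: vertex_pairs_def graphon_def)

lemma sum_Pow_prod:
  fixes g :: "'e \<Rightarrow> bool \<Rightarrow> real"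
  assumes "finite A"
  shows "(\<Sum>B\<in>Pow A. \<Prod>e\<in>A. g e (e \<in> B)) = (\<Prod>e\<in>A. g e True + g e False)"
proof -
  have "(\<Prod>e\<in>A. g e True + g e False) = (\<Sum>B\<in>Pow A. (\<Prod>e\<in>B. g e True) * (\<Prod>e\<in>A - B. g e False))"
    by (rule prod_add) fact
  also have "\<dots> = (\<Sum>B\<in>Pow A. \<Prod>e\<in>A. g e (e \<in> B))"
  proof (intro sum.cong refl)
    fix B assume "B \<in> Pow A"
    then have "(\<Prod>e\<in>A. g e (e \<in> B)) = (\<Prod>e\<in>A - B. g e (e \<in> B)) * (\<Prod>e\<in>B. g e (e \<in> B))"
      using assms by (intro prod.subset_diff) auto
    then show "(\<Prod>e\<in>B. g e True) * (\<Prod>e\<in>A - B. g e False) = (\<Prod>e\<in>A. g e (e \<in> B))" by (simp add: mult.commute)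
  qed
  finally show ?thesis by simp
qed

text \<open>Independence of the edges: the mean of a product of functions of single edges is the
  product of the means.\<close>

lemma sum_edge_weight_prod:
  "(\<Sum>B\<in>Pow (vertex_pairs k). edge_weight k W x B * (\<Prod>e\<in>vertex_pairs k. g e (e \<in> B))) =
   (\<Prod>e\<in>vertex_pairs k. W (x (fst e), x (snd e)) * g e True + (1 - W (x (fst e), x (snd e))) * g e False)"
proof -
  have "(\<Sum>B\<in>Pow (vertex_pairs k). edge_weight k W x B * (\<Prod>e\<in>vertex_pairs k. g e (e \<in> B))) =
    (\<Sum>B\<in>Pow (vertex_pairs k). \<Prod>e\<in>vertex_pairs k.
       (\<lambda>e b. (if b then W (x (fst e), x (snd e)) else 1 - W (x (fst e), x (snd e))) * g e b) e (e \<in> B))"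
    by (simp add: edge_weight_def prod.distrib)
  also have "\<dots> = (\<Prod>e\<in>vertex_pairs k. W (x (fst e), x (snd e)) * g e True + (1 - W (x (fst e), x (snd e))) * g e False)"
    by (subst sum_Pow_prod) auto
  finally show ?thesis .
qed

lemma sum_edge_weight: "(\<Sum>B\<in>Pow (vertex_pairs k). edge_weight k W x B) = 1"
  using sum_edge_weight_prod[of k W x "\<lambda>_ _. 1"] by simp

lemma edge_weight_nonneg:
  assumes "graphon W" "x \<in> space (sample_space k)"
  shows "0 \<le> edge_weight k W x B"
  unfolding edge_weight_def using graphon_sample[OF assms] by (intro prod_nonneg) auto

lemma edge_weight_le_1:
  assumes "graphon W" "x \<in> space (sample_space k)"
  shows "edge_weight k W x B \<le> 1"
  unfolding edge_weight_def using graphon_sample[OF assms] by (intro prod_le_1) auto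

lemma measurable_edge_weight[measurable]:
  assumes "graphon W"
  shows "(\<lambda>x. edge_weight k W x B) \<in> borel_measurable (sample_space k)"
  unfolding edge_weight_def
proof (rule borel_measurable_prod)
  fix e assume e: "e \<in> vertex_pairs k"
  note [measurable] = graphon_measurable[OF assms]
  have "fst e \<in> {1..k}" "snd e \<in> {1..k}" using e by (auto simp: vertex_pairs_def)
  then show "(\<lambda>x. if e \<in> B then W (x (fst e), x (snd e)) else 1 - W (x (fst e), x (snd e)))
     \<in> borel_measurable (sample_space k)"
    by (cases "e \<in> B") simp_all
qed

lemma prob_sampled_graph:
  assumes W: "graphon W" and x: "x \<in> space (sample_space k)"
  shows "measure_pmf.prob (sampled_graph k W x) P =
    (\<Sum>B\<in>Pow (vertex_pairs k). edge_weight k W x B * of_bool (edge_graph k B \<in> P))"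
proof -
  let ?A = "vertex_pairs k"
  let ?p = "Pi_pmf ?A False (\<lambda>(i, j). bernoulli_pmf (W (x i, x j)))"
  let ?S = "PiE_dflt ?A False (\<lambda>_. UNIV :: bool set)"
  define G where "G b = ({1..k}, {{i, j} |i j. (i, j) \<in> ?A \<and> b (i, j)})" for b
  have fin: "finite ?S" by (rule finite_PiE_dflt) auto
  have "measure_pmf.prob (sampled_graph k W x) P = measure_pmf.prob ?p (G -` P)"
    unfolding sampled_graph_def G_def[abs_def] by (simp add: measure_map_pmf)
  also have "\<dots> = (\<integral>b. indicator (G -` P) b \<partial>measure_pmf ?p)" by simp
  also have "\<dots> = (\<Sum>b\<in>?S. indicator (G -` P) b * pmf ?p b)"
    using set_Pi_pmf_subset[of ?A False "\<lambda>(i, j). bernoulli_pmf (W (x i, x j))"]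
    by (intro integral_measure_pmf_real fin) (auto simp: PiE_dflt_def)
  \<comment> \<open>Off \<open>?A\<close> the coins have the default value \<open>False\<close>, so
    a coin function and the set of its true arguments determine each other.\<close>
  also have "\<dots> = (\<Sum>B\<in>Pow ?A. edge_weight k W x B * of_bool (edge_graph k B \<in> P))"
  proof (rule sum.reindex_bij_witness[where i="\<lambda>B e. e \<in> B" and j="\<lambda>b. {e. b e}"])
    fix b assume b: "b \<in> ?S"
    have "pmf ?p b = (\<Prod>e\<in>?A. pmf (case e of (i, j) \<Rightarrow> bernoulli_pmf (W (x i, x j))) (b e))"
      by (rule pmf_Pi') (use b in \<open>auto simp: PiE_dflt_def\<close>)
    also have "\<dots> = edge_weight k W x {e. b e}"
      unfolding edge_weight_def
    proof (intro prod.cong refl)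
      fix e assume "e \<in> ?A"
      from graphon_sample[OF W x this]
      show "pmf (case e of (i, j) \<Rightarrow> bernoulli_pmf (W (x i, x j))) (b e) =
        (if e \<in> {e. b e} then W (x (fst e), x (snd e)) else 1 - W (x (fst e), x (snd e)))"
        by (cases "b e") (auto simp: case_prod_beta)
    qed
    finally have p: "pmf ?p b = edge_weight k W x {e. b e}" .
    have "G b = edge_graph k {e. b e}"
      using b unfolding G_def edge_graph_def PiE_dflt_def by fastforce
    then show "edge_weight k W x {e. b e} * of_bool (edge_graph k {e. b e} \<in> P) = indicator (G -` P) b * pmf ?p b"
      by (simp add: p indicator_def)
    show "{e. b e} \<in> Pow ?A" using b by (auto simp: PiE_dflt_def)
  qed (auto simp: PiE_dflt_def)
  finally show ?thesis .
qed

lemma prob_space_sample: "prob_space (sample_space k)"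
  by (rule prob_space_PiM) (rule prob_space_unit_interval)

text \<open>Acceptance probabilities become integrals of a polynomial in the values of
  \<open>W\<close>; the later estimates for \<open>random_graph\<close> rest on this form.\<close>

lemma prob_random_graph:
  assumes W: "graphon W"
  shows "measure (random_graph k W) P =
    (\<integral>x. (\<Sum>B\<in>Pow (vertex_pairs k). edge_weight k W x B * of_bool (edge_graph k B \<in> P)) \<partial>sample_space k)"
proof -
  interpret P: prob_space "sample_space k" by (rule prob_space_sample)
  have m: "(\<lambda>x. measure_pmf (sampled_graph k W x)) \<in> measurable (sample_space k) (subprob_algebra (count_space UNIV))"
  proof (rule measurable_subprob_algebra)
    fix A :: "graph set"
    have "(\<lambda>x. ennreal (\<Sum>B\<in>Pow (vertex_pairs k). edge_weight k W x B * of_bool (edge_graph k B \<in> A))) \<in> borel_measurable (sample_space k)"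
      using W by measurable
    then show "(\<lambda>x. emeasure (measure_pmf (sampled_graph k W x)) A) \<in> borel_measurable (sample_space k)"
      by (rule measurable_cong[THEN iffD1, rotated])
         (simp add: measure_pmf.emeasure_eq_measure prob_sampled_graph[OF W])
  qed (auto intro: measure_pmf.subprob_space_axioms)
  have "measure (random_graph k W) P = (\<integral>x. measure_pmf.prob (sampled_graph k W x) P \<partial>sample_space k)"
    unfolding random_graph_def by (rule P.measure_bind[OF m]) simp
  also have "\<dots> = (\<integral>x. (\<Sum>B\<in>Pow (vertex_pairs k). edge_weight k W x B * of_bool (edge_graph k B \<in> P)) \<partial>sample_space k)"
    by (intro Bochner_Integration.integral_cong refl) (rule prob_sampled_graph[OF W])
  finally show ?thesis .
qed

lemma integrable_edge_weight_sum:
  assumes W: "graphon W"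
  shows "integrable (sample_space k) (\<lambda>x. \<Sum>B\<in>Pow (vertex_pairs k). edge_weight k W x B * of_bool (edge_graph k B \<in> P))"
proof -
  interpret P: prob_space "sample_space k" by (rule prob_space_sample)
  show ?thesis
  proof (intro Bochner_Integration.integrable_sum P.integrable_bounded[where B=1])
    fix B x assume "x \<in> space (sample_space k)"
    then show "\<bar>edge_weight k W x B * of_bool (edge_graph k B \<in> P)\<bar> \<le> 1"
      using edge_weight_nonneg[OF W] edge_weight_le_1[OF W] by (cases "edge_graph k B \<in> P") auto
  qed (intro borel_measurable_times measurable_edge_weight W borel_measurable_const)
qed

text \<open>Only the graphs \<open>edge_graph k B\<close> carry mass, so the inclusion is tested on
  these alone.\<close>

lemma prob_random_graph_mono:
  assumes W: "graphon W" and PQ: "\<And>B. B \<subseteq> vertex_pairs k \<Longrightarrow> edge_graph k B \<in> P \<Longrightarrow> edge_graph k B \<in> Q"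
  shows "measure (random_graph k W) P \<le> measure (random_graph k W) Q"
  unfolding prob_random_graph[OF W]
proof (intro integral_mono integrable_edge_weight_sum W sum_mono mult_left_mono)
  fix x B assume "B \<in> Pow (vertex_pairs k)"
  then show "(of_bool (edge_graph k B \<in> P) :: real) \<le> of_bool (edge_graph k B \<in> Q)" using PQ by auto
qed (rule edge_weight_nonneg[OF W])

lemma prob_random_graph_UNIV:
  assumes W: "graphon W" shows "measure (random_graph k W) UNIV = 1"
proof -
  interpret P: prob_space "sample_space k" by (rule prob_space_sample)
  show ?thesis unfolding prob_random_graph[OF W] using P.prob_space by (simp add: sum_edge_weight)
qed

lemma prob_random_graph_disjoint:
  assumes W: "graphon W" and d: "P \<inter> Q = {}"
  shows "measure (random_graph k W) P + measure (random_graph k W) Q \<le> 1"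
proof -
  interpret P: prob_space "sample_space k" by (rule prob_space_sample)
  note int = integrable_edge_weight_sum[OF W]
  have "measure (random_graph k W) P + measure (random_graph k W) Q =
    (\<integral>x. (\<Sum>B\<in>Pow (vertex_pairs k). edge_weight k W x B * of_bool (edge_graph k B \<in> P)) +
      (\<Sum>B\<in>Pow (vertex_pairs k). edge_weight k W x B * of_bool (edge_graph k B \<in> Q)) \<partial>sample_space k)"
    unfolding prob_random_graph[OF W] by (rule Bochner_Integration.integral_add[symmetric]) (rule int)+
  also have "\<dots> \<le> (\<integral>x. 1 \<partial>sample_space k)"
  proof (rule integral_mono)
    fix x assume x: "x \<in> space (sample_space k)"
    have "(\<Sum>B\<in>Pow (vertex_pairs k). edge_weight k W x B * of_bool (edge_graph k B \<in> P)) +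
      (\<Sum>B\<in>Pow (vertex_pairs k). edge_weight k W x B * of_bool (edge_graph k B \<in> Q))
      \<le> (\<Sum>B\<in>Pow (vertex_pairs k). edge_weight k W x B)"
      unfolding sum.distrib[symmetric] using d edge_weight_nonneg[OF W x]
      by (intro sum_mono) (auto simp: of_bool_def)
    then show "(\<Sum>B\<in>Pow (vertex_pairs k). edge_weight k W x B * of_bool (edge_graph k B \<in> P)) +
      (\<Sum>B\<in>Pow (vertex_pairs k). edge_weight k W x B * of_bool (edge_graph k B \<in> Q)) \<le> 1"
      by (simp add: sum_edge_weight)
  qed (intro Bochner_Integration.integrable_add int P.integrable_const)+
  also have "\<dots> = 1" using P.prob_space by simp
  finally show ?thesis .
qed

section \<open>Integrating out one sample point\<close>

lemma measurable_resample:
  fixes F :: "(nat \<Rightarrow> real) \<Rightarrow> real"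
  assumes i: "i \<in> {1..k}" and F[measurable]: "F \<in> borel_measurable (sample_space k)"
  shows "(\<lambda>x. \<integral>y. F (x(i := y)) \<partial>unit_interval) \<in> borel_measurable (sample_space k)"
proof -
  have "(\<lambda>p. (fst p)(i := snd p)) \<in> measurable (sample_space k \<Otimes>\<^sub>M unit_interval) (Pi\<^sub>M (insert i {1..k}) (\<lambda>_. unit_interval))"
    by measurable
  then have [measurable]: "(\<lambda>p. (fst p)(i := snd p)) \<in> measurable (sample_space k \<Otimes>\<^sub>M unit_interval) (sample_space k)"
    unfolding insert_absorb[OF i] .
  have "(\<lambda>p. F ((fst p)(i := snd p))) \<in> borel_measurable (sample_space k \<Otimes>\<^sub>M unit_interval)"
    by measurable
  then show ?thesis
    by (intro unit_interval.borel_measurable_lebesgue_integral) (simp add: case_prod_beta')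
qed

text \<open>A fresh value in one coordinate leaves the expectation unchanged, as both sides reduce
  to the product over the other coordinates. The index set stays \<open>{1..k}\<close>, so variables
  can be integrated out one after another over the same space.\<close>

lemma resample:
  fixes F :: "(nat \<Rightarrow> real) \<Rightarrow> real"
  assumes i: "i \<in> {1..k}" and F: "F \<in> borel_measurable (sample_space k)"
    and B: "\<And>x. x \<in> space (sample_space k) \<Longrightarrow> \<bar>F x\<bar> \<le> b"
  shows "(\<integral>x. F x \<partial>sample_space k) = (\<integral>x. (\<integral>y. F (x(i := y)) \<partial>unit_interval) \<partial>sample_space k)"
proof -
  interpret P: prob_space "sample_space k" by (rule prob_space_sample)
  interpret S: product_prob_space "\<lambda>_::nat. unit_interval"
    by (intro product_prob_spaceI prob_space_unit_interval)
  note [measurable] = F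
  have I: "insert i ({1..k} - {i}) = {1..k}" using i by auto
  have upd: "x(i := y) \<in> space (sample_space k)" if "x \<in> space (sample_space k)" "y \<in> {0..1}" for x y
    using that i by (auto simp: space_PiM PiE_iff extensional_def)
  define g where "g x = (\<integral>y. F (x(i := y)) \<partial>unit_interval)" for x
  have gm: "g \<in> borel_measurable (sample_space k)"
    unfolding g_def[abs_def] by (rule measurable_resample[OF i F])
  obtain x0 where "x0 \<in> space (sample_space k)" using P.not_empty by blast
  then have b: "0 \<le> b" using order_trans[OF abs_ge_zero B] by blast
  have gB: "\<bar>g x\<bar> \<le> b" if "x \<in> space (sample_space k)" for x
    unfolding g_def by (rule unit_interval.abs_integral_le) (use B upd that b in auto)
  have *: "(\<integral>x. H x \<partial>sample_space k) = (\<integral>x. (\<integral>y. H (x(i := y)) \<partial>unit_interval) \<partial>Pi\<^sub>M ({1..k} - {i}) (\<lambda>_. unit_interval))"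
    if [measurable]: "H \<in> borel_measurable (sample_space k)" and "\<And>x. x \<in> space (sample_space k) \<Longrightarrow> \<bar>H x\<bar> \<le> b"
    for H :: "(nat \<Rightarrow> real) \<Rightarrow> real"
    using S.product_integral_insert[of "{1..k} - {i}" i H] P.integrable_bounded[OF that] unfolding I by simp
  have "(\<integral>x. g x \<partial>sample_space k) = (\<integral>x. (\<integral>y. g (x(i := y)) \<partial>unit_interval) \<partial>Pi\<^sub>M ({1..k} - {i}) (\<lambda>_. unit_interval))"
    by (rule *[OF gm gB])
  \<comment> \<open>\<open>g\<close> ignores coordinate \<open>i\<close>, so integrating over that
    coordinate does nothing.\<close>
  also have "\<dots> = (\<integral>x. g x \<partial>Pi\<^sub>M ({1..k} - {i}) (\<lambda>_. unit_interval))"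
    by (simp add: g_def unit_interval.prob_space del: space_unit_interval measure_unit_interval)
  also have "\<dots> = (\<integral>x. F x \<partial>sample_space k)"
    unfolding g_def by (rule *[OF F B, symmetric])
  finally show ?thesis by (simp add: g_def)
qed

section \<open>Moments of the sample\<close>

text \<open>The pair is sorted because the edge sets in use contain increasing pairs only; the
  matrix is then symmetric with zero diagonal.\<close>

definition adj :: "(nat \<times> nat) set \<Rightarrow> nat \<Rightarrow> nat \<Rightarrow> real" where
  "adj B i j = of_bool ((min i j, max i j) \<in> B)"

text \<open>The unnormalised four-cycle density of a symmetric matrix, degenerate index quadruples
  included.\<close>

definition cycle_sum :: "nat \<Rightarrow> (nat \<Rightarrow> nat \<Rightarrow> real) \<Rightarrow> real" where
  "cycle_sum k N = (\<Sum>i=1..k. \<Sum>l=1..k. (\<Sum>j=1..k. N i j * N j l)\<^sup>2)"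

lemma cycle_sum_nonneg: "0 \<le> cycle_sum k N"
  unfolding cycle_sum_def by (intro sum_nonneg) auto

lemma cycle_sum_expand:
  "cycle_sum k N = (\<Sum>i=1..k. \<Sum>l=1..k. \<Sum>j=1..k. \<Sum>m=1..k. N i j * N j l * (N i m * N m l))"
  by (simp add: cycle_sum_def power2_eq_square sum_product)

lemma measurable_coordinates:
  assumes Z: "Z \<in> borel_measurable (unit_interval \<Otimes>\<^sub>M unit_interval)" and i: "i \<in> {1..k}" "j \<in> {1..k}"
  shows "(\<lambda>x. Z (x i, x j)) \<in> borel_measurable (sample_space k)"
proof -
  note [measurable] = Z i measurable_component_singleton[OF i(1)] measurable_component_singleton[OF i(2)]
  show ?thesis by measurable
qed

text \<open>Edges outside \<open>F\<close> enter the product with the factor 1.\<close>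

lemma sum_edge_weight_subset:
  assumes "F \<subseteq> vertex_pairs k"
  shows "(\<Sum>B\<in>Pow (vertex_pairs k). edge_weight k W x B * (\<Prod>e\<in>F. h e (e \<in> B))) =
   (\<Prod>e\<in>F. W (x (fst e), x (snd e)) * h e True + (1 - W (x (fst e), x (snd e))) * h e False)"
proof -
  have F: "vertex_pairs k \<inter> F = F" using assms by auto
  have r: "(\<Prod>e\<in>F. g e) = (\<Prod>e\<in>vertex_pairs k. if e \<in> F then g e else 1)" for g :: "nat \<times> nat \<Rightarrow> real"
    using prod.inter_restrict[of "vertex_pairs k" g F] by (simp add: F)
  have "(\<Sum>B\<in>Pow (vertex_pairs k). edge_weight k W x B * (\<Prod>e\<in>F. h e (e \<in> B))) =
    (\<Sum>B\<in>Pow (vertex_pairs k). edge_weight k W x B * (\<Prod>e\<in>vertex_pairs k. (\<lambda>e b. if e \<in> F then h e b else 1) e (e \<in> B)))"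
    by (simp add: r)
  also have "\<dots> = (\<Prod>e\<in>vertex_pairs k. if e \<in> F then W (x (fst e), x (snd e)) * h e True + (1 - W (x (fst e), x (snd e))) * h e False else 1)"
    by (subst sum_edge_weight_prod) (intro prod.cong refl, auto)
  also have "\<dots> = (\<Prod>e\<in>F. W (x (fst e), x (snd e)) * h e True + (1 - W (x (fst e), x (snd e))) * h e False)"
    by (rule r[symmetric])
  finally show ?thesis .
qed

text \<open>On four distinct vertices the cycle uses four different edges, which are independent
  given the sample points. The mean of an adjacency entry is the value of \<open>W\<close>, so each
  factor averages to \<open>W - V\<close>.\<close>

lemma sum_edge_weight_cycle:
  assumes W: "graphon W" and V: "graphon V" and x: "x \<in> space (sample_space k)"
    and i: "i \<in> {1..k}" "j \<in> {1..k}" "l \<in> {1..k}" "m \<in> {1..k}" and d: "distinct [i, j, l, m]"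
  defines "N B a b \<equiv> adj B a b - V (x a, x b)" and "Z p \<equiv> W p - V p"
  shows "(\<Sum>B\<in>Pow (vertex_pairs k). edge_weight k W x B * (N B i j * N B j l * (N B i m * N B m l))) =
    Z (x i, x j) * Z (x j, x l) * (Z (x i, x m) * Z (x m, x l))"
proof -
  define p where "p i j = (min i j, max i j)" for i j :: nat
  let ?F = "{p i j, p j l, p i m, p m l}"
  have dist: "p i j \<notin> {p j l, p i m, p m l}" "p j l \<notin> {p i m, p m l}" "p i m \<notin> {p m l}"
    using d by (auto simp: p_def min_def max_def split: if_splits)
  have F: "?F \<subseteq> vertex_pairs k"
    using d i by (auto simp: p_def vertex_pairs_def min_def max_def)
  have symp: "U (x (fst (p a b)), x (snd (p a b))) = U (x a, x b)" if "graphon U" "a \<in> {1..k}" "b \<in> {1..k}" for U a b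
    using that sample_space_in[OF x that(2)] sample_space_in[OF x that(3)]
    by (auto simp: p_def min_def max_def graphon_def)
  define h where "h e b = of_bool b - V (x (fst e), x (snd e))" for e :: "nat \<times> nat" and b
  have N: "N B a b = h (p a b) (p a b \<in> B)" if "a \<in> {1..k}" "b \<in> {1..k}" for B a b
    using symp[OF V that] by (simp add: N_def h_def adj_def p_def[symmetric])
  \<comment> \<open>The mean of one factor: \<open>W * (1 - V) + (1 - W) * (0 - V)\<close> is
    \<open>W - V\<close>.\<close>
  have Z: "Z (x a, x b) = W (x (fst (p a b)), x (snd (p a b))) * h (p a b) True + (1 - W (x (fst (p a b)), x (snd (p a b)))) * h (p a b) False"
    if "a \<in> {1..k}" "b \<in> {1..k}" for a b
    using symp[OF V that] symp[OF W that] by (simp add: Z_def h_def algebra_simps)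
  have prod4: "(\<Prod>e\<in>?F. f e) = f (p i j) * f (p j l) * (f (p i m) * f (p m l))" for f :: "nat \<times> nat \<Rightarrow> real"
    using dist by simp
  show ?thesis
    using sum_edge_weight_subset[OF F, of W x h] unfolding prod4 by (simp only: N Z i)
qed

text \<open>The vertices are integrated out in the order m, j, l, i. Each of m and j contributes one
  codegree \<open>E (x i, x l)\<close>, which gives its square.\<close>

lemma integral_cycle:
  assumes Zk: "kernel Z" and i: "i \<in> {1..k}" "j \<in> {1..k}" "l \<in> {1..k}" "m \<in> {1..k}" and d: "distinct [i, j, l, m]"
  shows "(\<integral>x. Z (x i, x j) * Z (x j, x l) * (Z (x i, x m) * Z (x m, x l)) \<partial>sample_space k)
    = four_cycle_density unit_interval Z"
proof -
  interpret P: prob_space "sample_space k" by (rule prob_space_sample)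
  note Zm[measurable] = kernel_measurable[OF Zk]
  note mc[measurable] = measurable_coordinates[OF _ i(1) i(2)] measurable_coordinates[OF _ i(2) i(3)]
      measurable_coordinates[OF _ i(1) i(4)] measurable_coordinates[OF _ i(4) i(3)] measurable_coordinates[OF _ i(1) i(3)]
  note sp = sample_space_in[OF _ i(1)] sample_space_in[OF _ i(2)] sample_space_in[OF _ i(3)] sample_space_in[OF _ i(4)]
  note sp' = sp[unfolded atLeastAtMost_iff, THEN conjunct1] sp[unfolded atLeastAtMost_iff, THEN conjunct2]
  note ZB = kernel_bound[OF Zk]
  define E where "E p = (\<integral>y. Z (fst p, y) * Z (y, snd p) \<partial>unit_interval)" for p
  have Em[measurable]: "E \<in> borel_measurable (unit_interval \<Otimes>\<^sub>M unit_interval)"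
    unfolding E_def by measurable
  have EB: "\<bar>E (a, b)\<bar> \<le> 1" if "a \<in> {0..1}" "b \<in> {0..1}" for a b
    unfolding E_def using that by (intro unit_interval.abs_integral_le) (auto simp del: One_nat_def simp: abs_mult ZB intro!: mult_le_one)
  have E2: "(E (a, b))\<^sup>2 \<le> 1" if "a \<in> {0..1}" "b \<in> {0..1}" for a b
    using EB[OF that] by (simp add: abs_square_le_1)
  have "(\<integral>x. Z (x i, x j) * Z (x j, x l) * (Z (x i, x m) * Z (x m, x l)) \<partial>sample_space k)
    = (\<integral>x. (\<integral>y. Z (x i, x j) * Z (x j, x l) * (Z (x i, y) * Z (y, x l)) \<partial>unit_interval) \<partial>sample_space k)"
    by (subst resample[OF i(4), where b=1]) (use d in \<open>auto simp del: One_nat_def simp: abs_mult ZB sp' intro!: mult_le_one\<close>)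
  also have "\<dots> = (\<integral>x. Z (x i, x j) * Z (x j, x l) * E (x i, x l) \<partial>sample_space k)"
    by (simp add: E_def)
  also have "\<dots> = (\<integral>x. (\<integral>y. Z (x i, y) * Z (y, x l) * E (x i, x l) \<partial>unit_interval) \<partial>sample_space k)"
    by (subst resample[OF i(2), where b=1]) (use d in \<open>auto simp del: One_nat_def simp: abs_mult ZB EB sp' intro!: mult_le_one\<close>)
  also have "\<dots> = (\<integral>x. (E (x i, x l))\<^sup>2 \<partial>sample_space k)"
    by (simp add: E_def power2_eq_square)
  also have "\<dots> = (\<integral>x. (\<integral>b. (E (x i, b))\<^sup>2 \<partial>unit_interval) \<partial>sample_space k)"
    by (subst resample[OF i(3), where b=1]) (use d in \<open>auto simp del: One_nat_def simp: E2 sp'\<close>)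
  also have "\<dots> = (\<integral>x. (\<integral>a. (\<integral>b. (E (a, b))\<^sup>2 \<partial>unit_interval) \<partial>unit_interval) \<partial>sample_space k)"
  proof (subst resample[OF i(1), where b=1])
    have "(\<lambda>a. \<integral>b. (E (a, b))\<^sup>2 \<partial>unit_interval) \<in> borel_measurable unit_interval" by measurable
    then show "(\<lambda>x. \<integral>b. (E (x i, b))\<^sup>2 \<partial>unit_interval) \<in> borel_measurable (sample_space k)"
      by (rule measurable_compose[OF measurable_component_singleton[OF i(1)]])
    show "\<bar>\<integral>b. (E (x i, b))\<^sup>2 \<partial>unit_interval\<bar> \<le> 1" if "x \<in> space (sample_space k)" for x
      using sp(1)[OF that] by (intro unit_interval.abs_integral_le) (auto simp: E2)
  qed simp
  also have "\<dots> = four_cycle_density unit_interval Z"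
    using P.prob_space by (simp add: four_cycle_density_def E_def)
  finally show ?thesis .
qed

text \<open>Quadruples of distinct indices contribute exactly the four-cycle density of
  \<open>W - V\<close>. Each of the six possible coincidences leaves \<open>k ^ 3\<close>
  quadruples, with a contribution of at most 1 each.\<close>

lemma expected_cycle_sum:
  fixes k :: nat
  assumes W: "graphon W" and V: "graphon V"
  defines "F x \<equiv> (\<Sum>B\<in>Pow (vertex_pairs k). edge_weight k W x B * cycle_sum k (\<lambda>i j. adj B i j - V (x i, x j)))"
  shows "integrable (sample_space k) F"
    and "(\<integral>x. F x \<partial>sample_space k) \<le> real k ^ 4 * four_cycle_density unit_interval (\<lambda>p. W p - V p) + 6 * real k ^ 3"
proof -
  interpret P: prob_space "sample_space k" by (rule prob_space_sample)
  define C where "C = four_cycle_density unit_interval (\<lambda>p. W p - V p)"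
  have C: "0 \<le> C" unfolding C_def by (rule unit_interval.four_cycle_density_nonneg)
  define N where "N x B i j = adj B i j - V (x i, x j)" for x B i j
  define q where "q i l j m x = (\<Sum>B\<in>Pow (vertex_pairs k). edge_weight k W x B * (N x B i j * N x B j l * (N x B i m * N x B m l)))"
    for i l j m x
  have F: "F x = (\<Sum>i=1..k. \<Sum>l=1..k. \<Sum>j=1..k. \<Sum>m=1..k. q i l j m x)" for x
    unfolding F_def cycle_sum_expand q_def N_def sum_distrib_left
    by (simp only: sum.swap[where A="Pow (vertex_pairs k)"])
  have NB: "\<bar>N x B i j\<bar> \<le> 1" if "x \<in> space (sample_space k)" "i \<in> {1..k}" "j \<in> {1..k}" for x B i j
  proof -
    have "0 \<le> V (x i, x j)" "V (x i, x j) \<le> 1"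
      using V sample_space_in[OF that(1,2)] sample_space_in[OF that(1,3)] by (auto simp: graphon_def)
    then show ?thesis by (simp add: N_def adj_def)
  qed
  have qm: "q i l j m \<in> borel_measurable (sample_space k)"
    if "i \<in> {1..k}" "l \<in> {1..k}" "j \<in> {1..k}" "m \<in> {1..k}" for i l j m
    unfolding q_def N_def
    by (intro borel_measurable_sum borel_measurable_times borel_measurable_diff borel_measurable_const
        measurable_edge_weight W measurable_coordinates graphon_measurable V that)
  have qB: "\<bar>q i l j m x\<bar> \<le> 1" if x: "x \<in> space (sample_space k)" and
     i: "i \<in> {1..k}" "l \<in> {1..k}" "j \<in> {1..k}" "m \<in> {1..k}" for i l j m x
  proof -
    have "\<bar>q i l j m x\<bar> \<le> (\<Sum>B\<in>Pow (vertex_pairs k). \<bar>edge_weight k W x B * (N x B i j * N x B j l * (N x B i m * N x B m l))\<bar>)"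
      unfolding q_def by (rule sum_abs)
    also have "\<dots> \<le> (\<Sum>B\<in>Pow (vertex_pairs k). edge_weight k W x B)"
    proof (rule sum_mono)
      fix B
      have "\<bar>N x B i j * N x B j l * (N x B i m * N x B m l)\<bar> \<le> 1"
        unfolding abs_mult using NB[OF x] i by (intro mult_le_one mult_nonneg_nonneg abs_ge_zero) auto
      then have "edge_weight k W x B * \<bar>N x B i j * N x B j l * (N x B i m * N x B m l)\<bar> \<le> edge_weight k W x B * 1"
        by (intro mult_left_mono edge_weight_nonneg[OF W x])
      then show "\<bar>edge_weight k W x B * (N x B i j * N x B j l * (N x B i m * N x B m l))\<bar> \<le> edge_weight k W x B"
        using edge_weight_nonneg[OF W x, of B] by (simp add: abs_mult)
    qed
    finally show ?thesis by (simp add: sum_edge_weight)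
  qed
  have qi: "integrable (sample_space k) (q i l j m)"
    if "i \<in> {1..k}" "l \<in> {1..k}" "j \<in> {1..k}" "m \<in> {1..k}" for i l j m
    by (rule P.integrable_bounded[where B=1]) (use qm qB that in auto)
  show "integrable (sample_space k) F"
    unfolding F[abs_def] by (intro Bochner_Integration.integrable_sum qi)
  \<comment> \<open>The six indicators let one bound serve both cases: they vanish for distinct
    indices and otherwise sum to at least 1, where \<open>C\<close> is nonnegative.\<close>
  have qI: "(\<integral>x. q i l j m x \<partial>sample_space k) \<le>
      C + (of_bool (i = j) + of_bool (i = l) + of_bool (i = m) + of_bool (j = l) + of_bool (j = m) + of_bool (l = m))"
    if i: "i \<in> {1..k}" "l \<in> {1..k}" "j \<in> {1..k}" "m \<in> {1..k}" for i l j m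
  proof (cases "distinct [i, j, l, m]")
    case True
    have "(\<integral>x. q i l j m x \<partial>sample_space k) = (\<integral>x. (W (x i, x j) - V (x i, x j)) * (W (x j, x l) - V (x j, x l)) *
       ((W (x i, x m) - V (x i, x m)) * (W (x m, x l) - V (x m, x l))) \<partial>sample_space k)"
      unfolding q_def N_def
      by (intro Bochner_Integration.integral_cong refl sum_edge_weight_cycle[OF W V] i True)
    also have "\<dots> = C"
      unfolding C_def using integral_cycle[OF graphon_diff_kernel[OF W V] i(1) i(3) i(2) i(4) True] by simp
    finally show ?thesis by simp
  next
    case False
    have "(\<integral>x. q i l j m x \<partial>sample_space k) \<le> 1"
      by (rule abs_le_D1, rule P.abs_integral_le) (use qB i in auto)
    moreover have "1 \<le> of_bool (i = j) + of_bool (i = l) + of_bool (i = m) + of_bool (j = l) + of_bool (j = m) + (of_bool (l = m) :: real)"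
      using False by auto
    ultimately show ?thesis using C by linarith
  qed
  have "(\<integral>x. F x \<partial>sample_space k) = (\<Sum>i=1..k. \<Sum>l=1..k. \<Sum>j=1..k. \<Sum>m=1..k. (\<integral>x. q i l j m x \<partial>sample_space k))"
    unfolding F by (subst Bochner_Integration.integral_sum, (intro Bochner_Integration.integrable_sum qi; assumption), intro sum.cong refl)+
  also have "\<dots> \<le> (\<Sum>i=1..k. \<Sum>l=1..k. \<Sum>j=1..k. \<Sum>m=1..k.
      C + (of_bool (i = j) + of_bool (i = l) + of_bool (i = m) + of_bool (j = l) + of_bool (j = m) + of_bool (l = m)))"
    by (intro sum_mono qI)
  also have "\<dots> = real k ^ 4 * C + 6 * real k ^ 3"
  proof -
    have d1: "(\<Sum>b=1..k. of_bool (a = b)) = (1::real)" if "a \<in> {1..k}" for a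
      using that by (simp add: of_bool_def)
    have d2: "(\<Sum>a=1..k. of_bool (a = b)) = (1::real)" if "b \<in> {1..k}" for b
      using that by (simp add: of_bool_def)
    have d3: "(\<Sum>a=1..k. \<Sum>b=1..k. of_bool (a = b)) = (\<Sum>a=1..k. 1::real)"
      by (intro sum.cong refl d1)
    have d4: "(\<Sum>b=1..k. \<Sum>a=1..k. of_bool (a = b)) = (\<Sum>b=1..k. 1::real)"
      by (intro sum.cong refl d2)
    show ?thesis
      by (simp add: sum.distrib sum_distrib_left[symmetric] d3 d4 power4_eq_xxxx power3_eq_cube algebra_simps
          del: One_nat_def sum_of_bool_eq)
  qed
  finally show "(\<integral>x. F x \<partial>sample_space k) \<le> real k ^ 4 * four_cycle_density unit_interval (\<lambda>p. W p - V p) + 6 * real k ^ 3"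
    by (simp add: C_def)
qed

definition class_deviation :: "nat \<Rightarrow> (real \<Rightarrow> nat) \<Rightarrow> nat \<Rightarrow> (nat \<Rightarrow> real) \<Rightarrow> real" where
  "class_deviation k c a x =
     (\<Sum>i=1..k. of_bool (c (x i) = a) - measure unit_interval {y\<in>{0..1}. c y = a}) / k"

text \<open>The variance of an empirical frequency: the summands are centred and independent, so of
  the double sum only the \<open>k\<close> diagonal terms remain, each at most 1, and the
  normalisation divides them by \<open>k\<^sup>2\<close>.\<close>

lemma expected_class_deviation:
  assumes c[measurable]: "c \<in> measurable unit_interval (count_space UNIV)" and k: "k \<ge> 1"
  shows "integrable (sample_space k) (\<lambda>x. (class_deviation k c a x)\<^sup>2)"
    and "(\<integral>x. (class_deviation k c a x)\<^sup>2 \<partial>sample_space k) \<le> 1 / k"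
proof -
  interpret P: prob_space "sample_space k" by (rule prob_space_sample)
  define p where "p = measure unit_interval {y\<in>{0..1}. c y = a}"
  define f where "f t = of_bool (c t = a) - p" for t
  have l01: "0 \<le> p" "p \<le> 1" by (auto simp: p_def)
  have fB: "\<bar>f t\<bar> \<le> 1" for t using l01 by (auto simp: f_def)
  have sets: "{y\<in>{0..1}. c y = a} \<in> sets unit_interval"
  proof -
    have "{y\<in>space unit_interval. c y = a} \<in> sets unit_interval" by measurable
    then show ?thesis by simp
  qed
  have ind: "of_bool (c t = a) = indicator {y\<in>{0..1}. c y = a} t" if "t \<in> {0..1}" for t
    using that by (auto simp: indicator_def)
  have bm: "(\<lambda>t. of_bool (c t = a) :: real) \<in> borel_measurable unit_interval"
    by (rule measurable_compose[OF c]) simp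
  then have fm[measurable]: "f \<in> borel_measurable unit_interval" unfolding f_def by measurable
  have "(\<integral>t. of_bool (c t = a) \<partial>unit_interval) = (\<integral>t. indicator {y\<in>{0..1}. c y = a} t \<partial>unit_interval)"
    by (intro Bochner_Integration.integral_cong refl ind) simp
  also have "\<dots> = p" unfolding p_def by (subst Bochner_Integration.integral_indicator) (rule arg_cong[where f="measure unit_interval"], auto)
  finally have f0: "(\<integral>t. f t \<partial>unit_interval) = 0"
    unfolding f_def using bm by (subst Bochner_Integration.integral_diff) (auto intro!: unit_interval.integrable_bounded[where B=1])
  have fc[measurable]: "(\<lambda>x. f (x i)) \<in> borel_measurable (sample_space k)" if "i \<in> {1..k}" for i
    by (rule measurable_compose[OF measurable_component_singleton[OF that] fm])
  have ii: "integrable (sample_space k) (\<lambda>x. f (x i) * f (x j))" if "i \<in> {1..k}" "j \<in> {1..k}" for i j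
    by (rule P.integrable_bounded[where B=1])
       (auto simp del: One_nat_def simp: abs_mult fB intro!: mult_le_one borel_measurable_times fc[OF that(1)] fc[OF that(2)])
  have val: "(\<integral>x. f (x i) * f (x j) \<partial>sample_space k) \<le> of_bool (i = j)" if ij: "i \<in> {1..k}" "j \<in> {1..k}" for i j
  proof (cases "i = j")
    case True
    have "(\<integral>x. f (x i) * f (x j) \<partial>sample_space k) \<le> 1"
      by (rule abs_le_D1, rule P.abs_integral_le) (auto simp: abs_mult fB intro!: mult_le_one)
    then show ?thesis using True by simp
  next
    case False
    have "(\<integral>x. f (x i) * f (x j) \<partial>sample_space k) = (\<integral>x. (\<integral>t. f (x i) * f t \<partial>unit_interval) \<partial>sample_space k)"
      using False by (subst resample[OF ij(2), where b=1])
         (auto simp del: One_nat_def simp: abs_mult fB intro!: mult_le_one borel_measurable_times fc[OF ij(1)] fc[OF ij(2)])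
    then show ?thesis using False by (simp add: f0)
  qed
  have eq: "(class_deviation k c a x)\<^sup>2 = (\<Sum>i=1..k. \<Sum>j=1..k. f (x i) * f (x j)) / (real k)\<^sup>2" for x
    by (simp add: class_deviation_def f_def p_def power_divide power2_eq_square sum_product)
  show "integrable (sample_space k) (\<lambda>x. (class_deviation k c a x)\<^sup>2)"
    unfolding eq by (intro Bochner_Integration.integrable_divide Bochner_Integration.integrable_sum ii)
  have "(\<integral>x. (\<Sum>i=1..k. \<Sum>j=1..k. f (x i) * f (x j)) \<partial>sample_space k) = (\<Sum>i=1..k. \<Sum>j=1..k. \<integral>x. f (x i) * f (x j) \<partial>sample_space k)"
    by (subst Bochner_Integration.integral_sum, (intro Bochner_Integration.integrable_sum ii; assumption), intro sum.cong refl)+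
  also have "\<dots> \<le> (\<Sum>i=1..k. \<Sum>j=1..k. of_bool (i = j))" by (intro sum_mono val)
  also have "\<dots> = k" by (simp add: of_bool_def)
  finally have "(\<integral>x. (class_deviation k c a x)\<^sup>2 \<partial>sample_space k) \<le> real k / (real k)\<^sup>2"
    unfolding eq by (simp add: divide_right_mono)
  then show "(\<integral>x. (class_deviation k c a x)\<^sup>2 \<partial>sample_space k) \<le> 1 / k"
    using k by (simp add: power2_eq_square)
qed

section \<open>Sampling\<close>

text \<open>An equipartition of the unit interval indexed by vertices. The parts are arbitrary
  measurable sets and not consecutive intervals, so the notion is stable under relabelling of
  vertices and under measure-preserving maps.\<close>

definition uniform_labelling :: "nat set \<Rightarrow> (real \<Rightarrow> nat) \<Rightarrow> bool" where
  "uniform_labelling A m \<longleftrightarrow> m \<in> measurable unit_interval (count_space UNIV) \<and> (\<forall>y\<in>{0..1}. m y \<in> A) \<and>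
     (\<forall>v\<in>A. measure unit_interval {y\<in>{0..1}. m y = v} = 1 / card A)"

text \<open>Some placement of the vertices gives a step function of \<open>G\<close> near
  \<open>W\<close>. The quantifier over placements absorbs rearrangements and makes the notion
  invariant under graph isomorphism.\<close>

definition near_graph :: "(real \<times> real \<Rightarrow> real) \<Rightarrow> graph \<Rightarrow> real \<Rightarrow> bool" where
  "near_graph W G \<delta> \<longleftrightarrow> (\<exists>m. uniform_labelling (fst G) m \<and>
     cut_norm (\<lambda>(x, y). W (x, y) - of_bool ({m x, m y} \<in> snd G)) \<le> \<delta>)"

text \<open>Vertex v receives the interval from (v - 1) / k, excluded, to v / k. The ceiling of 0 is
  0, which is no vertex, so the point 0 gets the label 1.\<close>

lemma ceiling_labelling:
  assumes k: "k \<ge> 1"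
  defines "m \<equiv> \<lambda>y. if y = 0 then 1 else nat \<lceil>real k * y\<rceil>"
  shows "uniform_labelling {1..k} m"
  unfolding uniform_labelling_def
proof (intro conjI ballI)
  have k0: "0 < real k" using k by simp
  show mm[measurable]: "m \<in> measurable unit_interval (count_space UNIV)"
    unfolding m_def by measurable
  show "m y \<in> {1..k}" if y: "y \<in> {0..1}" for y
  proof (cases "y = 0")
    case False
    then have "0 < real k * y" "real k * y \<le> k" using y k0 by (auto intro: mult_pos_pos mult_left_le)
    then have "1 \<le> \<lceil>real k * y\<rceil>" "\<lceil>real k * y\<rceil> \<le> int k" by (auto simp: ceiling_le_iff)
    then have "1 \<le> nat \<lceil>real k * y\<rceil>" "nat \<lceil>real k * y\<rceil> \<le> k" by linarith+
    then show ?thesis using False by (simp add: m_def)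
  qed (use k in \<open>simp add: m_def\<close>)
  show "measure unit_interval {y\<in>{0..1}. m y = v} = 1 / card {1..k}" if v: "v \<in> {1..k}" for v
  proof -
    define S where "S = {(real v - 1) / k <.. real v / k}"
    have v1': "1 \<le> v" using v by simp
    have v1: "1 \<le> real v" "real v \<le> k" using v by auto
    have S01: "S \<subseteq> {0..1}"
    proof
      fix y assume y: "y \<in> S"
      have "0 \<le> (real v - 1) / k" "real v / k \<le> 1" using v1 k0 by auto
      then show "y \<in> {0..1}" using y by (auto simp: S_def)
    qed
    have mS: "m y = v" if "y \<in> S" for y
    proof -
      have "real v - 1 < real k * y" "real k * y \<le> v"
        using that k0 by (auto simp: S_def field_simps)
      then have "\<lceil>real k * y\<rceil> = int v" by (intro ceiling_unique) auto
      moreover have "y \<noteq> 0" using \<open>real v - 1 < real k * y\<close> v1 by auto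
      ultimately show ?thesis by (simp add: m_def)
    qed
    have Sm: "y \<in> S \<or> y = 0" if "y \<in> {0..1}" "m y = v" for y
    proof (cases "y = 0")
      case False
      then have "nat \<lceil>real k * y\<rceil> = v" using that by (simp add: m_def)
      then have "\<lceil>real k * y\<rceil> = int v" using v1' by linarith
      then have "real v - 1 < real k * y" "real k * y \<le> v" by linarith+
      then show ?thesis using k0 by (auto simp: S_def field_simps)
    qed simp
    have Ss[measurable]: "S \<in> sets unit_interval"
    proof -
      have "S \<inter> {0..1} \<in> sets unit_interval" by (rule borel_Int_unit_interval) (simp add: S_def)
      moreover have "S \<inter> {0..1} = S" using S01 by blast
      ultimately show ?thesis by (simp only:)
    qed
    have s0[measurable]: "{0} \<in> sets unit_interval"
      using borel_Int_unit_interval[of "{0}"] by simp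
    have "measure unit_interval S = measure lborel S"
      unfolding unit_interval_def by (rule measure_restrict_space) (use S01 in auto)
    also have "\<dots> = 1 / k" using k0 by (simp add: S_def divide_right_mono diff_divide_distrib[symmetric])
    finally have mSk: "measure unit_interval S = 1 / k" .
    have "measure unit_interval {0} = measure lborel {0::real}"
      unfolding unit_interval_def by (rule measure_restrict_space) auto
    then have m0: "measure unit_interval {0} = 0" by simp
    have ms: "{y\<in>{0..1}. m y = v} \<in> sets unit_interval"
    proof -
      have "{y\<in>space unit_interval. m y = v} \<in> sets unit_interval" by measurable
      then show ?thesis by simp
    qed
    have "measure unit_interval {y\<in>{0..1}. m y = v} \<le> measure unit_interval (S \<union> {0})"
    proof (rule unit_interval.finite_measure_mono)
      show "{y\<in>{0..1}. m y = v} \<subseteq> S \<union> {0}" using Sm by blast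
    qed (intro sets.Un Ss s0)
    also have "\<dots> \<le> measure unit_interval S + measure unit_interval {0}" by (rule measure_Un_le) auto
    finally have "measure unit_interval {y\<in>{0..1}. m y = v} \<le> 1 / k" using mSk m0 by simp
    moreover have "measure unit_interval S \<le> measure unit_interval {y\<in>{0..1}. m y = v}"
      by (rule unit_interval.finite_measure_mono) (use S01 mS ms in auto)
    ultimately show ?thesis using mSk by simp
  qed
qed

lemma uniform_labelling_measure_preserving:
  assumes m: "uniform_labelling A m" and \<psi>: "measure_preserving_map \<psi>"
  shows "uniform_labelling A (\<lambda>y. m (\<psi> y))"
proof -
  have mm: "m \<in> measurable unit_interval (count_space UNIV)" using m by (simp add: uniform_labelling_def)
  have pm: "\<psi> \<in> measurable unit_interval unit_interval" and d: "distr unit_interval unit_interval \<psi> = unit_interval"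
    using \<psi> by (auto simp: measure_preserving_map_def)
  have p01: "\<psi> y \<in> {0..1}" if "y \<in> {0..1}" for y using measurable_space[OF pm] that by simp
  have "measure unit_interval {y\<in>{0..1}. m (\<psi> y) = v} = measure unit_interval {y\<in>{0..1}. m y = v}" for v
  proof -
    have ms: "{y\<in>{0..1}. m y = v} \<in> sets unit_interval"
    proof -
      note [measurable] = mm
      have "{y\<in>space unit_interval. m y = v} \<in> sets unit_interval" by measurable
      then show ?thesis by simp
    qed
    have "measure unit_interval {y\<in>{0..1}. m y = v} = measure (distr unit_interval unit_interval \<psi>) {y\<in>{0..1}. m y = v}"
      by (simp add: d)
    also have "\<dots> = measure unit_interval (\<psi> -` {y\<in>{0..1}. m y = v} \<inter> space unit_interval)"
      by (rule measure_distr[OF pm ms])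
    also have "\<psi> -` {y\<in>{0..1}. m y = v} \<inter> space unit_interval = {y\<in>{0..1}. m (\<psi> y) = v}"
      unfolding space_unit_interval using p01 by blast
    finally show ?thesis by simp
  qed
  moreover have "m (\<psi> y) \<in> A" if "y \<in> {0..1}" for y
    using m p01[OF that] by (simp only: uniform_labelling_def)
  ultimately show ?thesis
    using m measurable_compose[OF pm mm] unfolding uniform_labelling_def by simp
qed

text \<open>The label of a uniform point is uniform on \<open>A\<close>, so integrals become
  averages over vertices.\<close>

lemma integral_uniform_labelling:
  fixes f :: "nat \<Rightarrow> real"
  assumes m: "uniform_labelling A m" and A: "finite A"
  shows "(\<integral>y. f (m y) \<partial>unit_interval) = (\<Sum>v\<in>A. f v) / card A"
proof -
  have mm[measurable]: "m \<in> measurable unit_interval (count_space UNIV)" and mA: "\<And>y. y \<in> {0..1} \<Longrightarrow> m y \<in> A"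
    and mu: "\<And>v. v \<in> A \<Longrightarrow> measure unit_interval {y\<in>{0..1}. m y = v} = 1 / card A"
    using m by (auto simp: uniform_labelling_def)
  have ms[measurable]: "{y\<in>{0..1}. m y = v} \<in> sets unit_interval" for v
  proof -
    have "{y\<in>space unit_interval. m y = v} \<in> sets unit_interval" by measurable
    then show ?thesis by simp
  qed
  have "(\<integral>y. f (m y) \<partial>unit_interval) = (\<integral>y. (\<Sum>v\<in>A. f v * indicator {y\<in>{0..1}. m y = v} y) \<partial>unit_interval)"
  proof (rule Bochner_Integration.integral_cong[OF refl])
    fix y assume y: "y \<in> space unit_interval"
    have "(\<Sum>v\<in>A. f v * indicator {y\<in>{0..1}. m y = v} y) = (\<Sum>v\<in>A. if v = m y then f v else 0)"
      using y by (intro sum.cong) (auto simp: indicator_def)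
    also have "\<dots> = f (m y)" using A mA y by simp
    finally show "f (m y) = (\<Sum>v\<in>A. f v * indicator {y\<in>{0..1}. m y = v} y)" by simp
  qed
  also have "\<dots> = (\<Sum>v\<in>A. f v * measure unit_interval ({y\<in>{0..1}. m y = v} \<inter> space unit_interval))"
  proof (subst Bochner_Integration.integral_sum)
    show "integrable unit_interval (\<lambda>y. f v * indicator {y\<in>{0..1}. m y = v} y)" for v
      by (intro Bochner_Integration.integrable_mult_right unit_interval.integrable_bounded[where B=1] borel_measurable_indicator ms)
         (simp add: indicator_def)
  qed (simp only: integral_mult_right_zero Bochner_Integration.integral_indicator)
  also have "\<dots> = (\<Sum>v\<in>A. f v * (1 / card A))"
  proof (intro sum.cong refl)
    fix v assume "v \<in> A"
    moreover have "{y\<in>{0..1}. m y = v} \<inter> space unit_interval = {y\<in>{0..1}. m y = v}" by auto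
    ultimately show "f v * measure unit_interval ({y\<in>{0..1}. m y = v} \<inter> space unit_interval) = f v * (1 / card A)"
      by (simp only: mu)
  qed
  finally show ?thesis by (simp add: sum_divide_distrib)
qed

text \<open>The link between the cut norm on the square and the moments of the sample.\<close>

lemma four_cycle_density_labelling:
  assumes m: "uniform_labelling {1..k} m"
  shows "four_cycle_density unit_interval (\<lambda>(x, y). N (m x) (m y)) = cycle_sum k N / real k ^ 4"
proof -
  note i = integral_uniform_labelling[OF m finite_atLeastAtMost]
  have "four_cycle_density unit_interval (\<lambda>(x, y). N (m x) (m y)) =
    (\<integral>x. (\<integral>z. ((\<Sum>j=1..k. N (m x) j * N j (m z)) / k)\<^sup>2 \<partial>unit_interval) \<partial>unit_interval)"
    unfolding four_cycle_density_def using i[of "\<lambda>j. N (m _) j * N j (m _)"] by simp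
  also have "\<dots> = (\<integral>x. (\<Sum>l=1..k. ((\<Sum>j=1..k. N (m x) j * N j l) / k)\<^sup>2) / k \<partial>unit_interval)"
    using i[of "\<lambda>l. ((\<Sum>j=1..k. N (m _) j * N j l) / k)\<^sup>2"] by simp
  also have "\<dots> = (\<Sum>i=1..k. (\<Sum>l=1..k. ((\<Sum>j=1..k. N i j * N j l) / k)\<^sup>2) / k) / k"
    using i[of "\<lambda>i. (\<Sum>l=1..k. ((\<Sum>j=1..k. N i j * N j l) / k)\<^sup>2) / k"] by simp
  also have "\<dots> = cycle_sum k N / real k ^ 4"
    unfolding cycle_sum_def
    by (simp add: power_divide sum_divide_distrib[symmetric] power2_eq_square power4_eq_xxxx)
  finally show ?thesis .
qed

lemma graphon_of_labelling:
  fixes u :: "nat \<Rightarrow> nat \<Rightarrow> real"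
  assumes m: "uniform_labelling A m" and A: "finite A" and u: "\<And>i j. u i j \<in> {0..1}" "\<And>i j. u i j = u j i"
  shows "graphon (\<lambda>(x, y). u (m x) (m y))"
proof -
  have "step_function (Suc (Max A)) m u"
    using m A u by (auto simp: step_function_def uniform_labelling_def less_Suc_eq_le)
  then show ?thesis by (rule graphon_of_step_function)
qed

lemma edge_graph_adj:
  assumes "B \<subseteq> vertex_pairs k"
  shows "of_bool ({i, j} \<in> snd (edge_graph k B)) = adj B i j"
proof -
  have "{i, j} \<in> snd (edge_graph k B) \<longleftrightarrow> (min i j, max i j) \<in> B"
  proof
    assume "{i, j} \<in> snd (edge_graph k B)"
    then obtain a b where ab: "(a, b) \<in> B" "{i, j} = {a, b}" by (auto simp: edge_graph_def)
    then have "a < b" using assms by (auto simp: vertex_pairs_def)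
    then show "(min i j, max i j) \<in> B" using ab by (auto simp: doubleton_eq_iff)
  next
    assume "(min i j, max i j) \<in> B"
    moreover have "{i, j} = {min i j, max i j}" by (auto simp: min_def max_def)
    ultimately show "{i, j} \<in> snd (edge_graph k B)" unfolding edge_graph_def by auto
  qed
  then show ?thesis by (simp add: adj_def)
qed

text \<open>The deterministic half of sampling, in three comparisons: \<open>W\<close> with its step
  function (\<open>\<epsilon>\<close>), the step function with its copy carried by the sampled
  classes after a rearrangement (\<open>2 * (M * \<sigma>)\<close>), and that copy with the
  adjacency matrix (\<open>\<tau>\<close>).\<close>

lemma near_graph_if_typical:
  assumes W: "graphon W" and st: "step_function M c v" and k: "k \<ge> 1" and B: "B \<subseteq> vertex_pairs k"
    and x: "x \<in> space (sample_space k)"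
    and cut: "cut_norm (\<lambda>(x, y). W (x, y) - v (c x) (c y)) \<le> \<epsilon>"
    and cyc: "cycle_sum k (\<lambda>i j. adj B i j - v (c (x i)) (c (x j))) \<le> \<tau> ^ 4 * real k ^ 4" and \<tau>: "0 \<le> \<tau>"
    and dev: "\<And>a. a < M \<Longrightarrow> \<bar>class_deviation k c a x\<bar> \<le> \<sigma>"
  shows "near_graph W (edge_graph k B) (\<epsilon> + 2 * (M * \<sigma>) + \<tau>)"
proof -
  have cm[measurable]: "c \<in> measurable unit_interval (count_space UNIV)" and cM: "\<And>y. y \<in> {0..1} \<Longrightarrow> c y < M"
    and v: "\<And>i j. v i j \<in> {0..1}" "\<And>i j. v i j = v j i"
    using st by (auto simp: step_function_def)
  obtain \<iota> where \<iota>: "uniform_labelling {1..k} \<iota>" using ceiling_labelling[OF k] by blast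
  have \<iota>m: "\<iota> \<in> measurable unit_interval (count_space UNIV)" and \<iota>k: "\<And>y. y \<in> {0..1} \<Longrightarrow> \<iota> y \<in> {1..k}"
    using \<iota> by (auto simp: uniform_labelling_def)
  \<comment> \<open>\<open>b\<close> is the class function of the sample, spread over the interval;
    the mass of each of its classes is an empirical frequency.\<close>
  define b where "b y = c (x (\<iota> y))" for y
  have bm: "b \<in> measurable unit_interval (count_space UNIV)"
    unfolding b_def by (rule measurable_compose[OF \<iota>m]) simp
  have xM: "c (x i) < M" if "i \<in> {1..k}" for i using cM sample_space_in[OF x that] by blast
  have diff: "measure unit_interval {y\<in>{0..1}. b y = a} - measure unit_interval {y\<in>{0..1}. c y = a} = class_deviation k c a x" for a
  proof -
    have "measure unit_interval {y\<in>{0..1}. b y = a} = (\<integral>y. indicator {y\<in>{0..1}. b y = a} y \<partial>unit_interval)"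
      by (subst Bochner_Integration.integral_indicator) (rule arg_cong[where f="measure unit_interval"], auto)
    also have "\<dots> = (\<integral>y. of_bool (c (x (\<iota> y)) = a) \<partial>unit_interval)"
      by (intro Bochner_Integration.integral_cong) (auto simp: b_def indicator_def)
    also have "\<dots> = (\<Sum>i=1..k. of_bool (c (x i) = a)) / k"
      using integral_uniform_labelling[OF \<iota>, of "\<lambda>i. of_bool (c (x i) = a)"] by simp
    finally show ?thesis using k
      by (simp add: class_deviation_def sum_subtractf diff_divide_distrib)
  qed
  have "\<exists>\<psi>. measure_preserving_map \<psi> \<and> measure unit_interval {y\<in>{0..1}. b (\<psi> y) \<noteq> c y} \<le>
     (\<Sum>a<M. \<bar>measure unit_interval {y\<in>{0..1}. c y = a} - measure unit_interval {y\<in>{0..1}. b y = a}\<bar>)"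
  proof (rule rearrangement[OF cm bm finite_lessThan[of M]])
    show "c y \<in> {..<M}" "b y \<in> {..<M}" if "y \<in> {0..1}" for y
      using cM[OF that] xM[OF \<iota>k[OF that]] by (simp_all add: b_def)
  qed blast
  then obtain \<psi> where \<psi>: "measure_preserving_map \<psi>" and bad: "measure unit_interval {y\<in>{0..1}. b (\<psi> y) \<noteq> c y} \<le>
     (\<Sum>a<M. \<bar>measure unit_interval {y\<in>{0..1}. c y = a} - measure unit_interval {y\<in>{0..1}. b y = a}\<bar>)"
    by blast
  \<comment> \<open>With vertices placed through \<open>\<psi>\<close>, the class of the sample
    point at \<open>y\<close> agrees with \<open>c y\<close> outside a set of measure at most
    \<open>M * \<sigma>\<close>.\<close>
  define m where "m y = \<iota> (\<psi> y)" for y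
  have m: "uniform_labelling {1..k} m"
    unfolding m_def by (rule uniform_labelling_measure_preserving[OF \<iota> \<psi>])
  have mm[measurable]: "m \<in> measurable unit_interval (count_space UNIV)" and mk: "\<And>y. y \<in> {0..1} \<Longrightarrow> m y \<in> {1..k}"
    using m by (auto simp: uniform_labelling_def)
  have bmm: "b (\<psi> y) = c (x (m y))" for y by (simp add: b_def m_def)
  have "measure unit_interval {y\<in>{0..1}. b (\<psi> y) \<noteq> c y} \<le> (\<Sum>a<M. \<sigma>)"
  proof (rule order_trans[OF bad], rule sum_mono)
    fix a assume "a \<in> {..<M}"
    then have "\<bar>class_deviation k c a x\<bar> \<le> \<sigma>" using dev by simp
    then show "\<bar>measure unit_interval {y\<in>{0..1}. c y = a} - measure unit_interval {y\<in>{0..1}. b y = a}\<bar> \<le> \<sigma>"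
      by (subst abs_minus_commute) (simp only: diff)
  qed
  then have bad': "measure unit_interval {y\<in>{0..1}. c (x (m y)) \<noteq> c y} \<le> M * \<sigma>" by (simp add: bmm)
  define N where "N i j = adj B i j - v (c (x i)) (c (x j))" for i j
  have adj: "adj B i j \<in> {0..1}" "adj B i j = adj B j i" for i j
    by (auto simp: adj_def min.commute max.commute)
  note gA = graphon_of_labelling[OF m finite_atLeastAtMost, of "adj B", OF adj]
  note gV = graphon_of_labelling[OF m finite_atLeastAtMost, of "\<lambda>i j. v (c (x i)) (c (x j))", OF v]
  note gv = graphon_of_step_function[OF st]
  have k1: "kernel (\<lambda>(y, z). W (y, z) - v (c y) (c z))"
    using graphon_diff_kernel[OF W gv] by (simp add: case_prod_beta')
  have k2: "kernel (\<lambda>(y, z). v (c y) (c z) - v (c (x (m y))) (c (x (m z))))"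
    using graphon_diff_kernel[OF gv gV] by (simp add: case_prod_beta')
  have k3: "kernel (\<lambda>(y, z). v (c (x (m y))) (c (x (m z))) - adj B (m y) (m z))"
    using graphon_diff_kernel[OF gV gA] by (simp add: case_prod_beta')
  have k4: "kernel (\<lambda>(y, z). v (c y) (c z) - adj B (m y) (m z))"
    using graphon_diff_kernel[OF gv gA] by (simp add: case_prod_beta')
  have k5: "kernel (\<lambda>(y, z). W (y, z) - adj B (m y) (m z))"
    using graphon_diff_kernel[OF W gA] by (simp add: case_prod_beta')
  have c2: "cut_norm (\<lambda>(y, z). v (c y) (c z) - v (c (x (m y))) (c (x (m z)))) \<le> 2 * (M * \<sigma>)"
  proof -
    define f where "f y = c (x (m y))" for y
    have [measurable]: "(\<lambda>y. real (f y)) \<in> borel_measurable unit_interval"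
      unfolding f_def by (rule measurable_compose[OF mm]) simp
    have [measurable]: "(\<lambda>y. real (c y)) \<in> borel_measurable unit_interval"
      by (rule measurable_compose[OF cm]) simp
    have "{y\<in>space unit_interval. real (f y) \<noteq> real (c y)} \<in> sets unit_interval" by measurable
    then have "cut_norm (\<lambda>(y, z). v (c y) (c z) - v (c (x (m y))) (c (x (m z)))) \<le>
      2 * measure unit_interval {y\<in>{0..1}. c (x (m y)) \<noteq> c y}"
      unfolding f_def by (intro cut_norm_le_exceptional[OF k2]) auto
    then show ?thesis using bad' by linarith
  qed
  have c3: "cut_norm (\<lambda>(y, z). v (c (x (m y))) (c (x (m z))) - adj B (m y) (m z)) \<le> \<tau>"
  proof (rule cut_norm_le_four_cycle[OF k3 _ \<tau>])
    have k4: "real k ^ 4 > 0" using k by simp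
    have "four_cycle_density unit_interval (\<lambda>(y, z). (\<lambda>i j. - N i j) (m y) (m z)) = cycle_sum k (\<lambda>i j. - N i j) / real k ^ 4"
      by (rule four_cycle_density_labelling[OF m])
    \<comment> \<open>The difference to be bounded is \<open>- N\<close>; the cycle sum has even
      degree, so the sign disappears.\<close>
    also have "cycle_sum k (\<lambda>i j. - N i j) = cycle_sum k N" by (simp add: cycle_sum_def)
    also have "cycle_sum k N / real k ^ 4 \<le> \<tau> ^ 4"
      using cyc k4 by (simp add: N_def[abs_def] divide_le_eq)
    finally show "four_cycle_density unit_interval (\<lambda>(y, z). v (c (x (m y))) (c (x (m z))) - adj B (m y) (m z)) \<le> \<tau> ^ 4"
      by (simp add: N_def)
  qed
  have "cut_norm (\<lambda>(y, z). v (c y) (c z) - adj B (m y) (m z)) \<le> 2 * (M * \<sigma>) + \<tau>"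
    using cut_norm_triangle[OF k4 k2 k3, simplified] c2 c3 by linarith
  moreover have "cut_norm (\<lambda>(y, z). W (y, z) - adj B (m y) (m z)) \<le>
     cut_norm (\<lambda>(y, z). W (y, z) - v (c y) (c z)) + cut_norm (\<lambda>(y, z). v (c y) (c z) - adj B (m y) (m z))"
    by (rule cut_norm_triangle[OF k5 k1 k4]) simp
  ultimately have "cut_norm (\<lambda>(y, z). W (y, z) - adj B (m y) (m z)) \<le> \<epsilon> + 2 * (M * \<sigma>) + \<tau>"
    using cut by linarith
  then show ?thesis
    unfolding near_graph_def using m
    by (intro exI[of _ m] conjI) (simp add: edge_graph_def, simp only: edge_graph_adj[OF B])
qed

text \<open>Markov's inequality for the nonnegative quantities \<open>C\<close> and
  \<open>D\<close>. The threshold depends on \<open>\<delta>\<close> only, since the number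
  \<open>M\<close> of classes is uniform in \<open>W\<close>.\<close>

lemma sampling:
  assumes \<delta>: "0 < (\<delta>::real)"
  obtains K where "\<And>k W. k \<ge> K \<Longrightarrow> graphon W \<Longrightarrow> 2 / 3 \<le> measure (random_graph k W) {G. near_graph W G \<delta>}"
proof -
  \<comment> \<open>The accuracy is split evenly among the three comparisons in
    \<open>near_graph_if_typical\<close>.\<close>
  define \<tau> where "\<tau> = \<delta> / 3"
  have \<tau>: "0 < \<tau>" using \<delta> by (simp add: \<tau>_def)
  \<comment> \<open>36 is 4 * 9: the four-cycle density of \<open>W - V\<close> is at most
    \<open>4 * \<epsilon>\<close>, thus at most a ninth of \<open>\<tau> ^ 4\<close>.\<close>
  define \<epsilon> where "\<epsilon> = min (\<delta> / 3) (\<tau> ^ 4 / 36)"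
  have \<epsilon>: "0 < \<epsilon>" using \<delta> \<tau> by (simp add: \<epsilon>_def)
  obtain M where M: "\<And>W. graphon W \<Longrightarrow>
    \<exists>c v. step_function M c v \<and> cut_norm (\<lambda>(x, y). W (x, y) - v (c x) (c y)) \<le> \<epsilon>"
    using weak_regularity[OF \<epsilon>] by blast
  \<comment> \<open>The 6 brings \<open>2 * (M * \<sigma>)\<close> below a third of
    \<open>\<delta>\<close>; the summand 1 keeps the denominator positive when \<open>M\<close> is
    0.\<close>
  define \<sigma> where "\<sigma> = \<delta> / (6 * (real M + 1))"
  have \<sigma>: "0 < \<sigma>" using \<delta> by (simp add: \<sigma>_def)
  have M\<sigma>: "2 * (M * \<sigma>) \<le> \<delta> / 3"
    using \<delta> by (simp add: \<sigma>_def field_simps)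
  \<comment> \<open>The sample size makes the share of degenerate cycles,
    \<open>6 / (\<tau> ^ 4 * k)\<close>, and the variance term,
    \<open>M / k / \<sigma>\<^sup>2\<close>, at most 1/9 each. With the 1/9 allotted to
    \<open>\<epsilon>\<close> the total failure probability is at most 1/3.\<close>
  obtain K1 :: nat where K1: "54 / \<tau> ^ 4 \<le> K1" using real_arch_simple by blast
  obtain K2 :: nat where K2: "9 * M / \<sigma>\<^sup>2 \<le> K2" using real_arch_simple by blast
  define K where "K = max 1 (max K1 K2)"
  show thesis
  proof (rule that[of K])
    fix k W assume kK: "k \<ge> K" and W: "graphon W"
    interpret P: prob_space "sample_space k" by (rule prob_space_sample)
    have k: "k \<ge> 1" "real k > 0" using kK by (auto simp: K_def)
    have kK1: "54 / \<tau> ^ 4 \<le> k" "9 * M / \<sigma>\<^sup>2 \<le> k" using K1 K2 kK by (auto simp: K_def)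
    obtain c v where st: "step_function M c v" and cut: "cut_norm (\<lambda>(x, y). W (x, y) - v (c x) (c y)) \<le> \<epsilon>"
      using M[OF W] by blast
    define V where "V = (\<lambda>(x, y). v (c x) (c y))"
    have V: "graphon V" unfolding V_def by (rule graphon_of_step_function[OF st])
    have cm: "c \<in> measurable unit_interval (count_space UNIV)" using st by (simp add: step_function_def)
    define C where "C x B = cycle_sum k (\<lambda>i j. adj B i j - V (x i, x j))" for x B
    define F where "F x = (\<Sum>B\<in>Pow (vertex_pairs k). edge_weight k W x B * C x B)" for x
    \<comment> \<open>The sum of squares controls all class deviations at once.\<close>
    define D where "D x = (\<Sum>a<M. (class_deviation k c a x)\<^sup>2)" for x
    have Fi: "integrable (sample_space k) F" and FI: "(\<integral>x. F x \<partial>sample_space k) \<le> real k ^ 4 * four_cycle_density unit_interval (\<lambda>p. W p - V p) + 6 * real k ^ 3"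
      using expected_cycle_sum[OF W V, of k] unfolding F_def C_def by auto
    note Di1 = expected_class_deviation[OF cm k(1)]
    have Di: "integrable (sample_space k) D"
      unfolding D_def[abs_def] by (intro Bochner_Integration.integrable_sum Di1)
    have "(\<integral>x. D x \<partial>sample_space k) = (\<Sum>a<M. \<integral>x. (class_deviation k c a x)\<^sup>2 \<partial>sample_space k)"
      unfolding D_def by (rule Bochner_Integration.integral_sum) (rule Di1)
    also have "\<dots> \<le> (\<Sum>a<M. 1 / k)" by (intro sum_mono Di1)
    finally have DI: "(\<integral>x. D x \<partial>sample_space k) \<le> M / k" by simp
    \<comment> \<open>The pointwise form of Markov's inequality: the left side is never above 1, and
      at most 0 when one of the two thresholds is exceeded. It is then averaged over
      \<open>B\<close> and \<open>x\<close>.\<close>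
    have near: "1 - C x B / (\<tau> ^ 4 * real k ^ 4) - D x / \<sigma>\<^sup>2 \<le> of_bool (edge_graph k B \<in> {G. near_graph W G \<delta>})"
      if x: "x \<in> space (sample_space k)" and B: "B \<subseteq> vertex_pairs k" for x B
    proof (cases "C x B \<le> \<tau> ^ 4 * real k ^ 4 \<and> D x \<le> \<sigma>\<^sup>2")
      case True
      have "\<bar>class_deviation k c a x\<bar> \<le> \<sigma>" if "a < M" for a
      proof -
        have "(class_deviation k c a x)\<^sup>2 \<le> D x"
          unfolding D_def using that by (intro member_le_sum) auto
        then have "(class_deviation k c a x)\<^sup>2 \<le> \<sigma>\<^sup>2" using True by linarith
        then show ?thesis using \<sigma> by (simp add: abs_le_square_iff[symmetric])
      qed
      then have "near_graph W (edge_graph k B) (\<epsilon> + 2 * (M * \<sigma>) + \<tau>)"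
        using True \<tau> by (intro near_graph_if_typical[OF W st k(1) B x cut]) (auto simp: C_def V_def)
      moreover have "\<epsilon> + 2 * (M * \<sigma>) + \<tau> \<le> \<delta>" using M\<sigma> by (simp add: \<epsilon>_def \<tau>_def)
      ultimately have "near_graph W (edge_graph k B) \<delta>" unfolding near_graph_def by (meson order_trans)
      moreover have "0 \<le> C x B / (\<tau> ^ 4 * real k ^ 4)" unfolding C_def by (intro divide_nonneg_nonneg cycle_sum_nonneg) auto
      moreover have "0 \<le> D x / \<sigma>\<^sup>2" unfolding D_def by (intro divide_nonneg_nonneg sum_nonneg) auto
      ultimately show ?thesis by simp
    next
      case False
      have n: "0 \<le> C x B / (\<tau> ^ 4 * real k ^ 4)" unfolding C_def by (intro divide_nonneg_nonneg cycle_sum_nonneg) auto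
      have n': "0 \<le> D x / \<sigma>\<^sup>2" unfolding D_def by (intro divide_nonneg_nonneg sum_nonneg) auto
      have "1 \<le> C x B / (\<tau> ^ 4 * real k ^ 4) \<or> 1 \<le> D x / \<sigma>\<^sup>2"
        using False \<tau> \<sigma> k by (auto simp: le_divide_eq)
      then have "1 - C x B / (\<tau> ^ 4 * real k ^ 4) - D x / \<sigma>\<^sup>2 \<le> 0" using n n' by linarith
      also have "0 \<le> (of_bool (edge_graph k B \<in> {G. near_graph W G \<delta>}) :: real)" by simp
      finally show ?thesis .
    qed
    have kern: "kernel (\<lambda>p. W p - V p)" by (rule graphon_diff_kernel[OF W V])
    have "four_cycle_density unit_interval (\<lambda>p. W p - V p) \<le> 4 * \<epsilon>"
      using four_cycle_le_cut_norm[OF kern] cut by (simp add: V_def case_prod_beta')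
    also have "\<dots> \<le> \<tau> ^ 4 / 9" by (simp add: \<epsilon>_def)
    finally have C4: "four_cycle_density unit_interval (\<lambda>p. W p - V p) \<le> \<tau> ^ 4 / 9" .
    have "(\<integral>x. F x \<partial>sample_space k) / (\<tau> ^ 4 * real k ^ 4) \<le> (real k ^ 4 * (\<tau> ^ 4 / 9) + 6 * real k ^ 3) / (\<tau> ^ 4 * real k ^ 4)"
      using FI mult_left_mono[OF C4, of "real k ^ 4"] by (intro divide_right_mono) auto
    also have "\<dots> = 1 / 9 + 6 / (\<tau> ^ 4 * k)"
      using \<tau> k by (simp add: field_simps power4_eq_xxxx power3_eq_cube)
    also have "6 / (\<tau> ^ 4 * k) \<le> 1 / 9"
      using kK1(1) \<tau> k by (simp add: field_simps)
    finally have F9: "(\<integral>x. F x \<partial>sample_space k) / (\<tau> ^ 4 * real k ^ 4) \<le> 2 / 9" by simp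
    have "(\<integral>x. D x \<partial>sample_space k) / \<sigma>\<^sup>2 \<le> M / k / \<sigma>\<^sup>2"
      using DI by (intro divide_right_mono) auto
    also have "\<dots> \<le> 1 / 9" using kK1(2) \<sigma> k by (simp add: field_simps)
    finally have D9: "(\<integral>x. D x \<partial>sample_space k) / \<sigma>\<^sup>2 \<le> 1 / 9" .
    have "2 / 3 \<le> 1 - (\<integral>x. F x \<partial>sample_space k) / (\<tau> ^ 4 * real k ^ 4) - (\<integral>x. D x \<partial>sample_space k) / \<sigma>\<^sup>2"
      using F9 D9 by simp
    also have "\<dots> = (\<integral>x. 1 - F x / (\<tau> ^ 4 * real k ^ 4) - D x / \<sigma>\<^sup>2 \<partial>sample_space k)"
    proof -
      have 1: "integrable (sample_space k) (\<lambda>x. F x / (\<tau> ^ 4 * real k ^ 4))" "integrable (sample_space k) (\<lambda>x. D x / \<sigma>\<^sup>2)"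
        by (intro Bochner_Integration.integrable_divide Fi Di)+
      have 2: "integrable (sample_space k) (\<lambda>x. 1 - F x / (\<tau> ^ 4 * real k ^ 4))"
        by (intro Bochner_Integration.integrable_diff P.integrable_const 1)
      show ?thesis
        unfolding Bochner_Integration.integral_diff[OF 2 1(2)] Bochner_Integration.integral_diff[OF P.integrable_const 1(1)]
        using P.prob_space by simp
    qed
    also have "\<dots> \<le> (\<integral>x. (\<Sum>B\<in>Pow (vertex_pairs k). edge_weight k W x B * of_bool (edge_graph k B \<in> {G. near_graph W G \<delta>})) \<partial>sample_space k)"
    proof (rule integral_mono)
      show "integrable (sample_space k) (\<lambda>x. 1 - F x / (\<tau> ^ 4 * real k ^ 4) - D x / \<sigma>\<^sup>2)"
        using Fi Di by (intro Bochner_Integration.integrable_diff Bochner_Integration.integrable_divide P.integrable_const)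
      show "integrable (sample_space k) (\<lambda>x. \<Sum>B\<in>Pow (vertex_pairs k). edge_weight k W x B * of_bool (edge_graph k B \<in> {G. near_graph W G \<delta>}))"
        by (rule integrable_edge_weight_sum[OF W])
      fix x assume x: "x \<in> space (sample_space k)"
      have "1 - F x / (\<tau> ^ 4 * real k ^ 4) - D x / \<sigma>\<^sup>2 =
        (\<Sum>B\<in>Pow (vertex_pairs k). edge_weight k W x B * (1 - C x B / (\<tau> ^ 4 * real k ^ 4) - D x / \<sigma>\<^sup>2))"
      proof -
        have "(\<Sum>B\<in>Pow (vertex_pairs k). edge_weight k W x B * (D x / \<sigma>\<^sup>2)) = D x / \<sigma>\<^sup>2"
          by (simp only: sum_distrib_right[symmetric] sum_edge_weight mult_1)
        moreover have "(\<Sum>B\<in>Pow (vertex_pairs k). edge_weight k W x B * (C x B / (\<tau> ^ 4 * real k ^ 4))) = F x / (\<tau> ^ 4 * real k ^ 4)"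
          by (simp add: F_def sum_divide_distrib)
        ultimately show ?thesis
          by (simp only: right_diff_distrib sum_subtractf mult_1_right sum_edge_weight)
      qed
      also have "\<dots> \<le> (\<Sum>B\<in>Pow (vertex_pairs k). edge_weight k W x B * of_bool (edge_graph k B \<in> {G. near_graph W G \<delta>}))"
        by (intro sum_mono mult_left_mono edge_weight_nonneg[OF W x] near[OF x]) auto
      finally show "1 - F x / (\<tau> ^ 4 * real k ^ 4) - D x / \<sigma>\<^sup>2 \<le> \<dots>" .
    qed
    also have "\<dots> = measure (random_graph k W) {G. near_graph W G \<delta>}"
      by (rule prob_random_graph[OF W, symmetric])
    finally show "2 / 3 \<le> measure (random_graph k W) {G. near_graph W G \<delta>}" .
  qed
qed

section \<open>Counting\<close>

text \<open>With all other coordinates fixed, no remaining factor contains both \<open>x i\<close>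
  and \<open>x j\<close>. The product therefore splits into a function of \<open>x i\<close> times a
  function of \<open>x j\<close>, and the bilinear bound applies.\<close>

lemma integral_edge_factor_le:
  assumes Z: "kernel Z" and e: "(i, j) \<in> vertex_pairs k"
    and r: "\<And>e. r e \<in> borel_measurable (unit_interval \<Otimes>\<^sub>M unit_interval)"
    and rB: "\<And>e a b. a \<in> {0..1} \<Longrightarrow> b \<in> {0..1} \<Longrightarrow> \<bar>r e (a, b)\<bar> \<le> 1"
  shows "\<bar>\<integral>x. Z (x i, x j) * (\<Prod>e\<in>vertex_pairs k - {(i, j)}. r e (x (fst e), x (snd e))) \<partial>sample_space k\<bar> \<le> 4 * cut_norm Z"
proof -
  interpret P: prob_space "sample_space k" by (rule prob_space_sample)
  let ?E = "vertex_pairs k - {(i, j)}"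
  have ij: "i \<in> {1..k}" "j \<in> {1..k}" "i < j" using e by (auto simp: vertex_pairs_def)
  have ev: "fst e \<in> {1..k}" "snd e \<in> {1..k}" if "e \<in> ?E" for e using that by (auto simp: vertex_pairs_def)
  have upd: "x(l := y) \<in> space (sample_space k)" if "x \<in> space (sample_space k)" "y \<in> {0..1}" "l \<in> {1..k}" for x y l
    using that by (auto simp: space_PiM PiE_iff extensional_def)
  define R where "R E x = (\<Prod>e\<in>E. r e (x (fst e), x (snd e)))" for E and x :: "nat \<Rightarrow> real"
  have Rm: "R E \<in> borel_measurable (sample_space k)" if "E \<subseteq> ?E" for E
    unfolding R_def[abs_def]
    by (intro borel_measurable_prod measurable_coordinates r) (use ev that in blast)+
  have RB: "\<bar>R E x\<bar> \<le> 1" if x: "x \<in> space (sample_space k)" and E: "E \<subseteq> ?E" for E x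
    unfolding R_def abs_prod
  proof (rule prod_le_1)
    fix e assume "e \<in> E"
    then have "fst e \<in> {1..k}" "snd e \<in> {1..k}" using ev E by blast+
    then have "\<bar>r e (x (fst e), x (snd e))\<bar> \<le> 1" by (intro rB sample_space_in[OF x])
    then show "0 \<le> \<bar>r e (x (fst e), x (snd e))\<bar> \<and> \<bar>r e (x (fst e), x (snd e))\<bar> \<le> 1" by simp
  qed
  define F where "F x = Z (x i, x j) * R ?E x" for x
  have Fm: "F \<in> borel_measurable (sample_space k)"
    unfolding F_def[abs_def]
    by (intro borel_measurable_times Rm order_refl measurable_coordinates kernel_measurable[OF Z] ij)
  have FB: "\<bar>F x\<bar> \<le> 1" if x: "x \<in> space (sample_space k)" for x
    unfolding F_def abs_mult
    by (intro mult_le_one abs_ge_zero RB[OF x] order_refl kernel_bound[OF Z] sample_space_in[OF x] ij)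
  define F1 where "F1 x = (\<integral>b. F (x(j := b)) \<partial>unit_interval)" for x
  have F1m: "F1 \<in> borel_measurable (sample_space k)"
    unfolding F1_def[abs_def] by (rule measurable_resample[OF ij(2) Fm])
  have F1B: "\<bar>F1 x\<bar> \<le> 1" if x: "x \<in> space (sample_space k)" for x
    unfolding F1_def by (rule unit_interval.abs_integral_le) (use FB upd[OF x _ ij(2)] in auto)
  have "(\<integral>x. F x \<partial>sample_space k) = (\<integral>x. F1 x \<partial>sample_space k)"
    unfolding F1_def by (rule resample[OF ij(2) Fm FB])
  also have "\<dots> = (\<integral>x. (\<integral>a. F1 (x(i := a)) \<partial>unit_interval) \<partial>sample_space k)"
    by (rule resample[OF ij(1) F1m F1B])
  finally have eq: "(\<integral>x. F x \<partial>sample_space k) = (\<integral>x. (\<integral>a. F1 (x(i := a)) \<partial>unit_interval) \<partial>sample_space k)" .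
  have "\<bar>\<integral>a. F1 (x(i := a)) \<partial>unit_interval\<bar> \<le> 4 * cut_norm Z" if x: "x \<in> space (sample_space k)" for x
  proof -
    \<comment> \<open>Edges at \<open>j\<close> avoid \<open>i\<close>, because the pair
      \<open>(i, j)\<close> has been removed; all other edges do not see the value b at
      \<open>j\<close>.\<close>
    let ?Ej = "{e\<in>?E. fst e = j \<or> snd e = j}" and ?En = "{e\<in>?E. \<not> (fst e = j \<or> snd e = j)}"
    define f where "f a = R ?En (x(i := a))" for a
    define g where "g b = R ?Ej (x(j := b))" for b
    have Rsplit: "R ?E (x(i := a, j := b)) = f a * g b" for a b
    proof -
      have fin: "finite ?En" "finite ?Ej" by simp_all
      have disj: "?En \<inter> ?Ej = {}" by blast
      have "?E = ?En \<union> ?Ej" by blast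
      then have "R ?E (x(i := a, j := b)) = R (?En \<union> ?Ej) (x(i := a, j := b))"
        by (rule arg_cong[where f="\<lambda>E. R E (x(i := a, j := b))"])
      also have "\<dots> = R ?En (x(i := a, j := b)) * R ?Ej (x(i := a, j := b))"
        unfolding R_def by (rule prod.union_disjoint[OF fin disj])
      also have "R ?En (x(i := a, j := b)) = f a"
        unfolding R_def f_def by (intro prod.cong refl) auto
      also have "R ?Ej (x(i := a, j := b)) = g b"
        unfolding R_def g_def
      proof (intro prod.cong refl)
        fix e assume "e \<in> ?Ej"
        then have "fst e \<noteq> i" "snd e \<noteq> i" using ij(3) by (auto simp: vertex_pairs_def)
        then show "r e ((x(i := a, j := b)) (fst e), (x(i := a, j := b)) (snd e)) = r e ((x(j := b)) (fst e), (x(j := b)) (snd e))"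
          by simp
      qed
      finally show ?thesis .
    qed
    have um: "(\<lambda>a. x(l := a)) \<in> measurable unit_interval (sample_space k)" if l: "l \<in> {1..k}" for l
    proof -
      have "(\<lambda>a. x(l := a)) \<in> measurable unit_interval (Pi\<^sub>M (insert l {1..k}) (\<lambda>_. unit_interval))"
        using x by measurable
      then show ?thesis unfolding insert_absorb[OF l] .
    qed
    have fm: "f \<in> borel_measurable unit_interval"
      unfolding f_def[abs_def] by (rule measurable_compose[OF um[OF ij(1)] Rm]) auto
    have gm: "g \<in> borel_measurable unit_interval"
      unfolding g_def[abs_def] by (rule measurable_compose[OF um[OF ij(2)] Rm]) auto
    have fB: "\<bar>f a\<bar> \<le> 1" if "a \<in> space unit_interval" for a
      unfolding f_def using that upd[OF x _ ij(1)] by (intro RB) auto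
    have gB: "\<bar>g a\<bar> \<le> 1" if "a \<in> space unit_interval" for a
      unfolding g_def using that upd[OF x _ ij(2)] by (intro RB) auto
    have "(\<integral>a. F1 (x(i := a)) \<partial>unit_interval) = (\<integral>a. (\<integral>b. f a * g b * Z (a, b) \<partial>unit_interval) \<partial>unit_interval)"
      unfolding F1_def F_def Rsplit using ij(3) by (simp add: mult.commute)
    also have "\<bar>\<dots>\<bar> \<le> 4 * cut_norm Z"
      by (rule unit_interval.bilinear_integral_le[OF kernel_measurable[OF Z] _ _ fm gm fB gB])
         (use kernel_bound[OF Z] cut_norm_lower[OF Z] in \<open>auto simp: unit_square_def\<close>)
    finally show ?thesis .
  qed
  then have "\<bar>\<integral>x. F x \<partial>sample_space k\<bar> \<le> 4 * cut_norm Z"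
    unfolding eq using cut_norm_nonneg[OF Z] by (intro P.abs_integral_le) auto
  then show ?thesis by (simp only: F_def R_def)
qed

text \<open>The edges are switched from \<open>W\<close> to \<open>U\<close> one at a time. A switch
  changes a single factor, by plus or minus \<open>U - W\<close>, and costs at most four cut
  norms.\<close>

lemma expected_edge_weight_diff:
  assumes U: "graphon U" and W: "graphon W"
  shows "\<bar>(\<integral>x. edge_weight k U x B \<partial>sample_space k) - (\<integral>x. edge_weight k W x B \<partial>sample_space k)\<bar>
    \<le> card (vertex_pairs k) * (4 * cut_norm (\<lambda>z. U z - W z))"
proof -
  interpret P: prob_space "sample_space k" by (rule prob_space_sample)
  let ?d = "4 * cut_norm (\<lambda>z. U z - W z)"
  note k = graphon_diff_kernel[OF U W]
  define q where "q Y e p = (if e \<in> B then Y p else 1 - Y p)" for Y :: "real \<times> real \<Rightarrow> real" and e p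
  \<comment> \<open>The hybrid: edges in \<open>A\<close> use \<open>U\<close>, the others
    \<open>W\<close>.\<close>
  define r where "r A e p = (if e \<in> A then q U e p else q W e p)" for A e p
  have qm: "q Y e \<in> borel_measurable (unit_interval \<Otimes>\<^sub>M unit_interval)" if "graphon Y" for Y e
    using graphon_measurable[OF that] unfolding q_def[abs_def] by (cases "e \<in> B") simp_all
  have qB: "\<bar>q Y e (a, b)\<bar> \<le> 1" if "graphon Y" "a \<in> {0..1}" "b \<in> {0..1}" for Y e a b
    using that by (auto simp: q_def graphon_def)
  have rm: "r A e \<in> borel_measurable (unit_interval \<Otimes>\<^sub>M unit_interval)" for A e
    using qm[OF U, of e] qm[OF W, of e] unfolding r_def[abs_def] by (cases "e \<in> A") simp_all
  have rB: "\<bar>r A e (a, b)\<bar> \<le> 1" if "a \<in> {0..1}" "b \<in> {0..1}" for A e a b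
    using qB[OF U that] qB[OF W that] by (simp add: r_def)
  define H where "H A x = (\<Prod>e\<in>vertex_pairs k. r A e (x (fst e), x (snd e)))" for A and x :: "nat \<Rightarrow> real"
  have Hi: "integrable (sample_space k) (H A)" for A
  proof (rule P.integrable_bounded[where B=1])
    show "H A \<in> borel_measurable (sample_space k)"
      unfolding H_def[abs_def] by (intro borel_measurable_prod measurable_coordinates rm) (auto simp: vertex_pairs_def)
    fix x assume x: "x \<in> space (sample_space k)"
    show "\<bar>H A x\<bar> \<le> 1"
      unfolding H_def abs_prod
    proof (rule prod_le_1)
      fix e assume "e \<in> vertex_pairs k"
      then have "fst e \<in> {1..k}" "snd e \<in> {1..k}" by (auto simp: vertex_pairs_def)
      then have "\<bar>r A e (x (fst e), x (snd e))\<bar> \<le> 1" by (intro rB sample_space_in[OF x])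
      then show "0 \<le> \<bar>r A e (x (fst e), x (snd e))\<bar> \<and> \<bar>r A e (x (fst e), x (snd e))\<bar> \<le> 1" by simp
    qed
  qed
  have "\<bar>(\<integral>x. H A x \<partial>sample_space k) - (\<integral>x. H {} x \<partial>sample_space k)\<bar> \<le> card A * ?d"
    if "finite A" "A \<subseteq> vertex_pairs k" for A
    using that
  proof (induction A rule: finite_induct)
    case (insert e A)
    obtain i j where e: "e = (i, j)" by (cases e)
    then have eV: "(i, j) \<in> vertex_pairs k" using insert.prems by auto
    let ?R = "\<lambda>x. \<Prod>e\<in>vertex_pairs k - {(i, j)}. r A e (x (fst e), x (snd e))"
    have split: "H A' x = r A' e (x i, x j) * (\<Prod>e\<in>vertex_pairs k - {(i, j)}. r A' e (x (fst e), x (snd e)))" for A' x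
      unfolding H_def by (subst prod.remove[OF finite_vertex_pairs eV]) (simp add: e)
    have diff: "H (insert e A) x - H A x = (if e \<in> B then 1 else -1) * ((U (x i, x j) - W (x i, x j)) * ?R x)" for x
    proof -
      have R: "(\<Prod>e'\<in>vertex_pairs k - {(i, j)}. r (insert e A) e' (x (fst e'), x (snd e'))) = ?R x"
        by (intro prod.cong refl) (auto simp: r_def e)
      have "H (insert e A) x - H A x = (q U e (x i, x j) - q W e (x i, x j)) * ?R x"
        unfolding split R using insert.hyps by (simp add: r_def left_diff_distrib)
      also have "q U e (x i, x j) - q W e (x i, x j) = (if e \<in> B then 1 else -1) * (U (x i, x j) - W (x i, x j))"
        by (simp add: q_def)
      finally show ?thesis by (simp only: mult.assoc)
    qed
    have "(\<integral>x. H (insert e A) x \<partial>sample_space k) - (\<integral>x. H A x \<partial>sample_space k) = (\<integral>x. H (insert e A) x - H A x \<partial>sample_space k)"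
      by (rule Bochner_Integration.integral_diff[symmetric]) (rule Hi)+
    also have "\<dots> = (if e \<in> B then 1 else -1) * (\<integral>x. (U (x i, x j) - W (x i, x j)) * ?R x \<partial>sample_space k)"
      unfolding diff by simp
    also have "\<bar>\<dots>\<bar> \<le> ?d"
      using integral_edge_factor_le[OF k eV, of "r A", OF rm rB] by (simp add: abs_mult)
    finally show ?case
      using insert.IH insert.prems insert.hyps by (simp add: distrib_right)
  qed simp
  from this[OF finite_vertex_pairs order_refl]
  show ?thesis by (simp add: H_def r_def q_def edge_weight_def cong: prod.cong)
qed

text \<open>The estimate for a single edge set is added up over all edge sets. The constant may grow
  with \<open>k\<close>, because it is applied at one fixed sample size.\<close>

lemma counting:
  assumes U: "graphon U" and W: "graphon W"
  shows "\<bar>measure (random_graph k U) P - measure (random_graph k W) P\<bar>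
    \<le> 2 ^ card (vertex_pairs k) * (card (vertex_pairs k) * (4 * cut_norm (\<lambda>z. U z - W z)))"
proof -
  interpret P: prob_space "sample_space k" by (rule prob_space_sample)
  let ?c = "card (vertex_pairs k) * (4 * cut_norm (\<lambda>z. U z - W z))"
  have c0: "0 \<le> ?c" using cut_norm_nonneg[OF graphon_diff_kernel[OF U W]] by simp
  have wi: "integrable (sample_space k) (\<lambda>x. edge_weight k Y x B)" if Y: "graphon Y" for Y B
    by (rule P.integrable_bounded[where B=1])
       (use measurable_edge_weight[OF Y] edge_weight_nonneg[OF Y] edge_weight_le_1[OF Y] in \<open>auto simp del: One_nat_def\<close>)
  have m: "measure (random_graph k Y) P = (\<Sum>B\<in>Pow (vertex_pairs k). of_bool (edge_graph k B \<in> P) * (\<integral>x. edge_weight k Y x B \<partial>sample_space k))"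
    if Y: "graphon Y" for Y
    unfolding prob_random_graph[OF Y]
    by (subst Bochner_Integration.integral_sum) (auto simp: mult.commute intro!: Bochner_Integration.integrable_mult_left wi[OF Y] simp del: One_nat_def)
  have "\<bar>measure (random_graph k U) P - measure (random_graph k W) P\<bar> =
    \<bar>\<Sum>B\<in>Pow (vertex_pairs k). of_bool (edge_graph k B \<in> P) * ((\<integral>x. edge_weight k U x B \<partial>sample_space k) - (\<integral>x. edge_weight k W x B \<partial>sample_space k))\<bar>"
    by (simp only: m[OF U] m[OF W] sum_subtractf right_diff_distrib)
  also have "\<dots> \<le> (\<Sum>B\<in>Pow (vertex_pairs k). \<bar>of_bool (edge_graph k B \<in> P) * ((\<integral>x. edge_weight k U x B \<partial>sample_space k) - (\<integral>x. edge_weight k W x B \<partial>sample_space k))\<bar>)"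
    by (rule sum_abs)
  also have "\<dots> \<le> (\<Sum>B\<in>Pow (vertex_pairs k). ?c)"
  proof (rule sum_mono)
    fix B
    show "\<bar>of_bool (edge_graph k B \<in> P) * ((\<integral>x. edge_weight k U x B \<partial>sample_space k) - (\<integral>x. edge_weight k W x B \<partial>sample_space k))\<bar> \<le> ?c"
      using expected_edge_weight_diff[OF U W, of k B] c0 by (cases "edge_graph k B \<in> P") (simp_all only: of_bool_eq mult_1 mult_zero_left abs_zero)
  qed
  also have "\<dots> = 2 ^ card (vertex_pairs k) * ?c" by (simp add: card_Pow)
  finally show ?thesis .
qed

section \<open>Testability\<close>

lemma cut_norm_cong:
  assumes "\<And>x y. x \<in> {0..1} \<Longrightarrow> y \<in> {0..1} \<Longrightarrow> Z (x, y) = Z' (x, y)"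
  shows "cut_norm Z = cut_norm Z'"
proof -
  have "(LINT z:S \<times> T|unit_square. Z z) = (LINT z:S \<times> T|unit_square. Z' z)" for S T
    unfolding set_lebesgue_integral_def
    by (rule Bochner_Integration.integral_cong) (auto simp: unit_square_def space_pair_measure assms)
  then show ?thesis by (simp add: cut_norm_def)
qed

lemma cut_norm_minus: "cut_norm (\<lambda>z. - Z z) = cut_norm Z"
  by (simp add: cut_norm_def set_lebesgue_integral_def)

text \<open>The placement of \<open>G\<close> is followed by the isomorphism. Simplicity puts each
  edge of \<open>G\<close> inside the vertex set, where the isomorphism is injective, so no non-edge
  turns into an edge.\<close>

lemma near_graph_isomorphic:
  assumes G: "simple_graph G" and iso: "graph_isomorphic G H" and near: "near_graph W G \<delta>"
  shows "near_graph W H \<delta>"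
proof -
  obtain f where f: "bij_betw f (fst G) (fst H)" and E: "snd H = (\<lambda>e. f ` e) ` snd G"
    using iso by (auto simp: graph_isomorphic_def)
  obtain m where m: "uniform_labelling (fst G) m"
    and cut: "cut_norm (\<lambda>(x, y). W (x, y) - of_bool ({m x, m y} \<in> snd G)) \<le> \<delta>"
    using near by (auto simp: near_graph_def)
  have inj: "inj_on f (fst G)" and img: "f ` fst G = fst H" and card: "card (fst H) = card (fst G)"
    using f bij_betw_same_card[OF f] by (auto simp: bij_betw_def)
  have mm: "m \<in> measurable unit_interval (count_space UNIV)" and mG: "\<And>y. y \<in> {0..1} \<Longrightarrow> m y \<in> fst G"
    and mu: "\<And>v. v \<in> fst G \<Longrightarrow> measure unit_interval {y\<in>{0..1}. m y = v} = 1 / card (fst G)"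
    using m by (auto simp: uniform_labelling_def)
  have lab: "uniform_labelling (fst H) (\<lambda>y. f (m y))"
    unfolding uniform_labelling_def
  proof (intro conjI ballI)
    show "(\<lambda>y. f (m y)) \<in> measurable unit_interval (count_space UNIV)"
      by (rule measurable_compose[OF mm]) simp
    show "f (m y) \<in> fst H" if "y \<in> {0..1}" for y using mG[OF that] img by blast
    fix w assume "w \<in> fst H"
    then obtain v where v: "v \<in> fst G" "w = f v" using img by blast
    have "{y\<in>{0..1}. f (m y) = w} = {y\<in>{0..1}. m y = v}"
      using mG inj_on_eq_iff[OF inj _ v(1)] v(2) by blast
    then show "measure unit_interval {y\<in>{0..1}. f (m y) = w} = 1 / card (fst H)"
      by (simp only: mu[OF v(1)] card)
  qed
  have edge: "{f (m x), f (m y)} \<in> snd H \<longleftrightarrow> {m x, m y} \<in> snd G" if "x \<in> {0..1}" "y \<in> {0..1}" for x y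
  proof
    assume "{f (m x), f (m y)} \<in> snd H"
    then obtain e where e: "e \<in> snd G" "f ` {m x, m y} = f ` e" unfolding E by auto
    have "e \<subseteq> fst G" using e(1) G by (auto simp: simple_graph_def)
    then have "{m x, m y} = e"
      using inj_on_image_eq_iff[OF inj, of "{m x, m y}" e] e(2) mG[OF that(1)] mG[OF that(2)] by blast
    then show "{m x, m y} \<in> snd G" using e(1) by simp
  next
    assume "{m x, m y} \<in> snd G"
    then have "f ` {m x, m y} \<in> snd H" unfolding E by (rule imageI)
    then show "{f (m x), f (m y)} \<in> snd H" by simp
  qed
  have "cut_norm (\<lambda>(x, y). W (x, y) - of_bool ({f (m x), f (m y)} \<in> snd H)) =
      cut_norm (\<lambda>(x, y). W (x, y) - of_bool ({m x, m y} \<in> snd G))"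
    by (rule cut_norm_cong) (simp only: edge prod.case)
  with lab cut show ?thesis by (auto simp: near_graph_def)
qed

lemma simple_edge_graph:
  assumes "B \<subseteq> vertex_pairs k" shows "simple_graph (edge_graph k B)"
proof -
  have "{i, j} \<subseteq> {1..k} \<and> card {i, j} = 2" if "(i, j) \<in> B" for i j
    using that assms by (auto simp: vertex_pairs_def)
  then show ?thesis by (auto simp: simple_graph_def edge_graph_def)
qed

text \<open>Both placements have classes of equal size, so some \<open>\<psi>\<close> turns
  \<open>m\<close> into \<open>m'\<close> almost everywhere. The pullback of \<open>U\<close> is
  isomorphic to \<open>U\<close>, hence in \<open>R\<close>, and is compared with \<open>W\<close>
  through the step function placed by \<open>m'\<close>. Only the pullback costs a fourth root,
  whence the two unequal terms of the bound.\<close>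

lemma near_same_graph:
  assumes U: "U \<in> W0" and W: "W \<in> W0" and R: "graphon_property R" "U \<in> R"
    and fin: "finite (fst G)"
    and nU: "near_graph U G \<delta>" and nW: "near_graph W G \<delta>" and r: "4 * \<delta> \<le> r ^ 4" "0 \<le> r"
  shows "setdist_cut W R \<le> ereal (\<delta> + r)"
proof -
  obtain m where m: "uniform_labelling (fst G) m" and cU: "cut_norm (\<lambda>(x, y). U (x, y) - of_bool ({m x, m y} \<in> snd G)) \<le> \<delta>"
    using nU by (auto simp: near_graph_def)
  obtain m' where m': "uniform_labelling (fst G) m'" and cW: "cut_norm (\<lambda>(x, y). W (x, y) - of_bool ({m' x, m' y} \<in> snd G)) \<le> \<delta>"
    using nW by (auto simp: near_graph_def)
  have "\<exists>\<psi>. measure_preserving_map \<psi> \<and> (AE x in unit_interval. m (\<psi> x) = m' x)"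
    by (rule rearrangement_exact[of m' m "fst G"]) (use m m' fin in \<open>auto simp: uniform_labelling_def\<close>)
  then obtain \<psi> where \<psi>: "measure_preserving_map \<psi>" and AE: "AE x in unit_interval. m (\<psi> x) = m' x"
    by blast
  have \<psi>m: "\<psi> \<in> measurable unit_interval unit_interval" using \<psi> by (simp add: measure_preserving_map_def)
  define u where "u i j = (of_bool ({i, j} \<in> snd G) :: real)" for i j
  have u: "u i j \<in> {0..1}" "u i j = u j i" for i j by (auto simp: u_def insert_commute)
  note lab = graphon_of_labelling[OF _ fin u]
  have m\<psi>: "uniform_labelling (fst G) (\<lambda>y. m (\<psi> y))" by (rule uniform_labelling_measure_preserving[OF m \<psi>])
  define U' where "U' = restrict (\<lambda>(x, y). U (\<psi> x, \<psi> y)) ({0..1} \<times> {0..1})"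
  have U': "U' \<in> W0" unfolding U'_def by (rule pullback_W0[OF U \<psi>m])
  have "isomorphic U U'" unfolding U'_def by (rule isomorphic_pullback[OF U \<psi>])
  then have U'R: "U' \<in> R" using R U' by (auto simp: graphon_property_def)
  have gU: "graphon U" "graphon W" "graphon U'" using U W U' W0_graphon by auto
  note d = graphon_diff_kernel
  have k0: "kernel (\<lambda>z. W z - U' z)" by (rule d[OF gU(2,3)])
  have k1: "kernel (\<lambda>(x, y). W (x, y) - u (m' x) (m' y))"
    using d[OF gU(2) lab[OF m']] by (simp add: case_prod_beta')
  have k2: "kernel (\<lambda>(x, y). u (m' x) (m' y) - u (m (\<psi> x)) (m (\<psi> y)))"
    using d[OF lab[OF m'] lab[OF m\<psi>]] by (simp add: case_prod_beta')
  have k3: "kernel (\<lambda>(x, y). u (m (\<psi> x)) (m (\<psi> y)) - U' (x, y))"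
    using d[OF lab[OF m\<psi>] gU(3)] by (simp add: case_prod_beta')
  have k4: "kernel (\<lambda>(x, y). u (m' x) (m' y) - U' (x, y))"
    using d[OF lab[OF m'] gU(3)] by (simp add: case_prod_beta')
  have k5: "kernel (\<lambda>(x, y). u (m x) (m y) - U (x, y))"
    using d[OF lab[OF m] gU(1)] by (simp add: case_prod_beta')
  have c1: "cut_norm (\<lambda>(x, y). W (x, y) - u (m' x) (m' y)) \<le> \<delta>" using cW by (simp only: u_def)
  \<comment> \<open>The two placements differ on a null set only.\<close>
  have c2: "cut_norm (\<lambda>(x, y). u (m' x) (m' y) - u (m (\<psi> x)) (m (\<psi> y))) \<le> 0"
  proof -
    obtain N where N: "{x\<in>space unit_interval. \<not> m (\<psi> x) = m' x} \<subseteq> N" "emeasure unit_interval N = 0" "N \<in> sets unit_interval"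
      using AE by (rule AE_E)
    have eq: "m (\<psi> x) = m' x" if "x \<in> {0..1} - N" for x using N(1) that by auto
    have "cut_norm (\<lambda>(x, y). u (m' x) (m' y) - u (m (\<psi> x)) (m (\<psi> y))) \<le> 2 * measure unit_interval N"
      by (rule cut_norm_le_exceptional[OF k2 N(3)]) (simp only: eq prod.case diff_self)
    then show ?thesis using N(2) by (simp add: measure_def)
  qed
  have c3: "cut_norm (\<lambda>(x, y). u (m (\<psi> x)) (m (\<psi> y)) - U' (x, y)) \<le> r"
  proof -
    have "cut_norm (\<lambda>(x, y). u (m x) (m y) - U (x, y)) = cut_norm (\<lambda>z. - (\<lambda>(x, y). U (x, y) - u (m x) (m y)) z)"
      by (simp add: case_prod_beta')
    also have "\<dots> \<le> \<delta>" unfolding cut_norm_minus using cU by (simp only: u_def)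
    finally have "4 * cut_norm (\<lambda>(x, y). u (m x) (m y) - U (x, y)) \<le> r ^ 4" using r(1) by linarith
    from cut_norm_pullback_le[OF k5 \<psi> this r(2)]
    have "cut_norm (\<lambda>(x, y). u (m (\<psi> x)) (m (\<psi> y)) - U (\<psi> x, \<psi> y)) \<le> r" by simp
    moreover have "cut_norm (\<lambda>(x, y). u (m (\<psi> x)) (m (\<psi> y)) - U' (x, y)) = cut_norm (\<lambda>(x, y). u (m (\<psi> x)) (m (\<psi> y)) - U (\<psi> x, \<psi> y))"
      by (rule cut_norm_cong) (simp add: U'_def)
    ultimately show ?thesis by simp
  qed
  have "d_cut W U' \<le> cut_norm (\<lambda>(x, y). W (x, y) - u (m' x) (m' y)) + cut_norm (\<lambda>(x, y). u (m' x) (m' y) - U' (x, y))"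
    unfolding d_cut_def by (rule cut_norm_triangle[OF k0 k1 k4]) simp
  also have "cut_norm (\<lambda>(x, y). u (m' x) (m' y) - U' (x, y)) \<le>
    cut_norm (\<lambda>(x, y). u (m' x) (m' y) - u (m (\<psi> x)) (m (\<psi> y))) + cut_norm (\<lambda>(x, y). u (m (\<psi> x)) (m (\<psi> y)) - U' (x, y))"
    by (rule cut_norm_triangle[OF k4 k2 k3]) simp
  finally have "d_cut W U' \<le> \<delta> + r" using c1 c2 c3 by linarith
  then show ?thesis
    unfolding setdist_cut_def by (intro INF_lower2[OF U'R]) simp
qed

text \<open>At one suitable sample size the acceptance probabilities of an element of
  \<open>R\<close> and of a function far from \<open>R\<close> differ by at least 1/3; the counting
  bound turns this gap into a lower bound on their cut distance.\<close>

lemma cut_ball_if_testable: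
  assumes R: "R \<subseteq> W0" and t: "testable R" and \<epsilon>: "0 < (\<epsilon>::real)"
  shows "\<exists>\<epsilon>'>0::real. B_cut R \<epsilon>' \<subseteq> B_1 R \<epsilon>"
proof -
  obtain P where P1: "\<And>W k. W \<in> R \<Longrightarrow> k \<ge> 1 \<Longrightarrow> measure (random_graph k W) P \<ge> 2 / 3"
    and P2: "\<And>\<epsilon>::real. \<epsilon> > 0 \<Longrightarrow> \<exists>k\<^sub>0\<ge>1. \<forall>k\<ge>k\<^sub>0. \<forall>W\<in>W0. setdist_1 W R \<ge> ereal \<epsilon> \<longrightarrow> measure (random_graph k W) P \<le> 1 / 3"
    using t unfolding testable_def by blast
  obtain k where k: "k \<ge> 1" and Pk: "\<And>W. W \<in> W0 \<Longrightarrow> setdist_1 W R \<ge> ereal \<epsilon> \<Longrightarrow> measure (random_graph k W) P \<le> 1 / 3"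
    using P2[OF \<epsilon>] by blast
  define c :: real where "c = 2 ^ card (vertex_pairs k) * (card (vertex_pairs k) * 4)"
  have c: "0 \<le> c" by (simp add: c_def)
  \<comment> \<open>The summand 1 makes \<open>c * \<epsilon>'\<close> strictly less than 1/3 and
    covers \<open>c = 0\<close>, which occurs when there are no vertex pairs.\<close>
  define \<epsilon>' where "\<epsilon>' = 1 / (3 * (c + 1))"
  have \<epsilon>': "0 < \<epsilon>'" using c by (simp add: \<epsilon>'_def)
  have "W \<in> B_1 R \<epsilon>" if WB: "W \<in> B_cut R \<epsilon>'" for W
  proof (rule ccontr)
    assume n: "W \<notin> B_1 R \<epsilon>"
    have W: "W \<in> W0" and "setdist_cut W R < ereal \<epsilon>'" using WB by (auto simp: B_cut_def)
    then obtain U where U: "U \<in> R" and d: "d_cut W U < \<epsilon>'"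
      unfolding setdist_cut_def INF_less_iff by auto
    have "setdist_1 W R \<ge> ereal \<epsilon>" using n W by (auto simp: B_1_def not_less)
    then have "measure (random_graph k W) P \<le> 1 / 3" by (rule Pk[OF W])
    moreover have "measure (random_graph k U) P \<ge> 2 / 3" by (rule P1[OF U k])
    moreover have gW: "graphon W" and gU: "graphon U" using W U R W0_graphon by auto
    have "\<bar>measure (random_graph k W) P - measure (random_graph k U) P\<bar> \<le> c * d_cut W U"
      using counting[OF gW gU, of k P] by (simp add: c_def d_cut_def mult.assoc)
    moreover have "c * d_cut W U \<le> c * \<epsilon>'" using d c by (intro mult_left_mono) auto
    moreover have "c * \<epsilon>' < 1 / 3" using c by (simp add: \<epsilon>'_def field_simps)
    ultimately show False by linarith
  qed
  then show ?thesis using \<epsilon>' by blast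
qed

text \<open>A single property has to serve every \<open>\<epsilon>\<close>, so the accuracy of the
  test is tied to the number of vertices and improves without bound.\<close>

lemma testable_if_cut_ball:
  assumes R: "graphon_property R" and h: "\<And>\<epsilon>::real. \<epsilon> > 0 \<Longrightarrow> \<exists>\<epsilon>'>0::real. B_cut R \<epsilon>' \<subseteq> B_1 R \<epsilon>"
  shows "testable R"
proof -
  have RW: "R \<subseteq> W0" using R by (simp add: graphon_property_def)
  have "\<exists>K. \<forall>k\<ge>K. \<forall>W. graphon W \<longrightarrow> 2 / 3 \<le> measure (random_graph k W) {G. near_graph W G (1 / n)}" if "n \<ge> 1" for n :: nat
    by (rule sampling[of "1 / n"]) (use that in auto)
  then obtain K where K: "\<And>n k W. n \<ge> (1::nat) \<Longrightarrow> k \<ge> K n \<Longrightarrow> graphon W \<Longrightarrow> 2 / 3 \<le> measure (random_graph k W) {G. near_graph W G (1 / n)}"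
    by metis
  \<comment> \<open>The best accuracy \<open>1 / \<nu> k\<close> that sampling guarantees for \<open>k\<close> vertices; for \<open>\<nu> k = 0\<close> every graph is accepted.\<close>
  define \<nu> where "\<nu> k = Max {n. n \<le> k \<and> (n = 0 \<or> K n \<le> k)}" for k :: nat
  have fin: "finite {n. n \<le> k \<and> (n = 0 \<or> K n \<le> k)}" for k by (rule finite_subset[of _ "{..k}"]) auto
  have \<nu>K: "K (\<nu> k) \<le> k" if "\<nu> k \<ge> 1" for k
    using Max_in[OF fin[of k]] that unfolding \<nu>_def[symmetric] by force
  \<comment> \<open>Hence \<open>\<nu> k\<close> tends to infinity, however fast \<open>K\<close>
    grows.\<close>
  have \<nu>ge: "n \<le> \<nu> k" if "n \<le> k" "K n \<le> k" for n k
    unfolding \<nu>_def using that by (intro Max_ge fin) auto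
  \<comment> \<open>Acceptance depends only on the vertex count and on nearness, both invariant
    under isomorphism.\<close>
  define P where "P = {G. simple_graph G \<and> (\<nu> (card (fst G)) = 0 \<or> (\<exists>U\<in>R. near_graph U G (1 / \<nu> (card (fst G)))))}"
  have card: "card (fst (edge_graph k B)) = k" for k B by (simp add: edge_graph_def)
  have "graph_property P"
    unfolding graph_property_def
  proof (intro conjI ballI allI impI)
    fix G H assume G: "G \<in> P" and H: "simple_graph H" and iso: "graph_isomorphic G H"
    have "card (fst H) = card (fst G)"
      using iso unfolding graph_isomorphic_def by (metis bij_betw_same_card)
    then show "H \<in> P" using G H near_graph_isomorphic[OF _ iso] unfolding P_def by auto
  qed (simp add: P_def)
  moreover have "measure (random_graph k W) P \<ge> 2 / 3" if W: "W \<in> R" for W k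
  proof -
    have gW: "graphon W" using W RW W0_graphon by auto
    show ?thesis
    proof (cases "\<nu> k = 0")
      case True
      have "1 \<le> measure (random_graph k W) P"
        unfolding prob_random_graph_UNIV[OF gW, of k, symmetric]
        by (rule prob_random_graph_mono[OF gW]) (simp add: P_def card True simple_edge_graph)
      then show ?thesis by simp
    next
      case False
      then have "2 / 3 \<le> measure (random_graph k W) {G. near_graph W G (1 / \<nu> k)}"
        by (intro K \<nu>K gW) auto
      also have "\<dots> \<le> measure (random_graph k W) P"
        by (rule prob_random_graph_mono[OF gW]) (use W in \<open>auto simp: P_def card simple_edge_graph\<close>)
      finally show ?thesis .
    qed
  qed
  moreover have "\<exists>k\<^sub>0\<ge>1. \<forall>k\<ge>k\<^sub>0. \<forall>W\<in>W0. setdist_1 W R \<ge> ereal \<epsilon> \<longrightarrow> measure (random_graph k W) P \<le> 1 / 3"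
    if \<epsilon>: "\<epsilon> > 0" for \<epsilon> :: real
  proof -
    obtain \<epsilon>' :: real where \<epsilon>': "\<epsilon>' > 0" "B_cut R \<epsilon>' \<subseteq> B_1 R \<epsilon>" using h[OF \<epsilon>] by blast
    \<comment> \<open>The two terms of \<open>near_same_graph\<close> get a third of
      \<open>\<epsilon>'\<close> each, so that their sum stays strictly below it; the second entry
      of the minimum pays for the fourth root.\<close>
    define r where "r = \<epsilon>' / 3"
    define \<delta> where "\<delta> = min (\<epsilon>' / 3) (r ^ 4 / 4)"
    have r: "0 < r" and \<delta>: "0 < \<delta>" "4 * \<delta> \<le> r ^ 4" "\<delta> + r < \<epsilon>'" using \<epsilon>' by (auto simp: r_def \<delta>_def min_def)
    obtain n :: nat where n: "n \<ge> 1" "1 / n \<le> \<delta>"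
    proof -
      obtain n where "inverse (real (Suc n)) < \<delta>" using reals_Archimedean[OF \<delta>(1)] by blast
      then show thesis by (intro that[of "Suc n"]) (auto simp: inverse_eq_divide)
    qed
    have "measure (random_graph k W) P \<le> 1 / 3" if k: "k \<ge> max n (K n)" and W: "W \<in> W0" and far: "setdist_1 W R \<ge> ereal \<epsilon>" for k W
    proof -
      have gW: "graphon W" by (rule W0_graphon[OF W])
      have \<nu>n: "n \<le> \<nu> k" using k by (intro \<nu>ge) auto
      then have \<nu>1: "\<nu> k \<ge> 1" using n(1) by simp
      have "1 / \<nu> k \<le> 1 / n" using \<nu>n n(1) by (intro divide_left_mono) auto
      then have \<nu>\<delta>: "1 / \<nu> k \<le> \<delta>" using n(2) by linarith
      let ?Q = "{G. near_graph W G (1 / \<nu> k)}"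
      \<comment> \<open>A graph near both \<open>W\<close> and an element of \<open>R\<close> would
        put \<open>W\<close> into \<open>B_cut R \<epsilon>'\<close>, hence into
        \<open>B_1 R \<epsilon>\<close>; so nearness to \<open>W\<close> rules out
        acceptance.\<close>
      have "2 / 3 \<le> measure (random_graph k W) ?Q" by (rule K[OF \<nu>1 \<nu>K[OF \<nu>1] gW])
      also have "\<dots> \<le> measure (random_graph k W) (- P)"
      proof (rule prob_random_graph_mono[OF gW])
        fix B assume B: "B \<subseteq> vertex_pairs k" and nW: "edge_graph k B \<in> ?Q"
        show "edge_graph k B \<in> - P"
        proof
          assume "edge_graph k B \<in> P"
          then obtain U where U: "U \<in> R" and nU: "near_graph U (edge_graph k B) (1 / \<nu> k)"
            using \<nu>1 by (auto simp: P_def card)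
          have "setdist_cut W R \<le> ereal (1 / \<nu> k + r)"
          proof (rule near_same_graph[OF _ W R U _ nU])
            show "U \<in> W0" using U RW by blast
            show "finite (fst (edge_graph k B))" by (simp add: edge_graph_def)
            show "near_graph W (edge_graph k B) (1 / \<nu> k)" using nW by simp
            show "4 * (1 / \<nu> k) \<le> r ^ 4" using \<nu>\<delta> \<delta>(2) by linarith
          qed (use r in simp)
          also have "\<dots> < ereal \<epsilon>'" using \<nu>\<delta> \<delta>(3) by simp
          finally have "W \<in> B_cut R \<epsilon>'" using W by (simp add: B_cut_def)
          then have "W \<in> B_1 R \<epsilon>" using \<epsilon>'(2) by blast
          then show False using far by (auto simp: B_1_def dest: leD)
        qed
      qed
      finally have "2 / 3 \<le> measure (random_graph k W) (- P)" .
      moreover have "measure (random_graph k W) P + measure (random_graph k W) (- P) \<le> 1"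
        by (rule prob_random_graph_disjoint[OF gW]) simp
      ultimately show ?thesis by linarith
    qed
    then show ?thesis by (intro exI[of _ "max 1 (max n (K n))"]) auto
  qed
  ultimately show ?thesis unfolding testable_def by blast
qed

theorem theorem3p4:
  fixes R :: "(real \<times> real \<Rightarrow> real) set"
  assumes "graphon_property R"
  shows "testable R \<longleftrightarrow>
    (\<forall>\<epsilon>>0::real. \<exists>\<epsilon>'>0::real. B_cut R \<epsilon>' \<subseteq> B_1 R \<epsilon>)"
  using cut_ball_if_testable[of R] testable_if_cut_ball[OF assms] assms
  by (auto simp: graphon_property_def)

end
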